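(* Let $\Omega$ be an irreducible symmetric cone, realized as the symmetric cone of a Euclidean simple Jordan algebra $\mathbb{E}$ equipped with the canonical scalar product $\langle x,y\rangle=\mathrm{tr}(xy)$. Let $a,b,c,d\colon\Omega\to\mathbb{R}$ be continuous functions such that $$a(x)+b(y)=c\left((x+y)^{-1}\right)+d\left(x^{-1}-(x+y)^{-1}\right)\quad\text{for all }(x,y)\in\Omega^2.$$ Then there exist constants $q\in\mathbb{R}$, $f,g\in\mathbb{E}$ and $\gamma_1,\gamma_2,\gamma_3\in\mathbb{R}$ such that for every $x\in\Omega$, $$a(x)=q\log\det x+\langle f,x\rangle+\langle g,x^{-1}\rangle+\gamma_1+\gamma_3,$$ $$b(x)=-q\log\det x+\langle f,x\rangle+\gamma_2,$$ $$c(x)=q\log\det x+\langle g,x\rangle+\langle f,x^{-1}\rangle+\gamma_3,$$ $$d(x)=-q\log\det x+\langle g,x\rangle+\gamma_1+\gamma_2.$$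
   Context: A Euclidean Jordan algebra is a (finite-dimensional real) Euclidean space $\mathbb{E}$ with scalar product $\langle\cdot,\cdot\rangle$, a bilinear product $(x,y)\mapsto xy$ and a neutral element $e$ such that for all $x,y,z\in\mathbb{E}$: $xy=yx$, $x(x^2y)=x^2(xy)$, $xe=x$, $\langle x,yz\rangle=\langle xy,z\rangle$. It is simple if it is not a Cartesian product of two Euclidean Jordan algebras of positive dimensions. The symmetric cone $\Omega$ of $\mathbb{E}$ is the interior of the set of squares $\overline{\Omega}=\{y^2: y\in\mathbb{E}\}$; irreducible symmetric cones are exactly those arising from simple $\mathbb{E}$. A primitive idempotent is $c\in\mathbb{E}$ with $cc=c\ne0$ which is not a sum of two non-null idempotents. A complete system of primitive orthogonal idempotents is $(c_1,\dots,c_r)$ with $\sum_i c_i=e$ and $c_ic_j=\delta_{ij}c_i$; its size $r$ is a constant called the rank. Every $x\in\mathbb{E}$ can be written $x=\sum_{i=1}^r\lambda_ic_i$ for some such system; the real numbers $\lambda_i$ are the eigenvalues of $x$, $\mathrm{tr}\,x=\sum_i\lambda_i$, $\det x=\prod_i\lambda_i$. One has $x\in\Omega$ iff all eigenvalues are strictly positive. The scalar product is taken to be $\langle x,y\rangle=\mathrm{tr}(xy)$. For $x=\sum_i\lambda_ic_i\in\Omega$ the Jordan inverse is $x^{-1}=\sum_i\lambda_i^{-1}c_i\in\Omega$. If $x,y\in\Omega$ then $x^{-1}-(x+y)^{-1}\in\Omega$. *)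

theory Defs
  imports "HOL-Analysis.Analysis"
begin

text \<open>
  A Euclidean Jordan algebra lives on a linear subspace \<open>V\<close> of a Euclidean space and carries the
  scalar product inherited from it. The ambient algebra is the case \<open>V = UNIV\<close>; proper subspaces
  are needed to speak about the factors of a Cartesian product.
\<close>

locale euclidean_jordan_algebra_on =
  fixes V :: "'a::euclidean_space set"
    and mul :: "'a \<Rightarrow> 'a \<Rightarrow> 'a"  (infixl "\<odot>" 70)
    and e :: 'a
  assumes subspace_carrier: "subspace V"
    and mul_closed: "\<And>x y. \<lbrakk>x \<in> V; y \<in> V\<rbrakk> \<Longrightarrow> x \<odot> y \<in> V"
    and unit_closed: "e \<in> V"
    and mul_add_left: "\<And>x y z. \<lbrakk>x \<in> V; y \<in> V; z \<in> V\<rbrakk> \<Longrightarrow> (x + y) \<odot> z = x \<odot> z + y \<odot> z"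
    and mul_add_right: "\<And>x y z. \<lbrakk>x \<in> V; y \<in> V; z \<in> V\<rbrakk> \<Longrightarrow> x \<odot> (y + z) = x \<odot> y + x \<odot> z"
    and mul_scaleR_left: "\<And>t x y. \<lbrakk>x \<in> V; y \<in> V\<rbrakk> \<Longrightarrow> (t *\<^sub>R x) \<odot> y = t *\<^sub>R (x \<odot> y)"
    and mul_scaleR_right: "\<And>t x y. \<lbrakk>x \<in> V; y \<in> V\<rbrakk> \<Longrightarrow> x \<odot> (t *\<^sub>R y) = t *\<^sub>R (x \<odot> y)"
    and mul_commute: "\<And>x y. \<lbrakk>x \<in> V; y \<in> V\<rbrakk> \<Longrightarrow> x \<odot> y = y \<odot> x"
    and jordan_identity:
      "\<And>x y. \<lbrakk>x \<in> V; y \<in> V\<rbrakk> \<Longrightarrow> x \<odot> ((x \<odot> x) \<odot> y) = (x \<odot> x) \<odot> (x \<odot> y)"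
    and mul_unit: "\<And>x. x \<in> V \<Longrightarrow> x \<odot> e = x"
    and inner_mul: "\<And>x y z. \<lbrakk>x \<in> V; y \<in> V; z \<in> V\<rbrakk> \<Longrightarrow> x \<bullet> (y \<odot> z) = (x \<odot> y) \<bullet> z"

abbreviation euclidean_jordan_algebra :: "('a::euclidean_space \<Rightarrow> 'a \<Rightarrow> 'a) \<Rightarrow> 'a \<Rightarrow> bool"
  where "euclidean_jordan_algebra \<equiv> euclidean_jordan_algebra_on UNIV"

text \<open>
  The algebra is (isomorphic to) the Cartesian product of two Euclidean Jordan algebras of positive
  dimension. The map \<open>\<phi>\<close> is the isomorphism of \<open>V \<times> W\<close>, with componentwise operations and the
  product scalar product, onto the whole algebra. Taking both factors inside the type \<open>'a\<close> is no
  restriction, since their dimensions are smaller than that of the whole algebra. Asking \<open>\<phi>\<close> to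
  be linear on all of \<open>'a \<times> 'a\<close> is none either: a linear map on a subspace extends.
\<close>

definition cartesian_product_decomposable ::
  "('a::euclidean_space \<Rightarrow> 'a \<Rightarrow> 'a) \<Rightarrow> bool"
  where "cartesian_product_decomposable mul \<longleftrightarrow>
    (\<exists>V mulV eV W mulW eW. \<exists>\<phi> :: 'a \<times> 'a \<Rightarrow> 'a.
       euclidean_jordan_algebra_on V mulV eV \<and> 0 < dim V \<and>
       euclidean_jordan_algebra_on W mulW eW \<and> 0 < dim W \<and>
       linear \<phi> \<and> bij_betw \<phi> (V \<times> W) UNIV \<and>
       (\<forall>p \<in> V \<times> W. \<forall>p' \<in> V \<times> W.
          \<phi> (mulV (fst p) (fst p'), mulW (snd p) (snd p')) = mul (\<phi> p) (\<phi> p') \<and>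
          \<phi> p \<bullet> \<phi> p' = p \<bullet> p'))"

definition simple_euclidean_jordan_algebra ::
  "('a::euclidean_space \<Rightarrow> 'a \<Rightarrow> 'a) \<Rightarrow> 'a \<Rightarrow> bool"
  where "simple_euclidean_jordan_algebra mul e \<longleftrightarrow>
    euclidean_jordan_algebra mul e \<and> \<not> cartesian_product_decomposable mul"

definition symmetric_cone :: "('a::euclidean_space \<Rightarrow> 'a \<Rightarrow> 'a) \<Rightarrow> 'a set"
  where "symmetric_cone mul = interior {mul y y | y. True}"

definition primitive_idempotent :: "('a::euclidean_space \<Rightarrow> 'a \<Rightarrow> 'a) \<Rightarrow> 'a \<Rightarrow> bool"
  where "primitive_idempotent mul c \<longleftrightarrow> mul c c = c \<and> c \<noteq> 0 \<and>
    \<not> (\<exists>u v. mul u u = u \<and> u \<noteq> 0 \<and> mul v v = v \<and> v \<noteq> 0 \<and> c = u + v)"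

definition complete_primitive_system ::
  "('a::euclidean_space \<Rightarrow> 'a \<Rightarrow> 'a) \<Rightarrow> 'a \<Rightarrow> nat \<Rightarrow> (nat \<Rightarrow> 'a) \<Rightarrow> bool"
  where "complete_primitive_system mul e r c \<longleftrightarrow>
    (\<forall>i<r. primitive_idempotent mul (c i)) \<and>
    (\<forall>i<r. \<forall>j<r. mul (c i) (c j) = (if i = j then c i else 0)) \<and>
    (\<Sum>i<r. c i) = e"

definition spectral_decomposition ::
  "('a::euclidean_space \<Rightarrow> 'a \<Rightarrow> 'a) \<Rightarrow> 'a \<Rightarrow> 'a \<Rightarrow> nat \<Rightarrow> (nat \<Rightarrow> real) \<Rightarrow> (nat \<Rightarrow> 'a) \<Rightarrow> bool"
  where "spectral_decomposition mul e x r lam c \<longleftrightarrow>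
    complete_primitive_system mul e r c \<and> x = (\<Sum>i<r. lam i *\<^sub>R c i)"

text \<open>
  In a Euclidean Jordan algebra every element has a spectral decomposition, and the three quantities
  below do not depend on which one is used, so the descriptions have a unique solution.
  The inverse is meaningful only if no eigenvalue is zero, in particular on the symmetric cone.
\<close>

definition jordan_tr :: "('a::euclidean_space \<Rightarrow> 'a \<Rightarrow> 'a) \<Rightarrow> 'a \<Rightarrow> 'a \<Rightarrow> real"
  where "jordan_tr mul e x =
    (THE t. \<exists>r lam c. spectral_decomposition mul e x r lam c \<and> t = (\<Sum>i<r. lam i))"

definition jordan_det :: "('a::euclidean_space \<Rightarrow> 'a \<Rightarrow> 'a) \<Rightarrow> 'a \<Rightarrow> 'a \<Rightarrow> real"
  where "jordan_det mul e x =
    (THE t. \<exists>r lam c. spectral_decomposition mul e x r lam c \<and> t = (\<Prod>i<r. lam i))"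

definition jordan_inverse :: "('a::euclidean_space \<Rightarrow> 'a \<Rightarrow> 'a) \<Rightarrow> 'a \<Rightarrow> 'a \<Rightarrow> 'a"
  where "jordan_inverse mul e x =
    (THE y. \<exists>r lam c. spectral_decomposition mul e x r lam c \<and>
       y = (\<Sum>i<r. inverse (lam i) *\<^sub>R c i))"

end

theory Submission
  imports Defs
begin

text \<open>
  Letting \<open>y\<close> tend to infinity in the equation shows that \<open>a x - d (x\<^sup>-\<^sup>1)\<close> is additive up to a
  constant, hence affine. The equation is invariant under the involution
  \<open>(x, y) \<mapsto> ((x + y)\<^sup>-\<^sup>1, x\<^sup>-\<^sup>1 - (x + y)\<^sup>-\<^sup>1)\<close>, so \<open>c u - b (u\<^sup>-\<^sup>1)\<close> is affine as well, and subtracting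
  the affine parts leaves two unknown functions:
  \<open>D ((x\<^sup>-\<^sup>1 - (x + y)\<^sup>-\<^sup>1)\<^sup>-\<^sup>1) - D x = B (x + y) - B y\<close>.
  On a ray this is a one-dimensional equation whose solutions are logarithmic. Replacing \<open>y\<close> by
  \<open>t y\<close> and letting \<open>t\<close> tend to \<open>0\<close> turns the difference of inverses into the derivative
  \<open>P (x\<^sup>-\<^sup>1) y\<close> and yields \<open>F (P x y) = 2 F x + F y\<close> for \<open>F = D - D e = B - B e\<close>.
  Such an \<open>F\<close> is differentiable at \<open>e\<close>, its gradient there commutes with all multiplications, and
  in a simple algebra a central element is a multiple of \<open>e\<close>. Hence \<open>F x = q tr (log x)\<close>.
\<close>

section \<open>Linear algebra preliminaries\<close>

text \<open>The product is not associative and multiplications by different elements need not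
  commute, so the key product identities are derived inside the algebra \<open>gen x\<close> of one
  element, where all multiplications commute. Three obstacles shape the rest. First,
  \<open>P x\<close> must be shown to map the cone into itself; only then is the derivative of the
  inverse negative, so that the argument of d lies in the cone. Second, the coefficient of ln t on a
  ray could depend on the ray; it is constant because otherwise the limit t to 0 would blow up.
  Third, F is only known to be continuous. Powers give a linear bound for F at e, \<open>P\<close>
  transports it to a Lipschitz bound near e, and exponential curves then supply the directional
  derivatives. The trace form enters through e \<bullet> c = 1 for primitive c, which makes e
  \<bullet> ln x the logarithm of the determinant.\<close>

lemma quadratic_nonneg_imp_linear_zero:
  fixes \<alpha> \<beta> :: real
  assumes "\<And>t. 0 \<le> 2 * t * \<alpha> + t\<^sup>2 * \<beta>"
  shows "\<alpha> = 0"
proof (rule ccontr)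
  assume "\<alpha> \<noteq> 0"
  \<comment> \<open>At t = - s \<alpha> the linear term is - 2 s \<alpha>^2, and this size of s
    keeps the quadratic term below s \<alpha>^2.\<close>
  define s where "s = 1 / (\<bar>\<beta>\<bar> + 1)"
  have s: "s > 0" "s * \<beta> < 1"
    unfolding s_def by (auto simp: divide_simps)
  have "0 \<le> 2 * (- s * \<alpha>) * \<alpha> + (- s * \<alpha>)\<^sup>2 * \<beta>" by (rule assms)
  also have "\<dots> = s * \<alpha>\<^sup>2 * (s * \<beta> - 2)" by (simp add: algebra_simps power2_eq_square)
  also have "\<dots> < 0" using s \<open>\<alpha> \<noteq> 0\<close> by (intro mult_pos_neg) auto
  finally show False by simp
qed

text \<open>The form v \<bullet> S v attains its minimum over W at w, so its first variation in the
  direction S w, twice the squared norm of S w, vanishes.\<close>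

lemma psd_kernel:
  fixes S :: "'a::real_inner \<Rightarrow> 'a"
  assumes "linear S" "subspace W" "S ` W \<subseteq> W"
    and sym: "\<And>u v. \<lbrakk>u \<in> W; v \<in> W\<rbrakk> \<Longrightarrow> S u \<bullet> v = u \<bullet> S v"
    and psd: "\<And>v. v \<in> W \<Longrightarrow> 0 \<le> v \<bullet> S v"
    and "w \<in> W" "w \<bullet> S w = 0"
  shows "S w = 0"
proof -
  interpret linear S by fact
  let ?u = "S w"
  have u: "?u \<in> W" using assms by auto
  have "?u \<bullet> S w = 0"
  proof (rule quadratic_nonneg_imp_linear_zero)
    fix t :: real
    have "0 \<le> (w + t *\<^sub>R ?u) \<bullet> S (w + t *\<^sub>R ?u)"
      by (intro psd subspace_add subspace_scale assms u)
    also have "\<dots> = 2 * t * (?u \<bullet> S w) + t\<^sup>2 * (?u \<bullet> S ?u)"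
      using sym[OF assms(6) u] assms(7)
      by (simp add: add scaleR inner_add_left inner_add_right inner_commute power2_eq_square)
    finally show "0 \<le> 2 * t * (?u \<bullet> S w) + t\<^sup>2 * (?u \<bullet> S ?u)" .
  qed
  then show ?thesis by simp
qed

text \<open>A maximiser v of the Rayleigh quotient over the unit vectors of W makes q I - T positive
  semidefinite on W with v isotropic, and \<open>psd_kernel\<close> turns this into the eigenvector
  equation.\<close>

lemma symmetric_eigenvector:
  fixes T :: "'a::euclidean_space \<Rightarrow> 'a"
  assumes T: "linear T" "subspace W" "T ` W \<subseteq> W" "W \<noteq> {0}"
    and sym: "\<And>u v. \<lbrakk>u \<in> W; v \<in> W\<rbrakk> \<Longrightarrow> T u \<bullet> v = u \<bullet> T v"
  obtains v q where "v \<in> W" "v \<noteq> 0" "T v = q *\<^sub>R v"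
proof -
  interpret linear T by fact
  have cont: "continuous_on X T" for X
    using linear_continuous_on linear_conv_bounded_linear T(1) by blast
  let ?K = "sphere 0 1 \<inter> W"
  obtain w where w: "w \<in> W" "w \<noteq> 0" using T(2,4) subspace_0 by blast
  have "w /\<^sub>R norm w \<in> ?K" using w T(2) by (auto intro: subspace_scale)
  moreover have "compact ?K"
    using T(2) by (intro compact_Int_closed closed_subspace) auto
  moreover have "continuous_on ?K (\<lambda>v. v \<bullet> T v)"
    by (intro continuous_intros cont)
  ultimately obtain v where v: "v \<in> ?K" and max: "\<And>u. u \<in> ?K \<Longrightarrow> u \<bullet> T u \<le> v \<bullet> T v"
    using continuous_attains_sup[of ?K "\<lambda>v. v \<bullet> T v"] by blast
  define q where "q = v \<bullet> T v"
  have le: "u \<bullet> T u \<le> q * (u \<bullet> u)" if u: "u \<in> W" for u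
  proof (cases "u = 0")
    case False
    have "(u /\<^sub>R norm u) \<bullet> T (u /\<^sub>R norm u) \<le> q"
      unfolding q_def using u False T(2) by (intro max) (auto intro: subspace_scale)
    then show ?thesis using False
      by (simp add: scaleR divide_simps power2_norm_eq_inner[symmetric] power2_eq_square)
  qed simp
  have "q *\<^sub>R v - T v = 0"
  proof (rule psd_kernel[of "\<lambda>u. q *\<^sub>R u - T u" W])
    show "linear (\<lambda>u. q *\<^sub>R u - T u)"
      by (intro linear_compose_sub linear_compose_scale_right linear_ident T(1))
    show "(\<lambda>u. q *\<^sub>R u - T u) ` W \<subseteq> W"
      using T by (auto intro!: subspace_diff subspace_scale)
    show "v \<bullet> (q *\<^sub>R v - T v) = 0"
      using v by (simp add: inner_diff_right q_def power2_norm_eq_inner[symmetric])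
  qed (use T v le sym in \<open>auto simp: inner_diff_left inner_diff_right\<close>)
  then show ?thesis using v by (intro that[of v q]) auto
qed

section \<open>Powers and functional calculus in a Euclidean Jordan algebra\<close>

locale eja = euclidean_jordan_algebra_on UNIV mul e
  for mul :: "'a::euclidean_space \<Rightarrow> 'a \<Rightarrow> 'a"  (infixl "\<odot>" 70) and e :: 'a
begin

lemma bilinear_mul: "bilinear (\<odot>)"
  unfolding bilinear_def
  by (auto intro!: linearI simp: mul_add_left mul_add_right mul_scaleR_left mul_scaleR_right)

sublocale prod: bounded_bilinear "(\<odot>)"
  using bilinear_mul bilinear_conv_bounded_bilinear by blast

lemmas bilin = prod.add_left prod.add_right prod.diff_left prod.diff_right
  prod.scaleR_left prod.scaleR_right prod.minus_left prod.minus_right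
  prod.zero_left prod.zero_right

lemma comm: "x \<odot> y = y \<odot> x" by (rule mul_commute) auto

lemma unit_right [simp]: "x \<odot> e = x" by (rule mul_unit) auto

lemma unit_left [simp]: "e \<odot> x = x" using comm[of e x] by simp

lemma jordan: "x \<odot> ((x \<odot> x) \<odot> y) = (x \<odot> x) \<odot> (x \<odot> y)"
  by (rule jordan_identity) auto

lemma inner_assoc: "x \<bullet> (y \<odot> z) = (x \<odot> y) \<bullet> z" by (rule inner_mul) auto

lemma L_sym: "(x \<odot> u) \<bullet> v = u \<bullet> (x \<odot> v)"
  using inner_assoc[of u x v] comm[of u x] by simp

lemma linear_L: "linear ((\<odot>) x)"
  by (intro linearI) (auto simp: bilin)

lemma scaleR_4: "4 *\<^sub>R (x::'b::real_vector) = x + x + (x + x)"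
  using scaleR_left_distrib[of 2 2 x] by (simp add: scaleR_2)

text \<open>The coefficient of \<open>t\<close> in the Jordan identity for \<open>x + t z\<close>; it is isolated by
  subtracting the identities for \<open>t = 1\<close> and \<open>t = - 1\<close>.\<close>

lemma jordan_linearised:
  "(x \<odot> x \<odot> y) \<odot> z =
    2 *\<^sub>R (x \<odot> y \<odot> (x \<odot> z)) + (x \<odot> x) \<odot> (y \<odot> z) - 2 *\<^sub>R (x \<odot> (y \<odot> (x \<odot> z)))"
proof -
  note j1 = jordan[of "x + z" y] and j2 = jordan[of "x - z" y]
  note jx = jordan[of x y] and jz = jordan[of z y]
  have "4 *\<^sub>R (x \<odot> ((x \<odot> z) \<odot> y)) + 2 *\<^sub>R (z \<odot> ((x \<odot> x) \<odot> y))
      = 4 *\<^sub>R ((x \<odot> z) \<odot> (x \<odot> y)) + 2 *\<^sub>R ((x \<odot> x) \<odot> (z \<odot> y))"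
    using arg_cong2[OF j1 j2, of "(-)"] jz comm[of z x]
    by (simp add: bilin algebra_simps scaleR_4 scaleR_2)
  then have "2 *\<^sub>R (2 *\<^sub>R (x \<odot> ((x \<odot> z) \<odot> y)) + (z \<odot> ((x \<odot> x) \<odot> y)))
      = 2 *\<^sub>R (2 *\<^sub>R ((x \<odot> z) \<odot> (x \<odot> y)) + ((x \<odot> x) \<odot> (z \<odot> y)))"
    by (simp add: scaleR_add_right)
  then have "2 *\<^sub>R (x \<odot> ((x \<odot> z) \<odot> y)) + (z \<odot> ((x \<odot> x) \<odot> y))
      = 2 *\<^sub>R ((x \<odot> z) \<odot> (x \<odot> y)) + ((x \<odot> x) \<odot> (z \<odot> y))"
    by (metis scaleR_cancel_left zero_neq_numeral)
  then show ?thesis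
    using comm[of y "x \<odot> z"] comm[of z "x \<odot> x \<odot> y"] comm[of "x \<odot> z" "x \<odot> y"] comm[of z y]
    by (simp add: algebra_simps)
qed


section \<open>Powers and the associative algebra generated by one element\<close>

primrec pow :: "'a \<Rightarrow> nat \<Rightarrow> 'a" where
  "pow x 0 = e"
| "pow x (Suc n) = x \<odot> pow x n"

text \<open>The polynomials in x. Closure of this span under the product, \<open>gen_mult\<close>,
  rests on power associativity, \<open>pow_add\<close>.\<close>

definition gen :: "'a \<Rightarrow> 'a set"
  where "gen x = span (range (pow x))"

lemma square_mult_pow: "(x \<odot> x) \<odot> pow x n = pow x (Suc (Suc n))"
  by (induction n) (simp_all add: jordan[symmetric])

text \<open>\<open>jordan_linearised\<close> with y = \<open>pow x n\<close> expresses
  multiplication by the power n + 2 through multiplications by x, by x \<odot> x and by the powers n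
  and n + 1; commuting with T is therefore inherited.\<close>

lemma commutes_with_pow:
  assumes "linear T" "\<And>v. T (x \<odot> v) = x \<odot> T v" "\<And>v. T ((x \<odot> x) \<odot> v) = (x \<odot> x) \<odot> T v"
  shows "T (pow x n \<odot> v) = pow x n \<odot> T v"
proof (induction n arbitrary: v rule: induct_nat_012)
  case (ge2 n)
  interpret linear T by fact
  have eq: "pow x (Suc (Suc n)) \<odot> w = 2 *\<^sub>R (pow x (Suc n) \<odot> (x \<odot> w)) + (x \<odot> x) \<odot> (pow x n \<odot> w)
      - 2 *\<^sub>R (x \<odot> (pow x n \<odot> (x \<odot> w)))" for w
    using jordan_linearised[of x "pow x n" w] square_mult_pow[of x n] by simp
  show ?case unfolding eq using ge2 assms(2,3) by (simp add: add diff scaleR)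
qed (use assms in simp_all)

text \<open>Two rounds of \<open>commutes_with_pow\<close>: first T is multiplication by x or by its
  square, then T is multiplication by a power.\<close>

lemma pow_commute: "pow x m \<odot> (pow x n \<odot> v) = pow x n \<odot> (pow x m \<odot> v)"
proof -
  have "x \<odot> (pow x n \<odot> v) = pow x n \<odot> (x \<odot> v)" for n v
    by (rule commutes_with_pow) (auto simp: linear_L jordan)
  moreover have "(x \<odot> x) \<odot> (pow x n \<odot> v) = pow x n \<odot> ((x \<odot> x) \<odot> v)" for n v
    by (rule commutes_with_pow) (auto simp: linear_L jordan)
  ultimately show ?thesis
    by (intro commutes_with_pow[symmetric]) (auto simp: linear_L jordan)
qed

lemma pow_add: "pow x m \<odot> pow x n = pow x (m + n)"
proof (induction m)
  case (Suc m)
  have "pow x (Suc m) \<odot> pow x n = pow x n \<odot> (x \<odot> pow x m)" by (simp add: comm)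
  also have "\<dots> = x \<odot> (pow x n \<odot> pow x m)"
    using pow_commute[of x n 1 "pow x m"] by simp
  also have "\<dots> = pow x (Suc m + n)" using Suc comm by simp
  finally show ?case .
qed simp

lemma subspace_gen [simp]: "subspace (gen x)"
  unfolding gen_def by simp

lemma pow_in_gen [simp]: "pow x n \<in> gen x"
  unfolding gen_def by (simp add: span_base)

lemma unit_in_gen [simp]: "e \<in> gen x" using pow_in_gen[of x 0] by simp

lemma self_in_gen [simp]: "x \<in> gen x" using pow_in_gen[of x 1] by simp

lemma gen_induct [consumes 1, case_names subspace pow]:
  assumes "a \<in> gen x" "subspace {a. P a}" "\<And>n. P (pow x n)"
  shows "P a"
  using assms span_induct[of a "range (pow x)" P] unfolding gen_def by auto

text \<open>Here v is arbitrary, so the operators commute on the whole algebra. Associativity of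
  \<open>gen x\<close> is the case of v in \<open>gen x\<close>.\<close>

lemma gen_commute:
  assumes "a \<in> gen x" "b \<in> gen x"
  shows "a \<odot> (b \<odot> v) = b \<odot> (a \<odot> v)"
  using assms(1)
proof (induction rule: gen_induct)
  case (pow m)
  show ?case using assms(2)
    by (induction rule: gen_induct) (auto simp: subspace_def bilin pow_commute)
qed (auto simp: subspace_def bilin)

lemma gen_mult [simp]:
  assumes "a \<in> gen x" "b \<in> gen x"
  shows "a \<odot> b \<in> gen x"
  using assms(1)
proof (induction rule: gen_induct)
  case (pow m)
  show ?case using assms(2)
    by (induction rule: gen_induct)
      (auto simp: subspace_def bilin pow_add intro: subspace_add[OF subspace_gen] subspace_scale[OF subspace_gen] subspace_0[OF subspace_gen])
qed (auto simp: subspace_def bilin intro: subspace_add[OF subspace_gen] subspace_scale[OF subspace_gen] subspace_0[OF subspace_gen])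

lemma gen_assoc:
  assumes "a \<in> gen x" "b \<in> gen x" "c \<in> gen x"
  shows "(a \<odot> b) \<odot> c = a \<odot> (b \<odot> c)"
  using gen_commute[of c x a b] assms by (simp add: comm)

text \<open>Indexed, so that it covers sets of idempotents (c the identity) as well as the numbered
  systems of \<open>complete_primitive_system\<close>. Zero members are allowed;
  \<open>0 \<notin> S\<close> is stated separately where signs of eigenvalues are read off.\<close>

definition idem_system :: "'i set \<Rightarrow> ('i \<Rightarrow> 'a) \<Rightarrow> bool"
  where "idem_system I c \<longleftrightarrow> finite I \<and>
    (\<forall>i\<in>I. \<forall>j\<in>I. c i \<odot> c j = (if i = j then c i else 0)) \<and> sum c I = e"

lemma idem_systemD:
  assumes "idem_system I c"
  shows "finite I" "\<And>i. i \<in> I \<Longrightarrow> c i \<odot> c i = c i"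
    "\<And>i j. \<lbrakk>i \<in> I; j \<in> I; i \<noteq> j\<rbrakk> \<Longrightarrow> c i \<odot> c j = 0" "sum c I = e"
  using assms unfolding idem_system_def by auto

lemma idem_inner: "c \<odot> c = c \<Longrightarrow> x \<bullet> c = (x \<odot> c) \<bullet> c"
  using inner_assoc[of x c c] by simp

lemma orth_inner: "c \<odot> d = 0 \<Longrightarrow> c \<bullet> d = 0"
  using inner_assoc[of c d e] by simp

lemma system_mult_idem:
  assumes "idem_system I c" "j \<in> I"
  shows "(\<Sum>i\<in>I. lam i *\<^sub>R c i) \<odot> c j = lam j *\<^sub>R c j"
proof -
  have "(\<Sum>i\<in>I. lam i *\<^sub>R c i) \<odot> c j = (\<Sum>i\<in>I. if i = j then lam j *\<^sub>R c j else 0)"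
    unfolding prod.sum_left
    by (intro sum.cong) (use assms in \<open>auto simp: bilin idem_systemD\<close>)
  then show ?thesis using assms idem_systemD(1)[OF assms(1)] by simp
qed

lemma system_mult:
  assumes "idem_system I c"
  shows "(\<Sum>i\<in>I. lam i *\<^sub>R c i) \<odot> (\<Sum>i\<in>I. mu i *\<^sub>R c i) = (\<Sum>i\<in>I. (lam i * mu i) *\<^sub>R c i)"
  unfolding prod.sum_right
  by (intro sum.cong) (auto simp: bilin system_mult_idem[OF assms] mult.commute)

lemma system_inner:
  assumes "idem_system I c"
  shows "(\<Sum>i\<in>I. lam i *\<^sub>R c i) \<bullet> (\<Sum>i\<in>I. mu i *\<^sub>R c i) = (\<Sum>i\<in>I. lam i * mu i * (c i \<bullet> c i))"
  unfolding inner_sum_right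
proof (intro sum.cong refl)
  fix j assume j: "j \<in> I"
  have "c j \<odot> c j = c j" using idem_systemD(2)[OF assms j] .
  then show "(\<Sum>i\<in>I. lam i *\<^sub>R c i) \<bullet> mu j *\<^sub>R c j = lam j * mu j * (c j \<bullet> c j)"
    using idem_inner[of "c j" "\<Sum>i\<in>I. lam i *\<^sub>R c i"] system_mult_idem[OF assms j] by simp
qed

text \<open>Both sides agree because the squared norm of their difference is
  \<open>\<Sum>i j. (f (lam i) - f (mu j))\<^sup>2 * (c i \<bullet> d j)\<close>, and idempotents belonging to
  different eigenvalues of \<open>x\<close> are orthogonal.\<close>

lemma functional_calculus_unique:
  assumes I: "idem_system I c" and J: "idem_system J d"
    and eq: "(\<Sum>i\<in>I. lam i *\<^sub>R c i) = (\<Sum>j\<in>J. mu j *\<^sub>R d j)"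
  shows "(\<Sum>i\<in>I. f (lam i) *\<^sub>R c i) = (\<Sum>j\<in>J. f (mu j) *\<^sub>R d j)"
proof -
  define x where "x = (\<Sum>i\<in>I. lam i *\<^sub>R c i)"
  have fin: "finite I" "finite J" using I J idem_systemD by auto
  let ?u = "\<Sum>i\<in>I. f (lam i) *\<^sub>R c i" and ?v = "\<Sum>j\<in>J. f (mu j) *\<^sub>R d j"
  have orth: "c i \<bullet> d j = 0" if "i \<in> I" "j \<in> J" "lam i \<noteq> mu j" for i j
  proof -
    have "x \<odot> c i = lam i *\<^sub>R c i" "x \<odot> d j = mu j *\<^sub>R d j"
      using system_mult_idem[OF I that(1), of lam] system_mult_idem[OF J that(2), of mu]
      unfolding x_def by (simp_all only: eq)
    then have "lam i * (c i \<bullet> d j) = mu j * (c i \<bullet> d j)"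
      using L_sym[of x "c i" "d j"] by simp
    then show ?thesis using that by simp
  qed
  have uu: "?u \<bullet> ?u = (\<Sum>i\<in>I. \<Sum>j\<in>J. (f (lam i))\<^sup>2 * (c i \<bullet> d j))"
  proof -
    have "c i \<bullet> c i = (\<Sum>j\<in>J. c i \<bullet> d j)" if "i \<in> I" for i
      using idem_inner[of "c i" e] idem_systemD(2)[OF I that] idem_systemD(4)[OF J]
        inner_sum_right[of "c i" d J] by (simp add: inner_commute)
    then show ?thesis unfolding system_inner[OF I]
      by (intro sum.cong) (auto simp: sum_distrib_left power2_eq_square)
  qed
  have vv: "?v \<bullet> ?v = (\<Sum>i\<in>I. \<Sum>j\<in>J. (f (mu j))\<^sup>2 * (c i \<bullet> d j))"
  proof -
    have "d j \<bullet> d j = (\<Sum>i\<in>I. c i \<bullet> d j)" if "j \<in> J" for j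
      using idem_inner[of "d j" e] idem_systemD(2)[OF J that] idem_systemD(4)[OF I]
        inner_sum_left[of c I "d j"] by simp
    then show ?thesis unfolding system_inner[OF J] sum.swap[of _ J I]
      by (intro sum.cong) (auto simp: sum_distrib_left power2_eq_square)
  qed
  have uv: "?u \<bullet> ?v = (\<Sum>i\<in>I. \<Sum>j\<in>J. f (lam i) * f (mu j) * (c i \<bullet> d j))"
    unfolding inner_sum_left by (simp add: inner_sum_right sum_distrib_left mult.assoc mult.left_commute)
  have "(?u - ?v) \<bullet> (?u - ?v) = ?u \<bullet> ?u - 2 * (?u \<bullet> ?v) + ?v \<bullet> ?v"
    by (simp add: inner_diff_left inner_diff_right inner_commute)
  also have "\<dots> = (\<Sum>i\<in>I. \<Sum>j\<in>J. (f (lam i) - f (mu j))\<^sup>2 * (c i \<bullet> d j))"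
    unfolding uu vv uv sum_distrib_left
    by (simp add: power2_diff algebra_simps sum.distrib sum_subtractf)
  also have "\<dots> = 0"
  proof (intro sum.neutral ballI)
    fix i j assume "i \<in> I" "j \<in> J"
    then show "(f (lam i) - f (mu j))\<^sup>2 * (c i \<bullet> d j) = 0"
      using orth[of i j] by (cases "lam i = mu j") simp_all
  qed
  finally show ?thesis by simp
qed

section \<open>Spectral theorem and functional calculus\<close>

lemma independent_idempotents:
  assumes "\<And>c d. \<lbrakk>c \<in> S; d \<in> S\<rbrakk> \<Longrightarrow> c \<odot> d = (if c = d then c else 0)" "0 \<notin> S"
  shows "finite S" "card S \<le> DIM('a)"
proof -
  have "pairwise orthogonal S"
    using assms orth_inner by (auto simp: pairwise_def orthogonal_def)
  then have "independent S" using assms pairwise_orthogonal_independent by blast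
  then show "finite S" "card S \<le> DIM('a)" using independent_bound by auto
qed

text \<open>Take orthogonal eigenvector idempotents in \<open>gen x\<close>, as many as possible;
  \<open>independent_idempotents\<close> bounds their number. If they do not sum to e, their
  annihilator W in \<open>gen x\<close> is nonzero and invariant, and an eigenvector found there can
  be normalised to one more idempotent.\<close>

lemma spectral_gen_aux:
  "\<exists>S\<subseteq>gen x. idem_system S (\<lambda>c. c) \<and> 0 \<notin> S \<and> (\<forall>c\<in>S. \<exists>q. x \<odot> c = q *\<^sub>R c)"
proof -
  define good where "good S \<longleftrightarrow> S \<subseteq> gen x \<and> 0 \<notin> S \<and>
    (\<forall>c\<in>S. \<forall>d\<in>S. c \<odot> d = (if c = d then c else 0)) \<and> (\<forall>c\<in>S. \<exists>q. x \<odot> c = q *\<^sub>R c)" for S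
  have bound: "finite S" "card S < Suc DIM('a)" if "good S" for S
    using independent_idempotents[of S] that unfolding good_def by (auto simp: less_Suc_eq_le)
  have "good {}" by (auto simp: good_def)
  then obtain S where S: "good S" and max: "\<And>T. good T \<Longrightarrow> card T \<le> card S"
    using ex_has_greatest_nat[of good "{}" card "Suc DIM('a)"] bound by blast
  note Sp = S[unfolded good_def]
  have "(\<Sum>c\<in>S. c) = e"
  proof (rule ccontr)
    assume ne: "(\<Sum>c\<in>S. c) \<noteq> e"
    define W where "W = {a \<in> gen x. \<forall>c\<in>S. c \<odot> a = 0}"
    have W: "subspace W"
      using subspace_gen[of x] by (auto simp: W_def subspace_def bilin)
    have "e - (\<Sum>c\<in>S. c) \<in> W"
    proof -
      have "c \<odot> (\<Sum>d\<in>S. d) = c" if "c \<in> S" for c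
      proof -
        have "c \<odot> (\<Sum>d\<in>S. d) = (\<Sum>d\<in>S. if c = d then c else 0)"
          unfolding prod.sum_right using Sp that by (intro sum.cong) auto
        then show ?thesis using that bound[OF S] by simp
      qed
      moreover have "(\<Sum>c\<in>S. c) \<in> gen x" using Sp by (intro subspace_sum) auto
      ultimately show ?thesis by (auto simp: W_def bilin intro: subspace_diff)
    qed
    then have "W \<noteq> {0}" using ne by auto
    moreover have "(\<odot>) x ` W \<subseteq> W"
      using Sp gen_commute[of _ x x] by (fastforce simp: W_def bilin)
    ultimately obtain v q where v: "v \<in> W" "v \<noteq> 0" "x \<odot> v = q *\<^sub>R v"
      using symmetric_eigenvector[OF linear_L W] L_sym by metis
    have vg: "v \<in> gen x" using v W_def by auto
    \<comment> \<open>An eigenvector lying in \<open>gen x\<close> is an eigenvector of every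
      polynomial in x, in particular of multiplication by v itself.\<close>
    have "\<exists>\<mu>. v \<odot> a = \<mu> *\<^sub>R v" if "a \<in> gen x" for a using that
    proof (induction rule: gen_induct)
      case subspace
      show ?case unfolding subspace_def
      proof (safe, goal_cases)
        case 1 show ?case by (rule exI[of _ 0]) (simp add: bilin)
      next
        case (2 _ _ s t) then show ?case by (intro exI[of _ "s + t"]) (simp add: bilin scaleR_add_left)
      next
        case (3 r _ s) then show ?case by (intro exI[of _ "r * s"]) (simp add: bilin)
      qed
    next
      case (pow n)
      have "v \<odot> pow x n = q ^ n *\<^sub>R v"
      proof (induction n)
        case (Suc n)
        have "v \<odot> pow x (Suc n) = x \<odot> (v \<odot> pow x n)" using gen_commute[of v x x] vg by simp
        then show ?case using Suc v by (simp add: bilin mult.commute)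
      qed simp
      then show ?case by blast
    qed
    then obtain \<mu> where \<mu>: "v \<odot> v = \<mu> *\<^sub>R v" using vg by blast
    \<comment> \<open>Pairing v \<odot> v with e gives v \<bullet> v, which excludes a nilpotent
      v.\<close>
    have "\<mu> * (v \<bullet> e) = v \<bullet> v" using \<mu> inner_assoc[of v v e] by (metis inner_scaleR_left unit_right)
    then have "\<mu> \<noteq> 0" using v by auto
    define c where "c = v /\<^sub>R \<mu>"
    have c: "c \<odot> c = c" "c \<noteq> 0" "x \<odot> c = q *\<^sub>R c" "c \<in> W"
      using \<mu> \<open>\<mu> \<noteq> 0\<close> v W by (auto simp: c_def bilin subspace_scale)
    have cd: "c \<odot> d = 0" "d \<odot> c = 0" if "d \<in> S" for d
      using c(4) that comm[of c d] by (auto simp: W_def)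
    then have "good (insert c S)"
      using Sp c cd by (auto simp: good_def W_def)
    moreover have "c \<notin> S" using c(1,2) cd by auto
    ultimately show False using max[of "insert c S"] bound[OF S] by simp
  qed
  then show ?thesis using Sp bound[OF S] by (intro exI[of _ S]) (auto simp: idem_system_def)
qed

lemma eigen_system_sum:
  assumes "idem_system I c" "\<And>i. i \<in> I \<Longrightarrow> x \<odot> c i = lam i *\<^sub>R c i"
  shows "x = (\<Sum>i\<in>I. lam i *\<^sub>R c i)"
proof -
  have "x = x \<odot> (\<Sum>i\<in>I. c i)" using idem_systemD(4)[OF assms(1)] by simp
  also have "\<dots> = (\<Sum>i\<in>I. lam i *\<^sub>R c i)" unfolding prod.sum_right using assms by (intro sum.cong) auto
  finally show ?thesis .
qed

lemma spectral_gen: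
  obtains S lam where "S \<subseteq> gen x" "idem_system S (\<lambda>c. c)" "0 \<notin> S" "x = (\<Sum>c\<in>S. lam c *\<^sub>R c)"
proof -
  obtain S where S: "S \<subseteq> gen x" "idem_system S (\<lambda>c. c)" "0 \<notin> S" "\<forall>c\<in>S. \<exists>q. x \<odot> c = q *\<^sub>R c"
    using spectral_gen_aux by blast
  then obtain lam where "\<And>c. c \<in> S \<Longrightarrow> x \<odot> c = lam c *\<^sub>R c" by metis
  then show thesis using that[OF S(1-3)] eigen_system_sum[OF S(2)] by blast
qed

text \<open>\<open>functional_calculus_unique\<close> makes the description well defined. By
  \<open>fcalc_eq\<close> the value may be computed from any system, primitive or not, with repeated
  eigenvalues allowed.\<close>

definition fcalc :: "(real \<Rightarrow> real) \<Rightarrow> 'a \<Rightarrow> 'a" where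
  "fcalc f x = (THE y. \<exists>S lam. idem_system S (\<lambda>c. c) \<and> x = (\<Sum>c\<in>S. lam c *\<^sub>R c) \<and>
    y = (\<Sum>c\<in>S. f (lam c) *\<^sub>R c))"

lemma fcalc_eq:
  assumes "idem_system I c"
  shows "fcalc f (\<Sum>i\<in>I. lam i *\<^sub>R c i) = (\<Sum>i\<in>I. f (lam i) *\<^sub>R c i)"
proof -
  obtain S mu where S: "idem_system S (\<lambda>c. c)" "(\<Sum>i\<in>I. lam i *\<^sub>R c i) = (\<Sum>c\<in>S. mu c *\<^sub>R c)"
    using spectral_gen by metis
  show ?thesis unfolding fcalc_def
  proof (rule the_equality)
    show "\<exists>S mu. idem_system S (\<lambda>c. c) \<and> (\<Sum>i\<in>I. lam i *\<^sub>R c i) = (\<Sum>c\<in>S. mu c *\<^sub>R c) \<and>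
      (\<Sum>i\<in>I. f (lam i) *\<^sub>R c i) = (\<Sum>c\<in>S. f (mu c) *\<^sub>R c)"
      using functional_calculus_unique[OF assms S(1) S(2)] S by blast
  next
    fix y assume "\<exists>S mu. idem_system S (\<lambda>c. c) \<and> (\<Sum>i\<in>I. lam i *\<^sub>R c i) = (\<Sum>c\<in>S. mu c *\<^sub>R c) \<and>
      y = (\<Sum>c\<in>S. f (mu c) *\<^sub>R c)"
    then obtain S mu where "idem_system S (\<lambda>c. c)"
      "(\<Sum>i\<in>I. lam i *\<^sub>R c i) = (\<Sum>c\<in>S. mu c *\<^sub>R c)" "y = (\<Sum>c\<in>S. f (mu c) *\<^sub>R c)"
      by blast
    then show "y = (\<Sum>i\<in>I. f (lam i) *\<^sub>R c i)"
      using functional_calculus_unique[OF assms, of S "\<lambda>c. c" lam mu f] by simp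
  qed
qed

section \<open>Positivity of idempotents and refinement to primitive systems\<close>

lemma L_idem_psd:
  assumes "c \<odot> c = c"
  shows "0 \<le> v \<bullet> (c \<odot> v)"
proof -
  text \<open>The Peirce identity \<open>2L\<^sup>3 - 3L\<^sup>2 + L = 0\<close> gives \<open>L = L\<^sup>2 + 4(L - L\<^sup>2)\<^sup>2\<close>.\<close>
  let ?L = "(\<odot>) c"
  have cubic: "2 *\<^sub>R ?L (?L (?L w)) = 3 *\<^sub>R ?L (?L w) - ?L w" for w
    using jordan_linearised[of c c w] assms scaleR_left_distrib[of 2 1 "?L (?L w)"]
    by (simp add: algebra_simps)
  define p where "p = v \<bullet> ?L v"
  define q where "q = v \<bullet> ?L (?L v)"
  define r where "r = v \<bullet> ?L (?L (?L v))"
  define s where "s = v \<bullet> ?L (?L (?L (?L v)))"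
  have 1: "2 * r = 3 * q - p"
    using arg_cong[OF cubic[of v], of "\<lambda>w. v \<bullet> w"] by (simp add: p_def q_def r_def inner_diff_right)
  have 2: "2 * s = 3 * r - q"
    using arg_cong[OF cubic[of "?L v"], of "\<lambda>w. v \<bullet> w"] by (simp add: s_def q_def r_def inner_diff_right)
  have 3: "?L v \<bullet> ?L v = q" "(?L v - ?L (?L v)) \<bullet> (?L v - ?L (?L v)) = q - 2 * r + s"
    by (simp_all add: q_def r_def s_def inner_diff_left inner_diff_right L_sym inner_commute)
  have "v \<bullet> ?L v = q + 4 * (q - 2 * r + s)" using 1 2 by (simp add: p_def)
  moreover have "0 \<le> q" "0 \<le> q - 2 * r + s" using 3 inner_ge_zero by metis+
  ultimately show ?thesis by simp
qed

lemma psd_L_kernel: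
  assumes "\<And>v. 0 \<le> v \<bullet> (c \<odot> v)" "w \<bullet> (c \<odot> w) = 0"
  shows "c \<odot> w = 0"
  by (rule psd_kernel[of _ UNIV]) (use assms in \<open>auto simp: linear_L L_sym\<close>)

lemma idempotent_summands_orthogonal:
  assumes "u \<odot> u = u" "v \<odot> v = v" "(u + v) \<odot> (u + v) = u + v"
  shows "u \<odot> v = 0"
proof -
  have "2 *\<^sub>R (u \<odot> v) = 0" using assms comm[of v u] by (simp add: bilin scaleR_2)
  then show ?thesis by simp
qed

text \<open>The nonnegative numbers w \<bullet> (u \<odot> w) and w \<bullet> (v \<odot> w) add up
  to 0, so both vanish and w lies in the kernel of multiplication by u. Thus the pieces of a split
  idempotent stay orthogonal to the rest of a system.\<close>

lemma summand_orthogonal: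
  assumes "u \<odot> u = u" "v \<odot> v = v" "w \<odot> w = w" "(u + v) \<odot> w = 0"
  shows "u \<odot> w = 0"
proof (rule psd_L_kernel)
  have "w \<bullet> (u \<odot> w) + w \<bullet> (v \<odot> w) = 0"
    using assms(4) by (simp add: bilin flip: inner_add_right)
  then show "w \<bullet> (u \<odot> w) = 0"
    using L_idem_psd[OF assms(1), of w] L_idem_psd[OF assms(2), of w] by linarith
qed (use L_idem_psd assms in auto)

text \<open>Splitting a non-primitive member keeps its eigenvalue and enlarges the system, so a
  system of eigenvectors of maximal size is primitive. In contrast to \<open>spectral_gen\<close>,
  its members may leave \<open>gen x\<close>.\<close>

lemma primitive_spectral:
  obtains S lam where "idem_system S (\<lambda>c. c)" "\<And>c. c \<in> S \<Longrightarrow> primitive_idempotent (\<odot>) c"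
    "x = (\<Sum>c\<in>S. lam c *\<^sub>R c)"
proof -
  define good where "good S \<longleftrightarrow> idem_system S (\<lambda>c. c) \<and> 0 \<notin> S \<and> (\<forall>c\<in>S. \<exists>q. x \<odot> c = q *\<^sub>R c)" for S
  have bound: "finite S" "card S < Suc DIM('a)" if "good S" for S
    using independent_idempotents[of S] that unfolding good_def idem_system_def by (auto simp: less_Suc_eq_le)
  obtain S0 where "good S0" unfolding good_def using spectral_gen_aux by blast
  then obtain S where S: "good S" and max: "\<And>T. good T \<Longrightarrow> card T \<le> card S"
    using ex_has_greatest_nat[of good S0 card "Suc DIM('a)"] bound by blast
  have sys: "idem_system S (\<lambda>c. c)" and ev: "\<And>c. c \<in> S \<Longrightarrow> \<exists>q. x \<odot> c = q *\<^sub>R c" and nz: "0 \<notin> S"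
    using S by (auto simp: good_def)
  note sysD = idem_systemD[OF sys]
  from ev obtain lam where lam: "\<And>c. c \<in> S \<Longrightarrow> x \<odot> c = lam c *\<^sub>R c" by metis
  have x: "x = (\<Sum>c\<in>S. lam c *\<^sub>R c)" using eigen_system_sum[OF sys] lam by blast
  have "primitive_idempotent (\<odot>) c" if c: "c \<in> S" for c
  proof (rule ccontr)
    assume "\<not> ?thesis"
    then obtain u v where uv: "u \<odot> u = u" "u \<noteq> 0" "v \<odot> v = v" "v \<noteq> 0" "c = u + v"
      using sysD(2)[OF c] c nz unfolding primitive_idempotent_def by metis
    have o: "u \<odot> v = 0" "v \<odot> u = 0"
      using idempotent_summands_orthogonal[of u v] sysD(2)[OF c] uv comm by auto
    have ow: "u \<odot> w = 0" "v \<odot> w = 0" if "w \<in> S - {c}" for w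
    proof -
      have w: "w \<odot> w = w" "c \<odot> w = 0" using that c sysD(2,3) by auto
      then show "u \<odot> w = 0" "v \<odot> w = 0"
        using summand_orthogonal[of u v w] summand_orthogonal[of v u w] uv by (simp_all add: add.commute)
    qed
    then have wo: "w \<odot> u = 0" "w \<odot> v = 0" if "w \<in> S - {c}" for w
      using that comm[of w u] comm[of w v] by auto
    let ?T = "insert u (insert v (S - {c}))"
    have nin: "u \<notin> S - {c}" "v \<notin> S - {c}" "u \<noteq> v" using ow[of u] ow[of v] uv o by auto
    have eigen: "x \<odot> w = lam c *\<^sub>R w" if w: "c \<odot> w = w" "\<And>d. d \<in> S - {c} \<Longrightarrow> d \<odot> w = 0" for w
    proof -
      have "x \<odot> w = (\<Sum>d\<in>S. lam d *\<^sub>R (d \<odot> w))" by (subst x) (simp add: prod.sum_left bilin)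
      also have "\<dots> = (\<Sum>d\<in>S. if d = c then lam c *\<^sub>R w else 0)" using w by (intro sum.cong) auto
      finally show ?thesis using c sysD(1) by simp
    qed
    have "good ?T"
      unfolding good_def idem_system_def
    proof (intro conjI)
      show "sum (\<lambda>c. c) ?T = e"
        using nin sysD(1,4) sum.remove[OF sysD(1) c, of "\<lambda>c. c"] uv(5) by (simp add: add.assoc)
      show "\<forall>d\<in>?T. \<exists>q. x \<odot> d = q *\<^sub>R d"
        using ev eigen[of u] eigen[of v] wo uv o by (auto simp: bilin)
      show "\<forall>i\<in>?T. \<forall>j\<in>?T. i \<odot> j = (if i = j then i else 0)"
        using sysD(2,3) ow wo o uv nin by auto
    qed (use uv nz sysD(1) in auto)
    moreover have "card ?T = Suc (card S)"
      using nin sysD(1) c card_Suc_Diff1[OF sysD(1) c] by simp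
    ultimately show False using max by fastforce
  qed
  then show thesis using that sys x by blast
qed


section \<open>The symmetric cone\<close>

text \<open>Positivity of the multiplication operator is visibly a convex cone condition.
  \<open>psd_eq_squares\<close> and \<open>symmetric_cone_eq\<close> identify \<open>psd\<close>
  with the squares and \<open>pd\<close> with the symmetric cone.\<close>

definition psd :: "'a set" where "psd = {x. \<forall>v. 0 \<le> v \<bullet> (x \<odot> v)}"

definition pd :: "'a set" where "pd = {x. \<forall>v. v \<noteq> 0 \<longrightarrow> 0 < v \<bullet> (x \<odot> v)}"

lemma mult_bound: obtains K where "K > 0" "\<And>x y. norm (x \<odot> y) \<le> K * norm x * norm y"
proof -
  from prod.pos_bounded obtain K where "K > 0" "\<And>x y. norm (x \<odot> y) \<le> norm x * norm y * K" by blast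
  then show thesis using that[of K] by (simp add: mult_ac)
qed

lemma unit_nonzero [simp]: "e \<noteq> 0"
proof
  assume "e = 0"
  then have "b = 0" for b :: 'a using unit_right[of b] by (simp add: bilin)
  then show False using nonempty_Basis nonzero_Basis by blast
qed

lemma psd_add: "x \<in> psd \<Longrightarrow> y \<in> psd \<Longrightarrow> x + y \<in> psd"
  by (auto simp: psd_def bilin inner_add_right)

lemma psd_scale: "x \<in> psd \<Longrightarrow> 0 \<le> t \<Longrightarrow> t *\<^sub>R x \<in> psd"
  by (auto simp: psd_def bilin)

lemma pd_subset_psd: "pd \<subseteq> psd"
proof
  fix x assume "x \<in> pd"
  then have "0 \<le> v \<bullet> (x \<odot> v)" for v by (cases "v = 0") (auto simp: pd_def bilin less_imp_le)
  then show "x \<in> psd" by (simp add: psd_def)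
qed

lemma pd_add_psd: "x \<in> pd \<Longrightarrow> y \<in> psd \<Longrightarrow> x + y \<in> pd"
  by (auto simp: psd_def pd_def bilin inner_add_right intro: add_pos_nonneg)

lemma pd_add [simp]: "x \<in> pd \<Longrightarrow> y \<in> pd \<Longrightarrow> x + y \<in> pd"
  using pd_add_psd pd_subset_psd by blast

lemma pd_scale [simp]: "x \<in> pd \<Longrightarrow> 0 < t \<Longrightarrow> t *\<^sub>R x \<in> pd"
  by (auto simp: pd_def bilin)

lemma unit_pd [simp]: "e \<in> pd"
  by (auto simp: pd_def)

lemma psd_sum: "(\<And>i. i \<in> I \<Longrightarrow> f i \<in> psd) \<Longrightarrow> sum f I \<in> psd"
  by (induction I rule: infinite_finite_induct) (auto simp: psd_def bilin inner_add_right)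

lemma idem_psd: "c \<odot> c = c \<Longrightarrow> c \<in> psd"
  by (auto simp: psd_def L_idem_psd)

lemma system_psd:
  assumes "idem_system I c" "\<And>i. i \<in> I \<Longrightarrow> 0 \<le> lam i"
  shows "(\<Sum>i\<in>I. lam i *\<^sub>R c i) \<in> psd"
  using assms idem_systemD(2)[OF assms(1)] by (intro psd_sum psd_scale idem_psd) auto

lemma square_psd: "y \<odot> y \<in> psd"
proof -
  obtain S lam where S: "idem_system S (\<lambda>c. c)" "y = (\<Sum>c\<in>S. lam c *\<^sub>R c)" using spectral_gen by metis
  have "(\<Sum>c\<in>S. (lam c * lam c) *\<^sub>R c) \<in> psd" by (rule system_psd[OF S(1)]) simp
  then show ?thesis using system_mult[OF S(1), of lam lam] S(2) by simp
qed

lemma system_coeff: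
  assumes "idem_system I c" "i \<in> I"
  shows "(\<Sum>i\<in>I. lam i *\<^sub>R c i) \<bullet> c i = lam i * (c i \<bullet> c i)"
  using idem_inner[of "c i" "\<Sum>i\<in>I. lam i *\<^sub>R c i"] system_mult_idem[OF assms, of lam] idem_systemD(2)[OF assms] by simp

lemma psd_spectral:
  assumes "x \<in> psd"
  obtains S lam where "S \<subseteq> gen x" "idem_system S (\<lambda>c. c)" "0 \<notin> S" "x = (\<Sum>c\<in>S. lam c *\<^sub>R c)"
    "\<And>c. c \<in> S \<Longrightarrow> 0 \<le> lam c"
proof -
  obtain S lam where S: "S \<subseteq> gen x" "idem_system S (\<lambda>c. c)" "0 \<notin> S" "x = (\<Sum>c\<in>S. lam c *\<^sub>R c)"
    using spectral_gen by metis
  have "0 \<le> lam c" if c: "c \<in> S" for c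
  proof -
    have "0 \<le> c \<bullet> (x \<odot> c)" using assms by (simp add: psd_def)
    also have "\<dots> = lam c * (c \<bullet> c)" using system_mult_idem[OF S(2) c, of lam] S(4) by simp
    finally have "0 \<le> lam c * (c \<bullet> c)" .
    moreover have "0 < c \<bullet> c" using c S(3) by auto
    ultimately show ?thesis by (simp add: zero_le_mult_iff)
  qed
  then show thesis using that[OF S] by blast
qed

lemma psd_eq_squares: "psd = {y \<odot> y | y. True}"
proof -
  have "\<exists>y. x = y \<odot> y" if x: "x \<in> psd" for x
  proof -
    obtain S lam where S: "idem_system S (\<lambda>c. c)" "x = (\<Sum>c\<in>S. lam c *\<^sub>R c)"
      "\<And>c. c \<in> S \<Longrightarrow> 0 \<le> lam c" using psd_spectral[OF x] by metis
    have "x = (\<Sum>c\<in>S. (sqrt (lam c) * sqrt (lam c)) *\<^sub>R c)"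
      unfolding S(2) using S(3) by (intro sum.cong) auto
    then show ?thesis unfolding system_mult[OF S(1), of "\<lambda>c. sqrt (lam c)" "\<lambda>c. sqrt (lam c)", symmetric]
      by blast
  qed
  then show ?thesis using square_psd by blast
qed

text \<open>Compactness of the unit sphere turns strict positivity into a uniform lower bound, the
  source of openness of \<open>pd\<close> and of all estimates for the inverse.\<close>

lemma coercive:
  assumes "x \<in> pd"
  obtains \<epsilon> where "\<epsilon> > 0" "\<And>v. \<epsilon> * (v \<bullet> v) \<le> v \<bullet> (x \<odot> v)"
proof -
  have "sphere (0::'a) 1 \<noteq> {}" by simp
  moreover have "continuous_on (sphere 0 1) (\<lambda>v. v \<bullet> (x \<odot> v))"
    by (intro continuous_intros prod.continuous_on)
  ultimately obtain w where w: "w \<in> sphere 0 1" "\<And>u. u \<in> sphere 0 1 \<Longrightarrow> w \<bullet> (x \<odot> w) \<le> u \<bullet> (x \<odot> u)"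
    using continuous_attains_inf[of "sphere (0::'a) 1" "\<lambda>v. v \<bullet> (x \<odot> v)"] by auto
  show thesis
  proof
    show "w \<bullet> (x \<odot> w) > 0" using assms w(1) by (cases "w = 0") (auto simp: pd_def)
    fix v show "w \<bullet> (x \<odot> w) * (v \<bullet> v) \<le> v \<bullet> (x \<odot> v)"
    proof (cases "v = 0")
      case False
      have "w \<bullet> (x \<odot> w) \<le> (v /\<^sub>R norm v) \<bullet> (x \<odot> (v /\<^sub>R norm v))"
        using False by (intro w) auto
      then show ?thesis using False
        by (simp add: bilin divide_simps power2_norm_eq_inner[symmetric] power2_eq_square)
    qed (simp add: bilin)
  qed
qed

lemma perturb_bound:
  assumes "\<And>x y. norm (x \<odot> y) \<le> K * norm x * norm y"
  shows "\<bar>v \<bullet> (r \<odot> v)\<bar> \<le> K * norm r * (v \<bullet> v)"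
proof -
  have "\<bar>v \<bullet> (r \<odot> v)\<bar> \<le> norm v * norm (r \<odot> v)" by (rule Cauchy_Schwarz_ineq2)
  also have "\<dots> \<le> norm v * (K * norm r * norm v)" by (intro mult_left_mono assms) auto
  finally show ?thesis by (simp add: power2_norm_eq_inner[symmetric] power2_eq_square mult_ac)
qed

lemma pd_perturb:
  assumes K: "\<And>x y. norm (x \<odot> y) \<le> K * norm x * norm y"
    and x: "\<And>v. \<epsilon> * (v \<bullet> v) \<le> v \<bullet> (x \<odot> v)" and r: "K * norm (y - x) \<le> \<delta>"
  shows "(\<epsilon> - \<delta>) * (v \<bullet> v) \<le> v \<bullet> (y \<odot> v)"
proof -
  have "v \<bullet> (y \<odot> v) = v \<bullet> (x \<odot> v) + v \<bullet> ((y - x) \<odot> v)" by (simp add: bilin inner_diff_right)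
  moreover have "\<bar>v \<bullet> ((y - x) \<odot> v)\<bar> \<le> \<delta> * (v \<bullet> v)"
    using perturb_bound[OF K, of v "y - x"] mult_right_mono[OF r, of "v \<bullet> v"] by simp
  ultimately show ?thesis using x[of v] by (simp add: algebra_simps)
qed

lemma coercive_pd:
  assumes "\<epsilon> > 0" "\<And>v. \<epsilon> * (v \<bullet> v) \<le> v \<bullet> (x \<odot> v)"
  shows "x \<in> pd"
  unfolding pd_def
proof safe
  fix v :: 'a assume "v \<noteq> 0"
  then have "0 < \<epsilon> * (v \<bullet> v)" using assms(1) by simp
  then show "0 < v \<bullet> (x \<odot> v)" using assms(2)[of v] by linarith
qed

lemma open_pd: "open pd"
  unfolding open_contains_ball
proof
  fix x assume "x \<in> pd"
  then obtain \<epsilon> where \<epsilon>: "\<epsilon> > 0" "\<And>v. \<epsilon> * (v \<bullet> v) \<le> v \<bullet> (x \<odot> v)" using coercive by blast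
  obtain K where K: "K > 0" "\<And>x y. norm (x \<odot> y) \<le> K * norm x * norm y" using mult_bound by blast
  have "ball x (\<epsilon> / 2 / K) \<subseteq> pd"
  proof
    fix y assume "y \<in> ball x (\<epsilon> / 2 / K)"
    then have "K * norm (y - x) \<le> \<epsilon> / 2"
      using K(1) by (simp add: dist_norm norm_minus_commute field_simps)
    then have "(\<epsilon> - \<epsilon> / 2) * (v \<bullet> v) \<le> v \<bullet> (y \<odot> v)" for v by (intro pd_perturb[OF K(2) \<epsilon>(2)])
    then show "y \<in> pd" using \<epsilon>(1) coercive_pd[of "\<epsilon> - \<epsilon> / 2" y] by simp
  qed
  then show "\<exists>r>0. ball x r \<subseteq> pd"
    using \<epsilon>(1) K(1) by (intro exI[of _ "\<epsilon> / 2 / K"]) auto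
qed

text \<open>An interior point of \<open>psd\<close> remains in \<open>psd\<close> after subtracting
  some s e with s > 0, and this s is a coercivity constant for it. Conversely \<open>pd\<close> is
  an open subset of \<open>psd\<close>.\<close>

lemma symmetric_cone_eq: "symmetric_cone (\<odot>) = pd"
proof -
  have "x \<in> pd" if "x \<in> interior psd" for x
  proof -
    from that obtain r where r: "r > 0" "cball x r \<subseteq> psd" by (auto simp: mem_interior_cball)
    define s where "s = r / norm e"
    have s: "s > 0" using r by (simp add: s_def)
    have "x - s *\<^sub>R e \<in> cball x r" using r by (simp add: dist_norm s_def)
    then have "x - s *\<^sub>R e \<in> psd" using r by blast
    then have "s * (v \<bullet> v) \<le> v \<bullet> (x \<odot> v)" for v by (auto simp: psd_def bilin inner_diff_right)
    then show ?thesis using coercive_pd s by blast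
  qed
  moreover have "pd \<subseteq> interior psd" using open_pd pd_subset_psd by (rule interior_maximal[rotated])
  ultimately show ?thesis unfolding symmetric_cone_def psd_eq_squares[symmetric] by blast
qed

lemma pd_inner_idem:
  assumes "x \<in> pd" "c \<odot> c = c" "c \<noteq> 0"
  shows "0 < x \<bullet> c"
  using assms idem_inner[of c x] by (auto simp: pd_def inner_commute)

lemma pd_coeff_pos:
  assumes "(\<Sum>i\<in>I. lam i *\<^sub>R c i) \<in> pd" "idem_system I c" "i \<in> I" "c i \<noteq> 0"
  shows "0 < lam i"
proof -
  have "0 < lam i * (c i \<bullet> c i)"
    using pd_inner_idem[OF assms(1) idem_systemD(2)[OF assms(2,3)] assms(4)] system_coeff[OF assms(2,3)] by simp
  then show ?thesis using inner_ge_zero[of "c i"] by (simp add: zero_less_mult_iff)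
qed

lemma system_pd:
  assumes I: "idem_system I c" and pos: "\<And>i. i \<in> I \<Longrightarrow> 0 < lam i"
  shows "(\<Sum>i\<in>I. lam i *\<^sub>R c i) \<in> pd"
  unfolding pd_def
proof safe
  fix v :: 'a assume "v \<noteq> 0"
  have fin: "finite I" using I idem_systemD(1) by blast
  have nn: "0 \<le> v \<bullet> (c i \<odot> v)" if "i \<in> I" for i
    using L_idem_psd idem_systemD(2)[OF I that] by blast
  have e: "(\<Sum>i\<in>I. v \<bullet> (c i \<odot> v)) = v \<bullet> v"
    using idem_systemD(4)[OF I] by (simp flip: inner_sum_right prod.sum_left)
  have "(\<Sum>i\<in>I. v \<bullet> (c i \<odot> v)) \<noteq> 0" using e \<open>v \<noteq> 0\<close> by simp
  then obtain i where i: "i \<in> I" "v \<bullet> (c i \<odot> v) \<noteq> 0" by (meson sum.neutral)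
  have "0 < (\<Sum>i\<in>I. lam i * (v \<bullet> (c i \<odot> v)))"
  proof (rule sum_pos2[OF fin i(1)])
    show "0 < lam i * (v \<bullet> (c i \<odot> v))" using i nn[OF i(1)] pos[OF i(1)] by simp
  qed (use nn pos in \<open>auto intro!: mult_nonneg_nonneg simp: less_imp_le\<close>)
  then show "0 < v \<bullet> ((\<Sum>i\<in>I. lam i *\<^sub>R c i) \<odot> v)"
    by (simp add: prod.sum_left inner_sum_right bilin)
qed

lemma pd_spectral:
  assumes "x \<in> pd"
  obtains S lam where "S \<subseteq> gen x" "idem_system S (\<lambda>c. c)" "0 \<notin> S" "x = (\<Sum>c\<in>S. lam c *\<^sub>R c)"
    "\<And>c. c \<in> S \<Longrightarrow> 0 < lam c"
proof -
  obtain S lam where S: "S \<subseteq> gen x" "idem_system S (\<lambda>c. c)" "0 \<notin> S" "x = (\<Sum>c\<in>S. lam c *\<^sub>R c)"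
    using spectral_gen by metis
  have "0 < lam c" if "c \<in> S" for c
    by (rule pd_coeff_pos[of lam _ S]) (use that S assms in auto)
  then show thesis using that[OF S] by blast
qed

text \<open>The eigenvalues of x are, up to positive factors, its inner products with its own
  spectral idempotents.\<close>

lemma pd_test:
  assumes "\<And>c. c \<odot> c = c \<Longrightarrow> c \<noteq> 0 \<Longrightarrow> 0 < x \<bullet> c"
  shows "x \<in> pd"
proof -
  obtain S lam where S: "idem_system S (\<lambda>c. c)" "0 \<notin> S" "x = (\<Sum>c\<in>S. lam c *\<^sub>R c)"
    using spectral_gen by metis
  have "0 < lam c" if c: "c \<in> S" for c
  proof -
    have "0 < lam c * (c \<bullet> c)"
      using assms[of c] idem_systemD(2)[OF S(1) c] c S(2) system_coeff[OF S(1) c, of lam] S(3) by auto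
    then show ?thesis using inner_ge_zero[of c] by (simp add: zero_less_mult_iff)
  qed
  then show ?thesis using system_pd[OF S(1)] S(3) by blast
qed

section \<open>The Jordan inverse\<close>

definition jinv :: "'a \<Rightarrow> 'a" where "jinv x = fcalc inverse x"

lemma coercive_norm:
  assumes "\<epsilon> > 0" "\<And>v. \<epsilon> * (v \<bullet> v) \<le> v \<bullet> (x \<odot> v)"
  shows "\<epsilon> * norm v \<le> norm (x \<odot> v)"
proof (cases "v = 0")
  case False
  have "\<epsilon> * norm v * norm v \<le> v \<bullet> (x \<odot> v)"
    using assms(2)[of v] by (simp add: power2_norm_eq_inner[symmetric] power2_eq_square mult_ac)
  also have "\<dots> \<le> norm v * norm (x \<odot> v)" by (rule norm_cauchy_schwarz)
  finally show ?thesis using False by (simp add: mult.commute)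
qed (simp add: bilin)

lemma pd_cancel:
  assumes "x \<in> pd" "x \<odot> u = x \<odot> v"
  shows "u = v"
proof -
  have "x \<odot> (u - v) = 0" using assms by (simp add: bilin)
  then have *: "\<not> 0 < (u - v) \<bullet> (x \<odot> (u - v))" by simp
  have "u - v = 0" using assms(1) * unfolding pd_def by blast
  then show ?thesis by simp
qed

lemma jinv_props:
  assumes "x \<in> pd"
  shows mult_jinv: "x \<odot> jinv x = e" and jinv_pd [simp]: "jinv x \<in> pd" and jinv_gen: "jinv x \<in> gen x"
proof -
  obtain S lam where S: "S \<subseteq> gen x" "idem_system S (\<lambda>c. c)" "x = (\<Sum>c\<in>S. lam c *\<^sub>R c)"
    "\<And>c. c \<in> S \<Longrightarrow> 0 < lam c" using pd_spectral[OF assms] by metis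
  have j: "jinv x = (\<Sum>c\<in>S. inverse (lam c) *\<^sub>R c)"
    unfolding jinv_def by (subst S(3)) (rule fcalc_eq[OF S(2)])
  have "x \<odot> jinv x = (\<Sum>c\<in>S. (lam c * inverse (lam c)) *\<^sub>R c)"
    using system_mult[OF S(2), of lam "\<lambda>c. inverse (lam c)"] S(3) j by simp
  also have "\<dots> = (\<Sum>c\<in>S. c)" using S(4) by (intro sum.cong) force+
  finally show "x \<odot> jinv x = e" using idem_systemD(4)[OF S(2)] by simp
  show "jinv x \<in> pd" unfolding j by (rule system_pd[OF S(2)]) (use S in auto)
  show "jinv x \<in> gen x" unfolding j using S(1)
    by (intro subspace_sum subspace_scale) auto
qed

text \<open>For a general element of a Jordan algebra x \<odot> w = e does not determine the
  inverse; on \<open>pd\<close> it does, since multiplication by x is injective.\<close>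

lemma jinv_unique: "x \<in> pd \<Longrightarrow> x \<odot> w = e \<Longrightarrow> jinv x = w"
  using pd_cancel[of x] mult_jinv by simp

lemma jinv_jinv [simp]: "x \<in> pd \<Longrightarrow> jinv (jinv x) = x"
  using mult_jinv comm by (intro jinv_unique) auto

lemma jinv_scale: "x \<in> pd \<Longrightarrow> t > 0 \<Longrightarrow> jinv (t *\<^sub>R x) = jinv x /\<^sub>R t"
  by (intro jinv_unique) (auto simp: bilin mult_jinv)

lemma jinv_unit [simp]: "jinv e = e" by (intro jinv_unique) auto

lemma pd_sqrt:
  assumes "x \<in> pd"
  obtains s where "s \<in> pd" "s \<odot> s = x" "s \<in> gen x"
proof -
  obtain S lam where S: "S \<subseteq> gen x" "idem_system S (\<lambda>c. c)" "x = (\<Sum>c\<in>S. lam c *\<^sub>R c)"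
    "\<And>c. c \<in> S \<Longrightarrow> 0 < lam c" using pd_spectral[OF assms] by metis
  let ?s = "\<Sum>c\<in>S. sqrt (lam c) *\<^sub>R c"
  have "?s \<in> pd" by (rule system_pd[OF S(2)]) (use S(4) in auto)
  moreover have "?s \<odot> ?s = x" unfolding system_mult[OF S(2)] S(3)
    using S(4) by (intro sum.cong) (auto simp: less_imp_le)
  moreover have "?s \<in> gen x" using S(1) by (intro subspace_sum subspace_scale) auto
  ultimately show thesis using that by blast
qed

lemma pd_square:
  assumes "x \<in> pd" shows "x \<odot> x \<in> pd"
proof -
  obtain S lam where S: "idem_system S (\<lambda>c. c)" "x = (\<Sum>c\<in>S. lam c *\<^sub>R c)"
    "\<And>c. c \<in> S \<Longrightarrow> 0 < lam c" using pd_spectral[OF assms] by metis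
  show ?thesis using system_mult[OF S(1), of lam lam] S system_pd[OF S(1), of "\<lambda>c. lam c * lam c"] by simp
qed

section \<open>The quadratic representation\<close>

text \<open>For symmetric matrices with product (xy + yx)/2 this is v \<mapsto> x v x.\<close>

definition P :: "'a \<Rightarrow> 'a \<Rightarrow> 'a" where
  "P x v = 2 *\<^sub>R (x \<odot> (x \<odot> v)) - (x \<odot> x) \<odot> v"

lemma linear_P: "linear (P x)"
  by (intro linearI) (auto simp: P_def bilin algebra_simps)

lemmas P_linear = linear_add[OF linear_P] linear_scale[OF linear_P] linear_diff[OF linear_P]
  linear_neg[OF linear_P] linear_0[OF linear_P]

lemma P_sym: "P x u \<bullet> v = u \<bullet> P x v"
  by (simp add: P_def inner_diff_left inner_diff_right L_sym)

lemma P_of_unit [simp]: "P x e = x \<odot> x"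
  by (simp add: P_def scaleR_2)

lemma P_unit [simp]: "P e v = v"
  by (simp add: P_def scaleR_2)

lemma P_scale: "P (t *\<^sub>R x) v = t\<^sup>2 *\<^sub>R P x v"
  by (simp add: P_def bilin power2_eq_square algebra_simps)

lemma P_unit_add: "P (e + k) v = v + 2 *\<^sub>R (k \<odot> v) + P k v"
  by (simp add: P_def bilin algebra_simps scaleR_2)

lemma P_bound:
  assumes K: "K > 0" "\<And>x y. norm (x \<odot> y) \<le> K * norm x * norm y"
  shows "norm (P x v) \<le> 3 * K\<^sup>2 * (norm x)\<^sup>2 * norm v"
proof -
  have 1: "norm (x \<odot> (x \<odot> v)) \<le> K * norm x * (K * norm x * norm v)"
    using K(1) by (intro order_trans[OF K(2)] mult_left_mono K(2)) auto
  have 2: "norm ((x \<odot> x) \<odot> v) \<le> K * (K * norm x * norm x) * norm v"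
    using K(1) by (intro order_trans[OF K(2)] mult_left_mono mult_right_mono K(2)) auto
  have "norm (P x v) \<le> norm (2 *\<^sub>R (x \<odot> (x \<odot> v))) + norm ((x \<odot> x) \<odot> v)"
    unfolding P_def by (rule norm_triangle_ineq4)
  also have "\<dots> \<le> 2 * (K * norm x * (K * norm x * norm v)) + K * (K * norm x * norm x) * norm v"
    unfolding norm_scaleR using 1 2 by linarith
  also have "\<dots> = 3 * K\<^sup>2 * (norm x)\<^sup>2 * norm v" by (simp add: power2_eq_square)
  finally show ?thesis .
qed

text \<open>\<open>jordan_linearised\<close> is quadratic in its first argument. Subtracting the
  instances at a and at c from the one at a + c leaves twice this identity, once commuting operators
  are put in a common order.\<close>

lemma gen_triple:
  assumes "a \<in> gen x" "b \<in> gen x" "c \<in> gen x"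
  shows "((a \<odot> c) \<odot> b) \<odot> v = (a \<odot> b) \<odot> (c \<odot> v) + (c \<odot> b) \<odot> (a \<odot> v) + (a \<odot> c) \<odot> (b \<odot> v)
    - 2 *\<^sub>R (a \<odot> (b \<odot> (c \<odot> v)))"
proof -
  have "c \<odot> (b \<odot> (a \<odot> v)) = a \<odot> (b \<odot> (c \<odot> v))"
    using gen_commute[of c x b "a \<odot> v"] gen_commute[of c x a v] gen_commute[of b x a "c \<odot> v"] assms by simp
  then have "2 *\<^sub>R (((a \<odot> c) \<odot> b) \<odot> v) = 2 *\<^sub>R ((a \<odot> b) \<odot> (c \<odot> v) + (c \<odot> b) \<odot> (a \<odot> v) + (a \<odot> c) \<odot> (b \<odot> v)
    - 2 *\<^sub>R (a \<odot> (b \<odot> (c \<odot> v))))"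
    using jordan_linearised[of "a + c" b v] jordan_linearised[of a b v] jordan_linearised[of c b v]
      comm[of c a]
    by (simp add: bilin algebra_simps scaleR_2)
  then show ?thesis by (simp only: scaleR_cancel_left) simp
qed

text \<open>Multiplication by (a \<odot> b)^2 is expanded in two ways by \<open>gen_triple\<close>:
  E1 reads the square as a^2 b^2, E2 as (a \<odot> b) \<odot> (a \<odot> b). Solving E2 for the
  squared operator of a \<odot> b and inserting E1, the mixed terms containing a \<odot> b
  cancel.\<close>

lemma P_mult:
  assumes g: "a \<in> gen x" "b \<in> gen x"
  shows "P (a \<odot> b) v = P a (P b v)"
proof -
  let ?M = "a \<odot> b" and ?A = "a \<odot> a" and ?B = "b \<odot> b"
  have gg: "?M \<in> gen x" "?A \<in> gen x" "?B \<in> gen x" using g by auto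
  note cm = gen_commute[OF g(1) gg(1)] gen_commute[OF g(2) gg(1)] gen_commute[OF g(1) gg(2)]
    gen_commute[OF g(2) gg(2)] gen_commute[OF g(1) gg(3)] gen_commute[OF g(2) gg(3)]
    gen_commute[OF g(2,1)] gen_commute[OF gg(2,1)] gen_commute[OF gg(3,1)] gen_commute[OF gg(3,2)]
  have Mb: "(?A \<odot> b) \<odot> w = 2 *\<^sub>R (?M \<odot> (a \<odot> w)) + ?A \<odot> (b \<odot> w) - 2 *\<^sub>R (a \<odot> (a \<odot> (b \<odot> w)))" for w
    using gen_triple[OF g(1,2,1), of w] by (simp add: cm scaleR_2)
  have Ma: "(?B \<odot> a) \<odot> w = 2 *\<^sub>R (?M \<odot> (b \<odot> w)) + ?B \<odot> (a \<odot> w) - 2 *\<^sub>R (a \<odot> (b \<odot> (b \<odot> w)))" for w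
    using gen_triple[OF g(2,1,2), of w] comm[of b a] by (simp add: cm scaleR_2)
  have aM: "a \<odot> ?M = ?A \<odot> b" "b \<odot> ?M = ?B \<odot> a" "?M \<odot> ?M = ?A \<odot> ?B" "a \<odot> ?B = ?B \<odot> a"
  proof -
    show 1: "a \<odot> ?M = ?A \<odot> b" using gen_assoc[OF g(1) g(1) g(2)] by simp
    show 2: "b \<odot> ?M = ?B \<odot> a" using gen_assoc[OF g(2) g(2) g(1)] comm[of b a] by simp
    have "?M \<odot> ?M = a \<odot> (?B \<odot> a)" using gen_assoc[OF g(1) g(2) gg(1)] 2 by simp
    then show "?M \<odot> ?M = ?A \<odot> ?B" using gen_commute[OF g(1) gg(3), of a] comm[of ?B ?A] by simp
    show "a \<odot> ?B = ?B \<odot> a" by (rule comm)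
  qed
  have E1: "(?M \<odot> ?M) \<odot> v = 4 *\<^sub>R (?M \<odot> (a \<odot> (b \<odot> v))) + ?A \<odot> (?B \<odot> v) - 4 *\<^sub>R (a \<odot> (a \<odot> (b \<odot> (b \<odot> v))))"
    unfolding aM(3) using gen_triple[OF g(1) gg(3) g(1), of v]
    by (simp add: aM(4) Ma cm bilin algebra_simps scaleR_4 scaleR_2)
  have E2: "(?M \<odot> ?M) \<odot> v = ?M \<odot> (?M \<odot> v) + 2 *\<^sub>R (?M \<odot> (a \<odot> (b \<odot> v))) + ?A \<odot> (b \<odot> (b \<odot> v))
      + ?B \<odot> (a \<odot> (a \<odot> v)) - 4 *\<^sub>R (a \<odot> (a \<odot> (b \<odot> (b \<odot> v))))"
    using gen_triple[OF g(1) gg(1) g(2), of v]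
    by (simp add: aM(1,2,4) Ma Mb cm bilin algebra_simps scaleR_4 scaleR_2)
  have "P ?M v = 4 *\<^sub>R (a \<odot> (a \<odot> (b \<odot> (b \<odot> v)))) - 2 *\<^sub>R (?B \<odot> (a \<odot> (a \<odot> v)))
      - 2 *\<^sub>R (?A \<odot> (b \<odot> (b \<odot> v))) + ?A \<odot> (?B \<odot> v)"
  proof -
    have MM: "?M \<odot> (?M \<odot> v) = (?M \<odot> ?M) \<odot> v - 2 *\<^sub>R (?M \<odot> (a \<odot> (b \<odot> v))) - ?A \<odot> (b \<odot> (b \<odot> v))
        - ?B \<odot> (a \<odot> (a \<odot> v)) + 4 *\<^sub>R (a \<odot> (a \<odot> (b \<odot> (b \<odot> v))))"
      unfolding E2 by (simp add: algebra_simps)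
    show ?thesis unfolding P_def MM unfolding E1 by (simp add: algebra_simps scaleR_4 scaleR_2)
  qed
  also have "\<dots> = P a (P b v)"
    unfolding P_def by (simp add: cm bilin algebra_simps scaleR_4 scaleR_2)
  finally show ?thesis .
qed

lemma P_jinv:
  assumes "x \<in> pd"
  shows "P x (P (jinv x) v) = v" "P (jinv x) (P x v) = v"
  using P_mult[of x x "jinv x" v] P_mult[of "jinv x" x x v] assms mult_jinv[OF assms] jinv_gen[OF assms]
    comm[of "jinv x" x] by auto

text \<open>\<open>gen_triple\<close> with factors \<open>jinv x\<close>, x, \<open>jinv x\<close>
  collapses because x \<odot> \<open>jinv x\<close> = e. The identity singles out - P
  (\<open>jinv x\<close>) y as the derivative in \<open>jinv_derivative\<close>.\<close>

lemma mult_P_jinv: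
  assumes "x \<in> pd"
  shows "x \<odot> P (jinv x) v = jinv x \<odot> v"
proof -
  let ?u = "jinv x"
  have g: "?u \<in> gen x" "?u \<odot> ?u \<in> gen x" using jinv_gen assms by auto
  have "(?u \<odot> ?u) \<odot> x = ?u"
    using gen_assoc[OF g(1) g(1) self_in_gen] mult_jinv[OF assms] comm[of ?u x] by simp
  moreover have "((?u \<odot> ?u) \<odot> x) \<odot> v = 2 *\<^sub>R (?u \<odot> v) + (?u \<odot> ?u) \<odot> (x \<odot> v) - 2 *\<^sub>R (?u \<odot> (x \<odot> (?u \<odot> v)))"
    using gen_triple[OF g(1) self_in_gen g(1), of v] mult_jinv[OF assms] comm[of ?u x]
    by (simp add: scaleR_2)
  moreover have "(?u \<odot> ?u) \<odot> (x \<odot> v) = x \<odot> ((?u \<odot> ?u) \<odot> v)" "?u \<odot> (x \<odot> (?u \<odot> v)) = x \<odot> (?u \<odot> (?u \<odot> v))"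
    using gen_commute[OF g(2) self_in_gen] gen_commute[OF g(1) self_in_gen] by auto
  ultimately show ?thesis
    unfolding P_def by (simp add: bilin algebra_simps scaleR_2)
qed


section \<open>Invariance of the cone under the quadratic representation\<close>

lemma vector_psd:
  assumes "\<And>x y. norm (x \<odot> y) \<le> K * norm x * norm y" "K * norm r \<le> \<delta>"
  shows "r + \<delta> *\<^sub>R e \<in> psd"
  unfolding psd_def
proof safe
  fix v
  have "\<bar>v \<bullet> (r \<odot> v)\<bar> \<le> \<delta> * (v \<bullet> v)"
    using perturb_bound[OF assms(1), of v r] mult_right_mono[OF assms(2), of "v \<bullet> v"] by simp
  then show "0 \<le> v \<bullet> ((r + \<delta> *\<^sub>R e) \<odot> v)" by (simp add: bilin inner_add_right)
qed

text \<open>For \<open>q = \<Sum>\<mu> d\<close> with idempotents \<open>d\<close> one has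
  \<open>P (e + k) q = \<Sum>\<mu> (d + k)\<^sup>2\<close> up to terms of second order in \<open>k\<close>.\<close>

lemma P_almost_psd:
  obtains C where "C > 0"
    "\<And>k q. q \<in> psd \<Longrightarrow> P (e + k) q + (C * (norm k)\<^sup>2 * norm q) *\<^sub>R e \<in> psd"
proof -
  obtain K where K: "K > 0" "\<And>x y. norm (x \<odot> y) \<le> K * norm x * norm y" using mult_bound by blast
  \<comment> \<open>The summands bound P k q and m (k \<odot> k); the outer K comes from
    \<open>vector_psd\<close>.\<close>
  define C where "C = K * (3 * K\<^sup>2 + K ^ 3 * norm e)"
  have "P (e + k) q + (C * (norm k)\<^sup>2 * norm q) *\<^sub>R e \<in> psd" if q: "q \<in> psd" for k q
  proof -
    obtain S \<mu> where S: "idem_system S (\<lambda>c. c)" "0 \<notin> S" "q = (\<Sum>d\<in>S. \<mu> d *\<^sub>R d)"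
      and \<mu>: "\<And>d. d \<in> S \<Longrightarrow> 0 \<le> \<mu> d" using psd_spectral[OF q] by metis
    define m where "m = (\<Sum>d\<in>S. \<mu> d)"
    have sq: "(\<Sum>d\<in>S. \<mu> d *\<^sub>R ((d + k) \<odot> (d + k))) = q + 2 *\<^sub>R (k \<odot> q) + m *\<^sub>R (k \<odot> k)"
    proof -
      have "(\<Sum>d\<in>S. \<mu> d *\<^sub>R ((d + k) \<odot> (d + k)))
          = (\<Sum>d\<in>S. \<mu> d *\<^sub>R d + 2 *\<^sub>R (k \<odot> (\<mu> d *\<^sub>R d)) + \<mu> d *\<^sub>R (k \<odot> k))"
      proof (intro sum.cong refl)
        fix d assume "d \<in> S"
        then have "(d + k) \<odot> (d + k) = d + 2 *\<^sub>R (k \<odot> d) + k \<odot> k"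
          using idem_systemD(2)[OF S(1)] comm[of d k] by (simp add: bilin scaleR_2)
        then show "\<mu> d *\<^sub>R ((d + k) \<odot> (d + k)) = \<mu> d *\<^sub>R d + 2 *\<^sub>R (k \<odot> (\<mu> d *\<^sub>R d)) + \<mu> d *\<^sub>R (k \<odot> k)"
          by (simp only: scaleR_add_right prod.scaleR_right scaleR_scaleR mult.commute)
      qed
      then show ?thesis
        by (simp add: sum.distrib S(3) m_def prod.sum_right scaleR_sum_right[symmetric] scaleR_sum_left)
    qed
    have "(\<Sum>d\<in>S. \<mu> d *\<^sub>R ((d + k) \<odot> (d + k))) \<in> psd"
      using \<mu> by (intro psd_sum psd_scale square_psd) auto
    then have "q + 2 *\<^sub>R (k \<odot> q) + m *\<^sub>R (k \<odot> k) \<in> psd" unfolding sq .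
    moreover define r where "r = P k q - m *\<^sub>R (k \<odot> k)"
    \<comment> \<open>A nonzero idempotent satisfies K norm d \<ge> 1, so the sum m of the
      eigenvalues is at most K^2 (q \<bullet> e).\<close>
    have m: "0 \<le> m" "m \<le> K\<^sup>2 * norm e * norm q"
    proof -
      show "0 \<le> m" unfolding m_def by (intro sum_nonneg \<mu>)
      have "m \<le> (\<Sum>d\<in>S. K\<^sup>2 * (\<mu> d * (d \<bullet> d)))" unfolding m_def
      proof (intro sum_mono)
        fix d assume d: "d \<in> S"
        have "d \<noteq> 0" using d S(2) by auto
        have "norm d \<le> K * norm d * norm d" using K(2)[of d d] idem_systemD(2)[OF S(1) d] by simp
        then have "1 \<le> K * norm d" using \<open>d \<noteq> 0\<close> by simp
        then have "1 \<le> (K * norm d)\<^sup>2" by (simp add: one_le_power)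
        then have "1 \<le> K\<^sup>2 * (d \<bullet> d)" by (simp add: power_mult_distrib power2_norm_eq_inner)
        then show "\<mu> d \<le> K\<^sup>2 * (\<mu> d * (d \<bullet> d))"
          using mult_left_mono[OF _ \<mu>[OF d], of 1 "K\<^sup>2 * (d \<bullet> d)"] by (simp add: mult_ac)
      qed
      also have "\<dots> = K\<^sup>2 * (\<Sum>d\<in>S. q \<bullet> d)" unfolding sum_distrib_left
        using system_coeff[OF S(1), of _ \<mu>] S(3) by (intro sum.cong) auto
      also have "\<dots> = K\<^sup>2 * (q \<bullet> e)"
        using idem_systemD(4)[OF S(1)] by (simp flip: inner_sum_right)
      also have "\<dots> \<le> K\<^sup>2 * (norm q * norm e)"
        using norm_cauchy_schwarz[of q e] by (intro mult_left_mono) auto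
      finally show "m \<le> K\<^sup>2 * norm e * norm q" by (simp add: mult_ac)
    qed
    have "r + (C * (norm k)\<^sup>2 * norm q) *\<^sub>R e \<in> psd"
    proof (rule vector_psd[OF K(2)])
      have "norm r \<le> norm (P k q) + norm (m *\<^sub>R (k \<odot> k))"
        unfolding r_def by (rule norm_triangle_ineq4)
      also have "\<dots> \<le> 3 * K\<^sup>2 * (norm k)\<^sup>2 * norm q + K\<^sup>2 * norm e * norm q * (K * norm k * norm k)"
        unfolding norm_scaleR using m K(1) by (intro add_mono P_bound[OF K] mult_mono K(2)) auto
      finally have "K * norm r \<le> K * (3 * K\<^sup>2 * (norm k)\<^sup>2 * norm q + K\<^sup>2 * norm e * norm q * (K * norm k * norm k))"
        using K(1) by (intro mult_left_mono) auto
      then show "K * norm r \<le> C * (norm k)\<^sup>2 * norm q"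
        by (simp add: C_def power2_eq_square power3_eq_cube algebra_simps)
    qed
    ultimately have "(q + 2 *\<^sub>R (k \<odot> q) + m *\<^sub>R (k \<odot> k)) + (r + (C * (norm k)\<^sup>2 * norm q) *\<^sub>R e) \<in> psd"
      by (rule psd_add)
    then show ?thesis by (simp add: P_unit_add r_def algebra_simps)
  qed
  moreover have "C > 0" using K(1) unfolding C_def by (intro mult_pos_pos add_pos_nonneg) auto
  ultimately show thesis using that by blast
qed

lemma closed_psd_limit:
  assumes "\<And>n::nat. n \<ge> N \<Longrightarrow> y + \<delta> n *\<^sub>R e \<in> psd"
    and "\<delta> \<longlonglongrightarrow> 0"
  shows "y \<in> psd"
  unfolding psd_def
proof safe
  fix v
  have "(\<lambda>n. v \<bullet> (y \<odot> v) + \<delta> n * (v \<bullet> v)) \<longlonglongrightarrow> v \<bullet> (y \<odot> v) + 0 * (v \<bullet> v)"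
    by (intro tendsto_intros assms)
  moreover have "\<forall>n\<ge>N. 0 \<le> v \<bullet> (y \<odot> v) + \<delta> n * (v \<bullet> v)"
    using assms(1) by (simp add: psd_def bilin inner_add_right)
  ultimately show "0 \<le> v \<bullet> (y \<odot> v)"
    using LIMSEQ_le_const[of _ "v \<bullet> (y \<odot> v) + 0 * (v \<bullet> v)" 0] by auto
qed

lemma system_pow:
  assumes "idem_system I c"
  shows "pow (\<Sum>i\<in>I. lam i *\<^sub>R c i) n = (\<Sum>i\<in>I. lam i ^ n *\<^sub>R c i)"
proof (induction n)
  case 0 then show ?case using idem_systemD(4)[OF assms] by simp
next
  case (Suc n) then show ?case using system_mult[OF assms, of lam "\<lambda>i. lam i ^ n"] by simp
qed

text \<open>\<open>P u = (P (u\<^bsup>1/n\<^esup>))\<^bsup>n\<^esup>\<close>, and each factor preserves the cone up to an error of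
  order \<open>n\<^bsup>-2\<^esup>\<close>. Normalising \<open>u \<le> e\<close> prevents the errors from growing.\<close>

lemma P_psd_contraction:
  assumes S: "idem_system S (\<lambda>c. c)" "u = (\<Sum>c\<in>S. lam c *\<^sub>R c)"
    and lam: "\<And>c. c \<in> S \<Longrightarrow> 0 < lam c \<and> lam c \<le> 1" and y: "y \<in> psd"
  shows "P u y \<in> psd"
proof -
  obtain K where K: "K > 0" "\<And>x y. norm (x \<odot> y) \<le> K * norm x * norm y" using mult_bound by blast
  obtain C where C: "C > 0" "\<And>k q. q \<in> psd \<Longrightarrow> P (e + k) q + (C * (norm k)\<^sup>2 * norm q) *\<^sub>R e \<in> psd"
    using P_almost_psd by blast
  \<comment> \<open>For w = u^(1/n): H / n bounds the distance of w from e, N bounds all powers of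
    w, R bounds P (\<open>pow w j\<close>) y, and R + 1 bounds the vector z of the induction once n0
    has made the accumulated error small. One factor then costs at most D / n^2.\<close>
  define H where "H = (\<Sum>c\<in>S. \<bar>ln (lam c)\<bar> * norm c)"
  define N where "N = (\<Sum>c\<in>S. norm c)"
  define R where "R = 3 * K\<^sup>2 * N\<^sup>2 * norm y"
  have nn: "H \<ge> 0" "N \<ge> 0" "R \<ge> 0" unfolding H_def N_def R_def by (auto intro!: sum_nonneg mult_nonneg_nonneg)
  define D where "D = C * H\<^sup>2 * (R + 1)"
  have D: "D \<ge> 0" unfolding D_def using C(1) nn by (intro mult_nonneg_nonneg) auto
  obtain n0 :: nat where n0: "D * norm e \<le> n0" "n0 \<ge> 1"
    using real_arch_simple[of "max 1 (D * norm e)"] by auto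
  have main: "P u y + (D / n) *\<^sub>R e \<in> psd" if n: "n \<ge> n0" for n :: nat
  proof -
    have n1: "n \<ge> 1" "D * norm e \<le> n" using n n0 by linarith+
    define w where "w = (\<Sum>c\<in>S. (lam c powr (1 / n)) *\<^sub>R c)"
    define k where "k = w - e"
    define \<delta> where "\<delta> = D / n\<^sup>2"
    have \<delta>: "\<delta> \<ge> 0" using D by (simp add: \<delta>_def)
    have pw: "pow w j = (\<Sum>c\<in>S. (lam c powr (1 / n)) ^ j *\<^sub>R c)" for j
      unfolding w_def by (rule system_pow[OF S(1)])
    have le1: "lam c powr (1 / n) \<le> 1" if "c \<in> S" for c
      using lam[OF that] powr_mono2[of "1 / n" "lam c" 1] by simp
    have root: "(lam c powr (1 / n)) ^ n = lam c" if "c \<in> S" for c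
      using lam[OF that] n1 powr_power[where z = "lam c" and n = n and u = "1 / real n"] by auto
    have "pow w n = u"
      unfolding pw S(2) using root by (intro sum.cong) auto
    have k_norm: "norm k \<le> H / n"
    proof -
      have "k = (\<Sum>c\<in>S. (lam c powr (1 / n) - 1) *\<^sub>R c)"
        unfolding k_def w_def using idem_systemD(4)[OF S(1)] by (simp add: scaleR_diff_left sum_subtractf)
      also have "norm \<dots> \<le> (\<Sum>c\<in>S. norm ((lam c powr (1 / n) - 1) *\<^sub>R c))" by (rule norm_sum)
      also have "\<dots> \<le> (\<Sum>c\<in>S. \<bar>ln (lam c)\<bar> * norm c / n)"
      proof (intro sum_mono)
        fix c assume c: "c \<in> S"
        have "1 + ln (lam c) / n \<le> lam c powr (1 / n)"
          using lam[OF c] exp_ge_add_one_self[of "ln (lam c) / n"] by (simp add: powr_def)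
        then have "\<bar>lam c powr (1 / n) - 1\<bar> \<le> \<bar>ln (lam c)\<bar> / n"
          using le1[OF c] ln_le_zero_iff[of "lam c"] lam[OF c]
          by (simp only: abs_of_nonpos diff_le_0_iff_le minus_diff_eq)
        then show "norm ((lam c powr (1 / n) - 1) *\<^sub>R c) \<le> \<bar>ln (lam c)\<bar> * norm c / n"
          using mult_right_mono[of _ "\<bar>ln (lam c)\<bar> / n" "norm c"] by simp
      qed
      also have "\<dots> = H / n" by (simp add: H_def sum_divide_distrib)
      finally show ?thesis .
    qed
    have w_bound: "norm (pow w j) \<le> N" for j
    proof -
      have "norm (pow w j) \<le> (\<Sum>c\<in>S. norm ((lam c powr (1 / n)) ^ j *\<^sub>R c))" unfolding pw by (rule norm_sum)
      also have "\<dots> \<le> N" unfolding N_def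
        using le1 by (intro sum_mono) (auto simp: power_le_one mult_left_le_one_le)
      finally show ?thesis .
    qed
    have "P (pow w j) y + (real j * \<delta>) *\<^sub>R e \<in> psd" if "j \<le> n" for j
      using that
    proof (induction j)
      case 0 then show ?case using y by simp
    next
      case (Suc j)
      define z where "z = P (pow w j) y + (real j * \<delta>) *\<^sub>R e"
      have z: "z \<in> psd" using Suc by (simp add: z_def)
      have "norm z \<le> R + 1"
      proof -
        have "norm (P (pow w j) y) \<le> 3 * K\<^sup>2 * (norm (pow w j))\<^sup>2 * norm y" by (rule P_bound[OF K])
        also have "\<dots> \<le> R" unfolding R_def
          using mult_left_mono[OF power_mono[OF w_bound[of j], of 2], of "3 * K\<^sup>2"] by (intro mult_right_mono) auto
        finally have "norm (P (pow w j) y) \<le> R" .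
        moreover have "norm ((real j * \<delta>) *\<^sub>R e) \<le> 1"
        proof -
          have "real j * \<delta> * norm e \<le> n * \<delta> * norm e" using Suc.prems \<delta> by (intro mult_right_mono) auto
          also have "\<dots> = D * norm e / n" using n1 by (simp add: \<delta>_def power2_eq_square)
          also have "\<dots> \<le> 1" using n1 by simp
          finally show ?thesis using \<delta> by simp
        qed
        ultimately show ?thesis unfolding z_def using norm_triangle_ineq[of "P (pow w j) y" "(real j * \<delta>) *\<^sub>R e"]
          by linarith
      qed
      then have "C * (norm k)\<^sup>2 * norm z \<le> C * (H / n)\<^sup>2 * (R + 1)"
        using C(1) k_norm nn by (intro mult_mono power_mono) auto
      also have "\<dots> = \<delta>" by (simp add: \<delta>_def D_def power_divide)
      finally have err: "C * (norm k)\<^sup>2 * norm z \<le> \<delta>" .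
      have "P w z + \<delta> *\<^sub>R e \<in> psd"
      proof -
        have "P w z + (C * (norm k)\<^sup>2 * norm z) *\<^sub>R e \<in> psd" using C(2)[OF z, of k] by (simp add: k_def)
        moreover have "(\<delta> - C * (norm k)\<^sup>2 * norm z) *\<^sub>R e \<in> psd"
          using err unit_pd pd_subset_psd by (intro psd_scale) auto
        ultimately have "P w z + (C * (norm k)\<^sup>2 * norm z) *\<^sub>R e + (\<delta> - C * (norm k)\<^sup>2 * norm z) *\<^sub>R e \<in> psd"
          by (rule psd_add)
        then show ?thesis by (simp add: algebra_simps)
      qed
      \<comment> \<open>P w sends the old error j \<delta> e to j \<delta> (w \<odot> w), which is
        below j \<delta> e because the eigenvalues of w are at most 1: errors add up but are not
        amplified.\<close>
      moreover have "(real j * \<delta>) *\<^sub>R (e - w \<odot> w) \<in> psd"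
      proof (rule psd_scale)
        have "e - w \<odot> w = (\<Sum>c\<in>S. (1 - lam c powr (1 / n) * lam c powr (1 / n)) *\<^sub>R c)"
          unfolding w_def system_mult[OF S(1)] using idem_systemD(4)[OF S(1)]
          by (simp add: scaleR_diff_left sum_subtractf)
        also have "\<dots> \<in> psd" by (rule system_psd[OF S(1)]) (simp add: le1 mult_le_one)
        finally show "e - w \<odot> w \<in> psd" .
      qed (use \<delta> in simp)
      ultimately have "P w z + \<delta> *\<^sub>R e + (real j * \<delta>) *\<^sub>R (e - w \<odot> w) \<in> psd" by (rule psd_add)
      moreover have "P w z = P (pow w (Suc j)) y + (real j * \<delta>) *\<^sub>R (w \<odot> w)"
        unfolding z_def using P_mult[of w w "pow w j" y] by (simp add: P_linear)
      ultimately show ?case by (simp add: algebra_simps)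
    qed
    from this[of n] have "P u y + (real n * \<delta>) *\<^sub>R e \<in> psd" using \<open>pow w n = u\<close> by simp
    moreover have "real n * \<delta> = D / n" using n1 by (simp add: \<delta>_def power2_eq_square)
    ultimately show ?thesis by simp
  qed
  have "(\<lambda>n. D / real n) \<longlonglongrightarrow> 0" by (rule lim_const_over_n)
  then show ?thesis using closed_psd_limit[of n0 "P u y" "\<lambda>n. D / real n"] main by blast
qed

lemma P_psd:
  assumes "u \<in> pd" "y \<in> psd"
  shows "P u y \<in> psd"
proof -
  obtain S lam where S: "idem_system S (\<lambda>c. c)" "u = (\<Sum>c\<in>S. lam c *\<^sub>R c)"
    and lam: "\<And>c. c \<in> S \<Longrightarrow> 0 < lam c" using pd_spectral[OF assms(1)] by metis
  have fin: "finite S" using idem_systemD(1)[OF S(1)] .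
  \<comment> \<open>Scales all eigenvalues to at most 1; P is homogeneous of degree two, so the
    factor can be undone.\<close>
  define t where "t = 1 / (1 + (\<Sum>c\<in>S. lam c))"
  have pos: "0 \<le> (\<Sum>c\<in>S. lam c)" using lam by (intro sum_nonneg) (auto simp: less_imp_le)
  then have t: "t > 0" by (simp add: t_def)
  have "P (t *\<^sub>R u) y \<in> psd"
  proof (rule P_psd_contraction[OF S(1) _ _ assms(2)])
    show "t *\<^sub>R u = (\<Sum>c\<in>S. (t * lam c) *\<^sub>R c)" by (simp add: S(2) scaleR_sum_right)
    fix c assume c: "c \<in> S"
    have "lam c \<le> (\<Sum>c\<in>S. lam c)" using lam fin c by (intro member_le_sum) (auto simp: less_imp_le)
    then show "0 < t * lam c \<and> t * lam c \<le> 1" using lam[OF c] t pos by (simp add: t_def divide_simps)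
  qed
  then have "inverse (t\<^sup>2) *\<^sub>R P (t *\<^sub>R u) y \<in> psd" by (rule psd_scale) simp
  then show ?thesis using t by (simp add: P_scale)
qed

text \<open>Split y into \<epsilon> e and a remainder in \<open>psd\<close>; the first part is
  mapped to \<epsilon> (u \<odot> u), which lies in \<open>pd\<close>.\<close>

lemma P_pd:
  assumes "u \<in> pd" "y \<in> pd"
  shows "P u y \<in> pd"
proof -
  obtain \<epsilon> where \<epsilon>: "\<epsilon> > 0" "\<And>v. \<epsilon> * (v \<bullet> v) \<le> v \<bullet> (y \<odot> v)" using coercive[OF assms(2)] by blast
  have "y - \<epsilon> *\<^sub>R e \<in> psd" using \<epsilon> by (simp add: psd_def bilin inner_diff_right)
  then have "\<epsilon> *\<^sub>R (u \<odot> u) + P u (y - \<epsilon> *\<^sub>R e) \<in> pd"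
    using \<epsilon> assms by (intro pd_add_psd pd_scale pd_square P_psd) auto
  then show ?thesis by (simp add: P_linear)
qed

section \<open>Calculus and monotonicity of the inverse\<close>

text \<open>Half of the coercivity constant of x survives in a neighbourhood, so inverting
  multiplication by y is bounded uniformly there.\<close>

lemma jinv_lipschitz:
  assumes "x \<in> pd"
  obtains r C where "r > 0" "C > 0" "\<And>y. norm (y - x) < r \<Longrightarrow> y \<in> pd"
    "\<And>y v. norm (y - x) < r \<Longrightarrow> norm v \<le> C * norm (y \<odot> v)"
proof -
  obtain \<epsilon> where \<epsilon>: "\<epsilon> > 0" "\<And>v. \<epsilon> * (v \<bullet> v) \<le> v \<bullet> (x \<odot> v)" using coercive[OF assms] by blast
  obtain K where K: "K > 0" "\<And>x y. norm (x \<odot> y) \<le> K * norm x * norm y" using mult_bound by blast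
  have c: "\<epsilon> / 2 * (v \<bullet> v) \<le> v \<bullet> (y \<odot> v)" if "norm (y - x) < \<epsilon> / 2 / K" for y v
  proof -
    have "K * norm (y - x) \<le> \<epsilon> / 2" using that K(1) by (simp add: field_simps)
    then show ?thesis using pd_perturb[OF K(2) \<epsilon>(2)] by fastforce
  qed
  show thesis
  proof (rule that[of "\<epsilon> / 2 / K" "2 / \<epsilon>"])
    fix y assume y: "norm (y - x) < \<epsilon> / 2 / K"
    show "y \<in> pd" using coercive_pd[of "\<epsilon> / 2" y] c[OF y] \<epsilon>(1) by simp
    fix v show "norm v \<le> 2 / \<epsilon> * norm (y \<odot> v)"
      using coercive_norm[of "\<epsilon> / 2" y v] c[OF y] \<epsilon>(1) by (simp add: field_simps)
  qed (use \<epsilon>(1) K(1) in auto)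
qed

text \<open>Multiplying \<open>jinv y - jinv x\<close> by y gives - (y - x) \<odot>
  \<open>jinv x\<close>, which takes the place of the resolvent identity.\<close>

lemma isCont_jinv:
  assumes "x \<in> pd"
  shows "isCont jinv x"
proof -
  obtain r C where r: "r > 0" "C > 0" "\<And>y. norm (y - x) < r \<Longrightarrow> y \<in> pd"
    "\<And>y v. norm (y - x) < r \<Longrightarrow> norm v \<le> C * norm (y \<odot> v)" using jinv_lipschitz[OF assms] by blast
  have "\<forall>\<^sub>F y in at x. norm (y - x) < r"
    using eventually_at_ball[OF r(1), of x UNIV] by (simp add: dist_norm norm_minus_commute)
  then have "\<forall>\<^sub>F y in at x. norm (jinv y - jinv x) \<le> C * norm ((y - x) \<odot> jinv x)"
  proof eventually_elim
    case (elim y)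
    have "y \<odot> (jinv y - jinv x) = - ((y - x) \<odot> jinv x)"
      using mult_jinv[OF assms] mult_jinv[OF r(3)[OF elim]] by (simp add: bilin)
    then show ?case using r(4)[OF elim, of "jinv y - jinv x"] by simp
  qed
  moreover have "((\<lambda>y. C * norm ((y - x) \<odot> jinv x)) \<longlongrightarrow> C * norm ((x - x) \<odot> jinv x)) (at x)"
    by (intro tendsto_intros prod.tendsto)
  then have "((\<lambda>y. C * norm ((y - x) \<odot> jinv x)) \<longlongrightarrow> 0) (at x)" by (simp add: bilin)
  ultimately have "((\<lambda>y. jinv y - jinv x) \<longlongrightarrow> 0) (at x)"
    by (rule Lim_null_comparison)
  then show ?thesis unfolding isCont_def using LIM_zero_iff by blast
qed

lemma continuous_on_jinv: "continuous_on pd jinv"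
  using isCont_jinv by (simp add: continuous_at_imp_continuous_on)

text \<open>Multiplied by x + t y, the error of the difference quotient becomes - t (y \<odot> v)
  with v the claimed derivative, so by \<open>jinv_lipschitz\<close> it is of order t.\<close>

lemma jinv_derivative:
  assumes x: "x \<in> pd"
  shows "((\<lambda>t. (jinv (x + t *\<^sub>R y) - jinv x) /\<^sub>R t) \<longlongrightarrow> - P (jinv x) y) (at 0)"
proof -
  obtain r C where r: "r > 0" "C > 0" "\<And>y. norm (y - x) < r \<Longrightarrow> y \<in> pd"
    "\<And>y v. norm (y - x) < r \<Longrightarrow> norm v \<le> C * norm (y \<odot> v)" using jinv_lipschitz[OF x] by blast
  let ?v = "- P (jinv x) y"
  have xv: "x \<odot> ?v = - (y \<odot> jinv x)" using mult_P_jinv[OF x, of y] by (simp add: bilin comm)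
  have "((\<lambda>t. norm (t *\<^sub>R y)) \<longlongrightarrow> norm (0 *\<^sub>R y)) (at 0)" by (intro tendsto_intros)
  then have "\<forall>\<^sub>F t in at 0. norm (t *\<^sub>R y) < r" using r(1) by (auto dest: order_tendstoD(2))
  moreover have "\<forall>\<^sub>F t in at (0::real). t \<noteq> 0" by (simp add: eventually_at_filter)
  ultimately have "\<forall>\<^sub>F t in at 0. norm ((jinv (x + t *\<^sub>R y) - jinv x) /\<^sub>R t - ?v) \<le> C * norm (t *\<^sub>R (y \<odot> ?v))"
  proof eventually_elim
    case (elim t)
    let ?z = "x + t *\<^sub>R y"
    have near: "norm (?z - x) < r" using elim by simp
    have "?z \<odot> (jinv ?z - jinv x) = - t *\<^sub>R (y \<odot> jinv x)"
      using mult_jinv[OF x] mult_jinv[OF r(3)[OF near]] by (simp add: bilin)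
    then have "?z \<odot> ((jinv ?z - jinv x) /\<^sub>R t) = - (y \<odot> jinv x)"
      using elim by (simp add: prod.scaleR_right)
    then have "?z \<odot> ((jinv ?z - jinv x) /\<^sub>R t - ?v) = - (t *\<^sub>R (y \<odot> ?v))"
      using xv by (simp only: prod.diff_right prod.add_left prod.scaleR_left) simp
    then show ?case using r(4)[OF near] by (metis norm_minus_cancel)
  qed
  moreover have "((\<lambda>t. C * norm (t *\<^sub>R (y \<odot> ?v))) \<longlongrightarrow> C * norm (0 *\<^sub>R (y \<odot> ?v))) (at 0)"
    by (intro tendsto_intros)
  then have "((\<lambda>t. C * norm (t *\<^sub>R (y \<odot> ?v))) \<longlongrightarrow> 0) (at 0)" by simp
  ultimately have "((\<lambda>t. (jinv (x + t *\<^sub>R y) - jinv x) /\<^sub>R t - ?v) \<longlongrightarrow> 0) (at 0)"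
    by (rule Lim_null_comparison)
  then show ?thesis using LIM_zero_iff by blast
qed

text \<open>Tested against an idempotent, the inverse along x + t y has derivative - (P
  (\<open>jinv z\<close>) y \<bullet> c) with z = x + t y, and \<open>P_pd\<close> makes it
  negative.\<close>

lemma jinv_antimono:
  assumes x: "x \<in> pd" and y: "y \<in> pd"
  shows "jinv x - jinv (x + y) \<in> pd"
proof (rule pd_test)
  fix c assume c: "c \<odot> c = c" "c \<noteq> 0"
  let ?g = "\<lambda>t. jinv (x + t *\<^sub>R y) \<bullet> c"
  have "?g 1 < ?g 0"
  proof (rule DERIV_neg_imp_decreasing[of 0 1 ?g])
    fix t :: real assume t: "0 \<le> t" "t \<le> 1"
    let ?z = "x + t *\<^sub>R y"
    have z: "?z \<in> pd" using t x y pd_add_psd psd_scale pd_subset_psd by blast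
    have "((\<lambda>h. ((jinv (?z + h *\<^sub>R y) - jinv ?z) /\<^sub>R h) \<bullet> c) \<longlongrightarrow> (- P (jinv ?z) y) \<bullet> c) (at 0)"
      by (intro tendsto_intros jinv_derivative z)
    then have "(?g has_real_derivative - (P (jinv ?z) y \<bullet> c)) (at t)"
      unfolding DERIV_def by (simp add: algebra_simps inner_diff_left divide_inverse)
    moreover have "0 < P (jinv ?z) y \<bullet> c" using z y c by (intro pd_inner_idem P_pd) auto
    ultimately show "\<exists>D. (?g has_real_derivative D) (at t) \<and> D < 0" by auto
  qed simp
  then show "0 < (jinv x - jinv (x + y)) \<bullet> c" by (simp add: inner_diff_left)
qed

lemma jinv_tendsto_0:
  assumes "x \<in> pd"
  shows "((\<lambda>t. jinv (x + t *\<^sub>R e)) \<longlongrightarrow> 0) at_top"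
proof (rule Lim_null_comparison)
  show "\<forall>\<^sub>F t in at_top. norm (jinv (x + t *\<^sub>R e)) \<le> norm e / t"
    using eventually_gt_at_top[of 0]
  proof eventually_elim
    case (elim t)
    let ?z = "x + t *\<^sub>R e"
    have z: "?z \<in> pd" using elim assms by auto
    have "t * (v \<bullet> v) \<le> v \<bullet> (?z \<odot> v)" for v
      using assms pd_subset_psd by (auto simp: psd_def bilin inner_add_right)
    then have "t * norm (jinv ?z) \<le> norm (?z \<odot> jinv ?z)" by (rule coercive_norm[OF elim])
    then show ?case using elim mult_jinv[OF z] by (simp add: field_simps)
  qed
  show "((\<lambda>t::real. norm e / t) \<longlongrightarrow> 0) at_top"
    by (intro tendsto_divide_0[OF tendsto_const] filterlim_at_top_imp_at_infinity filterlim_ident)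
qed

end

section \<open>Additive functions and the functional equation on a ray\<close>

lemma linear_functional_inner:
  fixes T :: "'a::euclidean_space \<Rightarrow> real"
  assumes "linear T"
  obtains f where "\<And>v. T v = f \<bullet> v"
  using that[of "adjoint T 1"] adjoint_works[OF assms, of _ 1] by (simp add: inner_commute)

lemma additive_continuous_homogeneous:
  fixes g :: "real \<Rightarrow> real"
  assumes add: "\<And>s t. \<lbrakk>s > 0; t > 0\<rbrakk> \<Longrightarrow> g (s + t) = g s + g t"
    and cont: "continuous_on {0<..} g" and t: "t > 0"
  shows "g t = t * g 1"
proof -
  have nat: "g (real (Suc n) * s) = real (Suc n) * g s" if "s > 0" for n s
  proof (induction n)
    case (Suc n)
    have "g (real (Suc n) * s + s) = g (real (Suc n) * s) + g s"
      using that by (intro add) auto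
    then show ?case using Suc by (simp add: algebra_simps)
  qed simp
  \<comment> \<open>Rational approximations from above; the outer Suc keeps them positive, where
    additivity is available.\<close>
  define r where "r n = real (Suc (nat \<lfloor>real (Suc n) * t\<rfloor>)) / real (Suc n)" for n
  have r: "r n > 0" "g (r n) = r n * g 1" for n
  proof -
    show "r n > 0" unfolding r_def by simp
    have "real (Suc n) * g (r n) = g (real (Suc n) * r n)" using nat \<open>r n > 0\<close> by simp
    also have "\<dots> = g (real (Suc (nat \<lfloor>real (Suc n) * t\<rfloor>)) * 1)" by (simp add: r_def)
    also have "\<dots> = real (Suc (nat \<lfloor>real (Suc n) * t\<rfloor>)) * g 1" by (rule nat) simp
    finally show "g (r n) = r n * g 1" by (simp add: r_def field_simps)
  qed
  have "r \<longlonglongrightarrow> t"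
  proof (rule tendsto_sandwich)
    have "real (Suc n) * t \<le> real (Suc (nat \<lfloor>real (Suc n) * t\<rfloor>))" for n
      using t by (simp add: of_nat_nat) linarith
    then have "t \<le> r n" for n unfolding r_def by (subst le_divide_eq) (simp add: mult.commute)
    then show "\<forall>\<^sub>F n in sequentially. t \<le> r n" by simp
    have "real (Suc (nat \<lfloor>real (Suc n) * t\<rfloor>)) \<le> real (Suc n) * t + 1" for n
      using t by (simp add: of_nat_nat)
    then have "r n \<le> t + inverse (real (Suc n))" for n
      unfolding r_def by (subst divide_le_eq) (simp add: algebra_simps inverse_eq_divide add_divide_distrib)
    then show "\<forall>\<^sub>F n in sequentially. r n \<le> t + inverse (real (Suc n))" by simp
    show "(\<lambda>n. t + inverse (real (Suc n))) \<longlonglongrightarrow> t"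
      using tendsto_add[OF tendsto_const LIMSEQ_inverse_real_of_nat] by simp
  qed simp
  moreover have "isCont g t" using cont t by (simp add: continuous_on_eq_continuous_at)
  ultimately have "(\<lambda>n. g (r n)) \<longlonglongrightarrow> g t" using isCont_tendsto_compose by blast
  moreover have "(\<lambda>n. g (r n)) \<longlonglongrightarrow> t * g 1"
    unfolding r(2) by (intro tendsto_intros \<open>r \<longlonglongrightarrow> t\<close>)
  ultimately show ?thesis by (rule LIMSEQ_unique)
qed

text \<open>Every vector is a difference of two elements of an open cone, so A extends to the linear
  map sending x - y to A x - A y.\<close>

lemma additive_on_open_cone:
  fixes A :: "'a::euclidean_space \<Rightarrow> real"
  assumes K: "open K" "p \<in> K" "\<And>x y. \<lbrakk>x \<in> K; y \<in> K\<rbrakk> \<Longrightarrow> x + y \<in> K"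
      "\<And>x t. \<lbrakk>x \<in> K; t > 0\<rbrakk> \<Longrightarrow> t *\<^sub>R x \<in> K"
    and add: "\<And>x y. \<lbrakk>x \<in> K; y \<in> K\<rbrakk> \<Longrightarrow> A (x + y) = A x + A y"
    and cont: "continuous_on K A"
  obtains f where "\<And>x. x \<in> K \<Longrightarrow> A x = f \<bullet> x"
proof -
  have hom: "A (t *\<^sub>R x) = t * A x" if "x \<in> K" "t > 0" for x t
  proof -
    have "continuous_on {0<..} (\<lambda>s. A (s *\<^sub>R x))"
      by (rule continuous_on_compose2[OF cont]) (use K that in \<open>auto intro!: continuous_intros\<close>)
    then show ?thesis
      using additive_continuous_homogeneous[of "\<lambda>s. A (s *\<^sub>R x)" t] that K add[of "_ *\<^sub>R x" "_ *\<^sub>R x"]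
      by (simp add: scaleR_left_distrib)
  qed
  define T where "T v = (THE d. \<exists>x\<in>K. \<exists>y\<in>K. v = x - y \<and> d = A x - A y)" for v
  have T: "T (x - y) = A x - A y" if "x \<in> K" "y \<in> K" for x y
    unfolding T_def
  proof (rule the_equality)
    fix d assume "\<exists>x'\<in>K. \<exists>y'\<in>K. x - y = x' - y' \<and> d = A x' - A y'"
    then obtain x' y' where *: "x' \<in> K" "y' \<in> K" "x + y' = x' + y" "d = A x' - A y'"
      by (auto simp: algebra_simps)
    then have "A x + A y' = A x' + A y" using add that by metis
    then show "d = A x - A y" using * by simp
  qed (use that in blast)
  have ex: "\<exists>x\<in>K. \<exists>y\<in>K. v = x - y" for v
  proof -
    obtain r where r: "r > 0" "ball p r \<subseteq> K" using K(1,2) by (meson open_contains_ball)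
    \<comment> \<open>Small enough for p + s v to stay in the ball; scaling p + s v and p by 1 / s
      represents v as a difference.\<close>
    define s where "s = r / (2 * (norm v + 1))"
    have n: "norm v + 1 > 0" using norm_ge_zero[of v] by linarith
    then have "s > 0" using r by (simp add: s_def)
    have "s * norm v \<le> s * (norm v + 1)" using \<open>s > 0\<close> by simp
    also have "\<dots> = r / 2" using n unfolding s_def by (simp add: field_simps)
    also have "\<dots> < r" using r by simp
    finally have "p + s *\<^sub>R v \<in> ball p r" using \<open>s > 0\<close> by (simp add: dist_norm)
    then have "p + s *\<^sub>R v \<in> K" using r(2) by blast
    then have "(1 / s) *\<^sub>R (p + s *\<^sub>R v) \<in> K" "(1 / s) *\<^sub>R p \<in> K" using K \<open>s > 0\<close> by auto
    moreover have "v = (1 / s) *\<^sub>R (p + s *\<^sub>R v) - (1 / s) *\<^sub>R p"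
      using \<open>s > 0\<close> by (simp add: algebra_simps)
    ultimately show ?thesis by blast
  qed
  have Tpos: "T (t *\<^sub>R v) = t * T v" if "t > 0" for t v
  proof -
    obtain x y where xy: "x \<in> K" "y \<in> K" "v = x - y" using ex by blast
    then show ?thesis using T[of "t *\<^sub>R x" "t *\<^sub>R y"] T[of x y] K that
      by (simp add: hom scaleR_diff_right right_diff_distrib)
  qed
  have Tneg: "T (- v) = - T v" for v
  proof -
    obtain x y where xy: "x \<in> K" "y \<in> K" "v = x - y" using ex by blast
    then show ?thesis using T[of x y] T[of y x] by simp
  qed
  have "linear T"
  proof (rule linearI)
    fix v w
    obtain x y where "x \<in> K" "y \<in> K" "v = x - y" using ex[of v] by blast
    moreover obtain x' y' where "x' \<in> K" "y' \<in> K" "w = x' - y'" using ex[of w] by blast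
    ultimately have "v + w = (x + x') - (y + y')" "T v = A x - A y" "T w = A x' - A y'"
      "T ((x + x') - (y + y')) = A (x + x') - A (y + y')" "A (x + x') = A x + A x'" "A (y + y') = A y + A y'"
      using T K(3) add by auto
    then show "T (v + w) = T v + T w" by simp
  next
    fix t :: real and v
    consider "t > 0" | "t = 0" | "t < 0" by linarith
    then show "T (t *\<^sub>R v) = t *\<^sub>R T v"
    proof cases
      case 2 then show ?thesis using T[of p p] K by simp
    next
      case 3 then show ?thesis using Tpos[of "- t" v] Tneg[of "t *\<^sub>R v"] by simp
    qed (simp add: Tpos)
  qed
  then obtain f where f: "\<And>v. T v = f \<bullet> v" using linear_functional_inner by blast
  show thesis
  proof (rule that[of f])
    fix x assume x: "x \<in> K"
    have "A x = T (x + x - x)" using T[of "x + x" x] add[of x x] K x by simp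
    then show "A x = f \<bullet> x" using f by simp
  qed
qed

text \<open>As y tends to infinity the increment t^2 / y tends to 0, so y (\<beta> (t + y) - \<beta>
  y) tends to t^2 times the derivative of \<phi>, that is, to t p t. Splitting an increment of
  length s + t shows that this limit is additive in t, hence linear.\<close>

lemma ray_equation_C1:
  fixes \<phi> \<beta> p :: "real \<Rightarrow> real"
  assumes eq: "\<And>t y. \<lbrakk>t > 0; y > 0\<rbrakk> \<Longrightarrow> \<phi> (t + t\<^sup>2 / y) - \<phi> t = \<beta> (t + y) - \<beta> y"
    and der: "\<And>t. t > 0 \<Longrightarrow> (\<phi> has_real_derivative p t / t) (at t)"
    and cont: "continuous_on {0<..} p"
  obtains c where "\<And>t. t > 0 \<Longrightarrow> p t = c"
proof -
  have lim: "((\<lambda>y. y * (\<beta> (t + y) - \<beta> y)) \<longlongrightarrow> t * p t) at_top" if t: "t > 0" for t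
  proof -
    have "((\<lambda>h. (\<phi> (t + h) - \<phi> t) / h) \<longlongrightarrow> p t / t) (at 0)"
      using der[OF t] unfolding DERIV_def .
    moreover have "filterlim (\<lambda>y::real. t\<^sup>2 / y) (at 0) at_top"
      unfolding filterlim_at
      using t by (auto intro!: tendsto_divide_0[OF tendsto_const] filterlim_at_top_imp_at_infinity filterlim_ident
          eventually_mono[OF eventually_gt_at_top[of 0]])
    ultimately have "((\<lambda>y. (\<phi> (t + t\<^sup>2 / y) - \<phi> t) / (t\<^sup>2 / y)) \<longlongrightarrow> p t / t) at_top"
      by (rule filterlim_compose)
    then have "((\<lambda>y. t\<^sup>2 * ((\<phi> (t + t\<^sup>2 / y) - \<phi> t) / (t\<^sup>2 / y))) \<longlongrightarrow> t\<^sup>2 * (p t / t)) at_top"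
      by (rule tendsto_mult[OF tendsto_const])
    moreover have "\<forall>\<^sub>F y in at_top. t\<^sup>2 * ((\<phi> (t + t\<^sup>2 / y) - \<phi> t) / (t\<^sup>2 / y)) = y * (\<beta> (t + y) - \<beta> y)"
      using eventually_gt_at_top[of 0] by eventually_elim (use eq t in simp)
    ultimately have "((\<lambda>y. y * (\<beta> (t + y) - \<beta> y)) \<longlongrightarrow> t\<^sup>2 * (p t / t)) at_top"
      by (simp add: tendsto_cong)
    then show ?thesis using t by (simp add: power2_eq_square)
  qed
  have add: "(s + t) * p (s + t) = s * p s + t * p t" if st: "s > 0" "t > 0" for s t
  proof -
    have shift: "filterlim (\<lambda>y::real. t + y) at_top at_top"
      by (rule filterlim_tendsto_add_at_top[OF tendsto_const filterlim_ident])
    have "((\<lambda>y. (t + y) * (\<beta> (s + (t + y)) - \<beta> (t + y))) \<longlongrightarrow> s * p s) at_top"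
      by (rule filterlim_compose[OF lim[OF st(1)] shift])
    \<comment> \<open>The factor equals y / (t + y); it turns the weight t + y of the shifted limit
      into y.\<close>
    moreover have "((\<lambda>y::real. 1 - t / (t + y)) \<longlongrightarrow> 1 - 0) at_top"
      by (intro tendsto_intros tendsto_divide_0[OF tendsto_const] filterlim_at_top_imp_at_infinity shift)
    ultimately have "((\<lambda>y. (1 - t / (t + y)) * ((t + y) * (\<beta> (s + (t + y)) - \<beta> (t + y)))) \<longlongrightarrow> (1 - 0) * (s * p s)) at_top"
      by (rule tendsto_mult[rotated])
    then have "((\<lambda>y. (1 - t / (t + y)) * ((t + y) * (\<beta> (s + (t + y)) - \<beta> (t + y))) + y * (\<beta> (t + y) - \<beta> y))
        \<longlongrightarrow> (1 - 0) * (s * p s) + t * p t) at_top"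
      by (rule tendsto_add[OF _ lim[OF st(2)]])
    moreover have "\<forall>\<^sub>F y in at_top. (1 - t / (t + y)) * ((t + y) * (\<beta> (s + (t + y)) - \<beta> (t + y))) + y * (\<beta> (t + y) - \<beta> y)
        = y * (\<beta> ((s + t) + y) - \<beta> y)"
      using eventually_gt_at_top[of 0]
    proof eventually_elim
      case (elim y)
      then have *: "(1 - t / (t + y)) * (t + y) = y" using st by (simp add: field_simps)
      show ?case unfolding mult.assoc[symmetric] * by (simp add: algebra_simps)
    qed
    ultimately have "((\<lambda>y. y * (\<beta> ((s + t) + y) - \<beta> y)) \<longlongrightarrow> s * p s + t * p t) at_top"
      by (simp add: tendsto_cong)
    moreover have "((\<lambda>y. y * (\<beta> ((s + t) + y) - \<beta> y)) \<longlongrightarrow> (s + t) * p (s + t)) at_top"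
      using st by (intro lim) auto
    ultimately show ?thesis using tendsto_unique trivial_limit_at_top_linorder by blast
  qed
  have "p t = p 1" if "t > 0" for t
  proof -
    have "t * p t = t * (1 * p 1)"
      by (rule additive_continuous_homogeneous[of "\<lambda>t. t * p t"])
        (use add that cont in \<open>auto intro!: continuous_intros\<close>)
    then show ?thesis using that by simp
  qed
  then show thesis using that by blast
qed

text \<open>Averaging over dilations turns a continuous solution into a continuously differentiable
  one, with \<open>t \<Phi>'(t) = \<phi> (t exp k) - \<phi> t\<close>.\<close>

lemma ray_equation_dilation:
  fixes \<phi> \<beta> :: "real \<Rightarrow> real"
  assumes eq: "\<And>t y. \<lbrakk>t > 0; y > 0\<rbrakk> \<Longrightarrow> \<phi> (t + t\<^sup>2 / y) - \<phi> t = \<beta> (t + y) - \<beta> y"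
    and cont: "continuous_on {0<..} \<phi>" "continuous_on {0<..} \<beta>" and k: "k > 0" and t: "t > 0"
  shows "\<phi> (t * exp k) - \<phi> t = \<phi> (exp k) - \<phi> 1"
proof -
  define \<Phi> where "\<Phi> t = integral {0..k} (\<lambda>s. \<phi> (t * exp s))" for t
  define B where "B t = integral {0..k} (\<lambda>s. \<beta> (t * exp s))" for t
  have int: "(\<lambda>s. \<phi> (t * exp s)) integrable_on {0..k}" "(\<lambda>s. \<beta> (t * exp s)) integrable_on {0..k}" if "t > 0" for t
    using that
    by (auto intro!: integrable_continuous_interval continuous_on_compose2[OF cont(1)]
        continuous_on_compose2[OF cont(2)] continuous_intros)
  have eqI: "\<Phi> (t + t\<^sup>2 / y) - \<Phi> t = B (t + y) - B y" if "t > 0" "y > 0" for t y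
  proof -
    have pos: "t + t\<^sup>2 / y > 0" "t + y > 0" using that by (auto intro!: add_pos_pos divide_pos_pos)
    have "\<Phi> (t + t\<^sup>2 / y) - \<Phi> t = integral {0..k} (\<lambda>s. \<phi> ((t + t\<^sup>2 / y) * exp s) - \<phi> (t * exp s))"
      unfolding \<Phi>_def using integral_diff[OF int(1)[OF pos(1)] int(1)[OF that(1)]] by simp
    also have "\<dots> = integral {0..k} (\<lambda>s. \<beta> ((t + y) * exp s) - \<beta> (y * exp s))"
    proof (rule integral_cong)
      fix s :: real
      \<comment> \<open>Scaling t and y by a common factor preserves the form of the equation, so
        averages satisfy it too.\<close>
      have "(t * exp s)\<^sup>2 / (y * exp s) = t\<^sup>2 / y * exp s" by (simp add: power2_eq_square)
      then show "\<phi> ((t + t\<^sup>2 / y) * exp s) - \<phi> (t * exp s) = \<beta> ((t + y) * exp s) - \<beta> (y * exp s)"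
        using eq[of "t * exp s" "y * exp s"] that by (simp add: distrib_right)
    qed
    also have "\<dots> = B (t + y) - B y"
      unfolding B_def using integral_diff[OF int(2)[OF pos(2)] int(2)[OF that(2)]] by simp
    finally show ?thesis .
  qed
  \<comment> \<open>With an antiderivative G of \<phi> (exp s) the average becomes G (ln t + k) - G
    (ln t), to which the chain rule applies.\<close>
  have "continuous_on UNIV (\<lambda>s. \<phi> (exp s))"
    by (rule continuous_on_compose2[OF cont(1)]) (auto intro!: continuous_intros)
  then have "\<exists>G. \<forall>x. - \<infinity> < ereal x \<longrightarrow> ereal x < \<infinity> \<longrightarrow> (G has_vector_derivative \<phi> (exp x)) (at x)"
    by (intro einterval_antiderivative) (auto simp: continuous_on_eq_continuous_at)
  then obtain G where G: "\<And>x. (G has_real_derivative \<phi> (exp x)) (at x)"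
    by (auto simp: has_real_derivative_iff_has_vector_derivative)
  have \<Phi>: "\<Phi> t = G (ln t + k) - G (ln t)" if "t > 0" for t
  proof -
    have "((\<lambda>s. \<phi> (t * exp s)) has_integral G (ln t + k) - G (ln t + 0)) {0..k}"
    proof (rule fundamental_theorem_of_calculus)
      fix s
      have "((\<lambda>s. G (ln t + s)) has_real_derivative \<phi> (exp (ln t + s)) * 1) (at s within {0..k})"
        by (rule DERIV_chain2[OF G]) (auto intro!: derivative_eq_intros)
      then show "((\<lambda>s. G (ln t + s)) has_vector_derivative \<phi> (t * exp s)) (at s within {0..k})"
        using that by (simp add: has_real_derivative_iff_has_vector_derivative exp_add)
    qed (use k in simp)
    then show ?thesis unfolding \<Phi>_def by (simp add: integral_unique)
  qed
  have der: "(\<Phi> has_real_derivative (\<phi> (t * exp k) - \<phi> t) / t) (at t)" if "t > 0" for t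
  proof -
    have "((\<lambda>t. G (ln t + k) - G (ln t)) has_real_derivative \<phi> (exp (ln t + k)) * (1 / t) - \<phi> (exp (ln t)) * (1 / t)) (at t)"
      using that by (intro DERIV_diff DERIV_chain2[OF G]) (auto intro!: derivative_eq_intros)
    then have "((\<lambda>t. G (ln t + k) - G (ln t)) has_real_derivative (\<phi> (t * exp k) - \<phi> t) / t) (at t)"
      using that by (simp add: exp_add diff_divide_distrib)
    then show ?thesis
    proof (rule has_field_derivative_transform_within_open[of _ _ _ "{0<..}"])
      show "\<And>x. x \<in> {0<..} \<Longrightarrow> G (ln x + k) - G (ln x) = \<Phi> x" using \<Phi> by simp
    qed (use that in auto)
  qed
  have "continuous_on {0<..} (\<lambda>t. \<phi> (t * exp k) - \<phi> t)"
    by (intro continuous_intros continuous_on_compose2[OF cont(1)] cont) auto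
  then obtain c where c: "\<And>t. t > 0 \<Longrightarrow> \<phi> (t * exp k) - \<phi> t = c"
    using ray_equation_C1[of \<Phi> B "\<lambda>t. \<phi> (t * exp k) - \<phi> t", OF eqI der] by blast
  show ?thesis using c[OF t] c[of 1] by simp
qed

text \<open>\<open>ray_equation_dilation\<close> makes \<phi> (exp k) - \<phi> 1 additive in k, so
  \<phi> is logarithmic; the equation then determines the increments of \<beta>.\<close>

lemma ray_equation:
  fixes \<phi> \<beta> :: "real \<Rightarrow> real"
  assumes eq: "\<And>t y. \<lbrakk>t > 0; y > 0\<rbrakk> \<Longrightarrow> \<phi> (t + t\<^sup>2 / y) - \<phi> t = \<beta> (t + y) - \<beta> y"
    and cont: "continuous_on {0<..} \<phi>" "continuous_on {0<..} \<beta>"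
  obtains q where "\<And>t. t > 0 \<Longrightarrow> \<phi> t = \<phi> 1 + q * ln t" "\<And>t. t > 0 \<Longrightarrow> \<beta> t = \<beta> 1 + q * ln t"
proof -
  note dil = ray_equation_dilation[OF eq cont]
  define \<alpha> where "\<alpha> k = \<phi> (exp k) - \<phi> 1" for k
  define q where "q = \<alpha> 1"
  have \<alpha>: "\<alpha> k = k * q" if "k > 0" for k
    unfolding q_def
  proof (rule additive_continuous_homogeneous[OF _ _ that])
    show "\<alpha> (s + t) = \<alpha> s + \<alpha> t" if "s > 0" "t > 0" for s t
      using dil[of t "exp s"] that by (simp add: \<alpha>_def exp_add)
    show "continuous_on {0<..} \<alpha>" unfolding \<alpha>_def
      by (intro continuous_intros continuous_on_compose2[OF cont(1)]) auto
  qed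
  have \<phi>: "\<phi> t = \<phi> 1 + q * ln t" if t: "t > 0" for t
  proof -
    consider "t > 1" | "t = 1" | "t < 1" by linarith
    then show ?thesis
    proof cases
      case 1 then show ?thesis using \<alpha>[of "ln t"] by (simp add: \<alpha>_def algebra_simps)
    next
      case 3
      have "\<phi> (t * exp (- ln t)) - \<phi> t = \<phi> (exp (- ln t)) - \<phi> 1"
        using 3 t by (intro dil) auto
      moreover have "t * exp (- ln t) = 1" using t by (simp add: exp_minus)
      ultimately show ?thesis using \<alpha>[of "- ln t"] 3 t by (simp add: \<alpha>_def algebra_simps)
    qed simp
  qed
  have less: "\<beta> z = \<beta> y + q * (ln z - ln y)" if "y > 0" "y < z" for y z
  proof -
    define t where "t = z - y"
    have t: "t > 0" using that by (simp add: t_def)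
    have p: "t + t\<^sup>2 / y > 0" using t that by (intro add_pos_pos divide_pos_pos) auto
    have "\<beta> z - \<beta> y = \<phi> (t + t\<^sup>2 / y) - \<phi> t" using eq[OF t that(1)] by (simp add: t_def)
    also have "\<dots> = q * (ln (t + t\<^sup>2 / y) - ln t)" using \<phi>[OF p] \<phi>[OF t] by (simp add: algebra_simps)
    \<comment> \<open>Since t = z - y, the two arguments of \<phi> have ratio z / y.\<close>
    also have "t + t\<^sup>2 / y = t * (z / y)" using that by (simp add: t_def power2_eq_square field_simps)
    also have "ln (t * (z / y)) - ln t = ln z - ln y" using t that by (simp add: ln_mult ln_div)
    finally show ?thesis by simp
  qed
  have "\<beta> t = \<beta> 1 + q * ln t" if t: "t > 0" for t
  proof -
    consider "t > 1" | "t = 1" | "t < 1" by linarith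
    then show ?thesis
    proof cases
      case 1 then show ?thesis using less[of 1 t] by simp
    next
      case 3 then show ?thesis using less[of t 1] t by simp
    qed simp
  qed
  then show thesis using that \<phi> by blast
qed


section \<open>Multiplicative functions on the cone\<close>

context eja begin

lemma P_pow: "P x (pow x n) = pow x (Suc (Suc n))"
  unfolding P_def square_mult_pow by (simp add: scaleR_2)

lemma pow_pd: "x \<in> pd \<Longrightarrow> pow x n \<in> pd"
proof (induction n rule: induct_nat_012)
  case (ge2 n)
  then have "P x (pow x n) \<in> pd" by (intro P_pd)
  then show ?case by (simp only: P_pow)
qed auto

lemma system_P:
  assumes "idem_system I c"
  shows "P (\<Sum>i\<in>I. lam i *\<^sub>R c i) (\<Sum>i\<in>I. mu i *\<^sub>R c i) = (\<Sum>i\<in>I. ((lam i)\<^sup>2 * mu i) *\<^sub>R c i)"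
proof -
  have "2 * (lam i * (lam i * mu i)) - lam i * lam i * mu i = (lam i)\<^sup>2 * mu i" for i
    by (simp add: power2_eq_square)
  then show ?thesis
    unfolding P_def system_mult[OF assms] scaleR_sum_right sum_subtractf[symmetric] scaleR_scaleR
      scaleR_diff_left[symmetric] by (simp only:)
qed

text \<open>The curve exp (t h). Multiplicativity of F becomes additivity in t along it, and every
  element of \<open>pd\<close> lies on such a curve.\<close>

definition exp_line :: "'a \<Rightarrow> real \<Rightarrow> 'a" where "exp_line h t = fcalc (\<lambda>l. exp (t * l)) h"

lemma exp_line:
  shows exp_line_pd: "exp_line h t \<in> pd"
    and P_exp_line: "P (exp_line h s) (exp_line h t) = exp_line h (2 * s + t)"
    and continuous_on_exp_line: "continuous_on UNIV (exp_line h)"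
    and exp_line_derivative: "((\<lambda>t. (exp_line h t - e) /\<^sub>R t) \<longlongrightarrow> h) (at 0)"
    and exp_line_scale: "exp_line (s *\<^sub>R h) 1 = exp_line h s"
proof -
  obtain S lam where S: "idem_system S (\<lambda>c. c)" "h = (\<Sum>c\<in>S. lam c *\<^sub>R c)" using spectral_gen by metis
  have E: "exp_line h = (\<lambda>t. \<Sum>c\<in>S. exp (t * lam c) *\<^sub>R c)"
    unfolding exp_line_def S(2) fcalc_eq[OF S(1)] ..
  show "exp_line h t \<in> pd" unfolding E by (rule system_pd[OF S(1)]) simp
  have E0: "exp_line h 0 = e" unfolding E using idem_systemD(4)[OF S(1)] by simp
  show "P (exp_line h s) (exp_line h t) = exp_line h (2 * s + t)"
    unfolding E system_P[OF S(1)]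
    by (simp add: exp_add distrib_right mult.assoc exp_double)
  show "continuous_on UNIV (exp_line h)" unfolding E by (intro continuous_intros)
  have eq: "(exp_line h t - e) /\<^sub>R t = (\<Sum>c\<in>S. ((exp (t * lam c) - exp (0 * lam c)) / t) *\<^sub>R c)" for t
  proof -
    have "(exp_line h t - exp_line h 0) /\<^sub>R t = (\<Sum>c\<in>S. ((exp (t * lam c) - exp (0 * lam c)) / t) *\<^sub>R c)"
      unfolding E by (simp only: scaleR_sum_right flip: sum_subtractf)
        (intro sum.cong refl, simp add: algebra_simps divide_inverse)
    then show ?thesis by (simp only: E0)
  qed
  have "((\<lambda>t. (exp (t * lam c) - exp (0 * lam c)) / t) \<longlongrightarrow> lam c) (at 0)" for c
  proof -
    have "((\<lambda>t. exp (t * lam c)) has_real_derivative lam c) (at 0)"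
      by (auto intro!: derivative_eq_intros)
    then show ?thesis unfolding DERIV_def by simp
  qed
  then have "((\<lambda>t. \<Sum>c\<in>S. ((exp (t * lam c) - exp (0 * lam c)) / t) *\<^sub>R c) \<longlongrightarrow> (\<Sum>c\<in>S. lam c *\<^sub>R c)) (at 0)"
    by (intro tendsto_intros)
  then show "((\<lambda>t. (exp_line h t - e) /\<^sub>R t) \<longlongrightarrow> h) (at 0)"
    by (simp only: eq S(2)[symmetric])
  have "s *\<^sub>R h = (\<Sum>c\<in>S. (s * lam c) *\<^sub>R c)" by (simp add: S(2) scaleR_sum_right)
  then have "exp_line (s *\<^sub>R h) 1 = (\<Sum>c\<in>S. exp (1 * (s * lam c)) *\<^sub>R c)"
    unfolding exp_line_def by (simp only: fcalc_eq[OF S(1)])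
  then show "exp_line (s *\<^sub>R h) 1 = exp_line h s" unfolding E by simp
qed

end

section \<open>Differentiability at the unit of a continuous multiplicative function\<close>

locale multiplicative_on_cone = eja +
  fixes F :: "'a \<Rightarrow> real"
  assumes F_P: "\<And>x y. \<lbrakk>x \<in> pd; y \<in> pd\<rbrakk> \<Longrightarrow> F (P x y) = 2 * F x + F y"
    and F_cont: "continuous_on pd F"
begin

lemma F_unit: "F e = 0" using F_P[of e e] by simp

lemma F_square: "x \<in> pd \<Longrightarrow> F (x \<odot> x) = 2 * F x"
  using F_P[of x e] by (simp add: F_unit)

lemma F_pow: "x \<in> pd \<Longrightarrow> F (pow x n) = n * F x"
proof (induction n rule: induct_nat_012)
  case (ge2 n)
  have "F (pow x (Suc (Suc n))) = 2 * F x + F (pow x n)"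
    unfolding P_pow[symmetric] using ge2.prems by (intro F_P pow_pd)
  then show ?case using ge2 by (simp add: algebra_simps)
qed (auto simp: F_unit)

lemma F_jinv: "x \<in> pd \<Longrightarrow> F (jinv x) = - F x"
proof -
  assume x: "x \<in> pd"
  then have "F x + F (jinv x) = 0"
    using F_P[of x "jinv x \<odot> jinv x"] F_square[of "jinv x"] pd_square[of "jinv x"]
      P_jinv(1)[of x e] F_unit by simp
  then show ?thesis by simp
qed

text \<open>If x is at distance \<rho> from e, the first n of its powers, n of order 1 / \<rho>,
  stay where F is below 1 in absolute value; as F (\<open>pow x n\<close>) = n F x, F x is of order
  \<rho>.\<close>

lemma F_bound_near_unit:
  obtains r C where "r > 0" "C > 0" "\<And>x. norm (x - e) < r \<Longrightarrow> x \<in> pd \<and> \<bar>F x\<bar> \<le> C * norm (x - e)"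
proof -
  obtain K where K: "K > 0" "\<And>x y. norm (x \<odot> y) \<le> K * norm x * norm y" using mult_bound by blast
  have "isCont F e" using F_cont open_pd by (simp add: continuous_on_eq_continuous_at)
  then obtain r1 where r1: "r1 > 0" "\<And>x. norm (x - e) < r1 \<Longrightarrow> \<bar>F x\<bar> < 1"
    using F_unit unfolding continuous_at_eps_delta dist_norm by (metis diff_zero real_norm_def zero_less_one)
  obtain r2 where r2: "r2 > 0" "ball e r2 \<subseteq> pd" using open_pd unit_pd open_contains_ball by blast
  define M where "M = norm e + r1"
  have M: "M > 0" using r1 by (simp add: M_def add_nonneg_pos)
  \<comment> \<open>Each further power moves by at most K \<rho> M, so up to \<theta> / \<rho>
    powers remain within r1 / 2 of e.\<close>
  define \<theta> where "\<theta> = r1 / (2 * K * M)"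
  have \<theta>: "\<theta> > 0" using r1 K M by (simp add: \<theta>_def)
  show thesis
  proof (rule that[of "min \<theta> r2" "2 / \<theta>"])
    fix x assume x: "norm (x - e) < min \<theta> r2"
    have pd: "x \<in> pd" using x r2 by (auto simp: dist_norm norm_minus_commute)
    define \<rho> where "\<rho> = norm (x - e)"
    have "\<bar>F x\<bar> \<le> 2 / \<theta> * \<rho>"
    proof (cases "\<rho> = 0")
      case True then show ?thesis using F_unit by (simp add: \<rho>_def)
    next
      case False
      then have \<rho>: "\<rho> > 0" by (simp add: \<rho>_def)
      define n where "n = nat \<lfloor>\<theta> / \<rho>\<rfloor>"
      have q1: "\<theta> / \<rho> \<ge> 1" using x \<rho> by (simp add: \<rho>_def[symmetric])
      have n: "real n \<le> \<theta> / \<rho>" "\<theta> / \<rho> < real n + 1" "n \<ge> 1"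
        using q1 unfolding n_def by linarith+
      have "norm (pow x j - e) \<le> real j * (K * \<rho> * M)" if "j \<le> n" for j using that
      proof (induction j)
        case (Suc j)
        have le: "real j * (K * \<rho> * M) < r1"
        proof -
          have "real j * (K * \<rho> * M) \<le> \<theta> / \<rho> * (K * \<rho> * M)"
            using Suc.prems n K M \<rho> by (intro mult_right_mono) auto
          also have "\<dots> = r1 / 2" using K M \<rho> by (simp add: \<theta>_def field_simps)
          finally show ?thesis using r1 by simp
        qed
        have IH: "norm (pow x j - e) \<le> real j * (K * \<rho> * M)" using Suc by simp
        have "norm (pow x j) \<le> M"
          using norm_triangle_ineq2[of "pow x j" e] IH le by (simp add: M_def)
        then have "norm ((x - e) \<odot> pow x j) \<le> K * \<rho> * M"
          unfolding \<rho>_def using K by (intro order_trans[OF K(2)] mult_left_mono) auto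
        moreover have eq: "pow x (Suc j) - e = (x - e) \<odot> pow x j + (pow x j - e)" by (simp add: bilin)
        have "norm (pow x (Suc j) - e) \<le> norm ((x - e) \<odot> pow x j) + norm (pow x j - e)"
          unfolding eq by (rule norm_triangle_ineq)
        ultimately show ?case using IH by (simp add: algebra_simps)
      qed simp
      then have "norm (pow x n - e) \<le> real n * (K * \<rho> * M)" by simp
      also have "\<dots> \<le> \<theta> / \<rho> * (K * \<rho> * M)"
        using n K M \<rho> by (intro mult_right_mono) auto
      also have "\<dots> = r1 / 2" using K M \<rho> by (simp add: \<theta>_def field_simps)
      finally have "\<bar>F (pow x n)\<bar> < 1" using r1 by (intro r1(2)) linarith
      then have "real n * \<bar>F x\<bar> < 1" using F_pow[OF pd, of n] by (simp add: abs_mult)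
      then have "\<bar>F x\<bar> \<le> 1 / real n" using n by (simp add: field_simps)
      also have "\<dots> \<le> 2 / (\<theta> / \<rho>)"
      proof -
        define a where "a = \<theta> / \<rho>"
        have "1 \<le> real n" using n(3) by simp
        then have "a > 0" "a \<le> 2 * real n" using n q1 unfolding a_def by linarith+
        then show ?thesis using n(3) unfolding a_def[symmetric] by (simp add: divide_simps)
      qed
      finally show ?thesis by simp
    qed
    then show "x \<in> pd \<and> \<bar>F x\<bar> \<le> 2 / \<theta> * norm (x - e)" using pd by (simp add: \<rho>_def)
  qed (use \<theta> r2 in auto)
qed

text \<open>With s \<odot> s = y, the map P (\<open>jinv s\<close>) carries y to e and lowers F by F
  y. The bound at e, applied to the image z of x, thus controls F x - F y.\<close>

lemma F_lipschitz_near_unit: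
  obtains r C where "r > 0" "C > 0"
    "\<And>x y. \<lbrakk>norm (x - e) < r; norm (y - e) < r\<rbrakk> \<Longrightarrow> \<bar>F x - F y\<bar> \<le> C * norm (x - y)"
proof -
  obtain K where K: "K > 0" "\<And>x y. norm (x \<odot> y) \<le> K * norm x * norm y" using mult_bound by blast
  obtain r C where r: "r > 0" "C > 0" "\<And>x. norm (x - e) < r \<Longrightarrow> x \<in> pd \<and> \<bar>F x\<bar> \<le> C * norm (x - e)"
    using F_bound_near_unit by blast
  obtain d where d: "d > 0" "\<And>x. norm (x - e) < d \<Longrightarrow> norm (jinv x - e) < 1"
    using isCont_jinv[OF unit_pd] unfolding continuous_at_eps_delta dist_norm
    by (metis jinv_unit zero_less_one)
  define D where "D = 3 * K\<^sup>2 * ((norm e + 1) * norm e)"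
  have D: "D > 0" unfolding D_def using K by (intro mult_pos_pos) (auto simp: add_nonneg_pos)
  define R where "R = min (min r d) (r / (2 * D))"
  show thesis
  proof (rule that[of R "C * D"])
    fix x y assume xy: "norm (x - e) < R" "norm (y - e) < R"
    have pd: "x \<in> pd" "y \<in> pd" using r(3) xy by (auto simp: R_def)
    obtain s where s: "s \<in> pd" "s \<odot> s = y" using pd_sqrt[OF pd(2)] by metis
    let ?u = "jinv s"
    define z where "z = P ?u x"
    have "?u \<odot> ?u = jinv y"
    proof (rule jinv_unique[OF pd(2), symmetric])
      have "y \<odot> (?u \<odot> ?u) = ?u \<odot> ((s \<odot> s) \<odot> ?u)"
        unfolding s(2)[symmetric]
        using gen_commute[of "s \<odot> s" s ?u ?u] jinv_gen[OF s(1)] by simp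
      also have "(s \<odot> s) \<odot> ?u = s"
        using gen_assoc[of s s s ?u] jinv_gen[OF s(1)] mult_jinv[OF s(1)] by simp
      finally show "y \<odot> (?u \<odot> ?u) = e" using mult_jinv[OF s(1)] comm by simp
    qed
    \<comment> \<open>Continuity of the inverse at e bounds the right side, and with it P
      (\<open>jinv s\<close>), uniformly for y near e.\<close>
    then have "(norm ?u)\<^sup>2 = jinv y \<bullet> e"
      using inner_assoc[of ?u ?u e] by (simp add: power2_norm_eq_inner)
    also have "\<dots> \<le> norm (jinv y) * norm e" by (rule norm_cauchy_schwarz)
    also have "\<dots> \<le> (norm e + 1) * norm e"
    proof (rule mult_right_mono)
      have "norm (jinv y - e) < 1" using d xy by (auto simp: R_def)
      then show "norm (jinv y) \<le> norm e + 1" using norm_triangle_ineq2[of "jinv y" e] by linarith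
    qed simp
    finally have u: "(norm ?u)\<^sup>2 \<le> (norm e + 1) * norm e" .
    have "P ?u y = e" using P_jinv(2)[OF s(1), of e] s(2) by simp
    then have "z - e = P ?u (x - y)" by (simp add: z_def P_linear)
    also have "norm \<dots> \<le> 3 * K\<^sup>2 * (norm ?u)\<^sup>2 * norm (x - y)" by (rule P_bound[OF K])
    also have "\<dots> \<le> D * norm (x - y)"
      unfolding D_def using u by (intro mult_right_mono mult_left_mono) auto
    finally have z: "norm (z - e) \<le> D * norm (x - y)" .
    also have "\<dots> < D * (R + R)"
      using norm_triangle_ineq4[of "x - e" "y - e"] xy D by (intro mult_strict_left_mono) auto
    also have "\<dots> \<le> D * (r / (2 * D) + r / (2 * D))"
      using D by (intro mult_left_mono add_mono) (auto simp: R_def)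
    also have "\<dots> = r" using D by (simp add: field_simps)
    finally have Fz: "\<bar>F z\<bar> \<le> C * norm (z - e)" using r(3) by blast
    have "F z = F x - F y" unfolding z_def
      using F_P[of ?u x] F_jinv[OF s(1)] F_square[OF s(1)] s pd by simp
    then have "\<bar>F x - F y\<bar> \<le> C * norm (z - e)" using Fz by simp
    also have "\<dots> \<le> C * (D * norm (x - y))" using z r by (intro mult_left_mono) auto
    finally show "\<bar>F x - F y\<bar> \<le> C * D * norm (x - y)" by (simp add: mult.assoc)
  qed (use r d D in \<open>auto simp: R_def\<close>)
qed

text \<open>The future gradient of F at e, read off on exponential curves before differentiability
  is known.\<close>

definition G :: "'a \<Rightarrow> real" where "G h = F (exp_line h 1)"

lemma F_exp_line: "F (exp_line h t) = t * G h"
proof -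
  define g where "g t = F (exp_line h t)" for t
  have g: "g (2 * s + t) = 2 * g s + g t" for s t
    using F_P[of "exp_line h s" "exp_line h t"] by (simp add: g_def exp_line_pd P_exp_line)
  have g0: "g 0 = 0" using g[of 0 0] by simp
  have dbl: "g (2 * s) = 2 * g s" for s using g[of s 0] g0 by simp
  have add: "g (s + t) = g s + g t" for s t
    using g[of "s / 2" t] dbl[of "s / 2"] by simp
  have cont: "continuous_on {0<..} g"
    unfolding g_def using exp_line_pd
    by (intro continuous_on_compose2[OF F_cont continuous_on_subset[OF continuous_on_exp_line]]) auto
  have pos: "g t = t * g 1" if "t > 0" for t
    by (rule additive_continuous_homogeneous[OF _ cont that]) (rule add)
  have "g t = t * g 1"
  proof -
    consider "t > 0" | "t = 0" | "t < 0" by linarith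
    then show ?thesis
    proof cases
      case 1 then show ?thesis by (rule pos)
    next
      case 3 then show ?thesis using pos[of "- t"] add[of t "- t"] g0 by simp
    qed (simp add: g0)
  qed
  then show ?thesis unfolding g_def G_def .
qed

text \<open>A curve with tangent h differs from the exponential curve by o(t), hence by the
  Lipschitz bound so do the values of F; on the exponential curve F is exactly t G h.\<close>

lemma F_along_curve:
  assumes "((\<lambda>t. (\<gamma> t - e) /\<^sub>R t) \<longlongrightarrow> h) (at 0)"
  shows "((\<lambda>t. F (\<gamma> t) / t) \<longlongrightarrow> G h) (at 0)"
proof -
  let ?E = "exp_line h"
  obtain r C where r: "r > 0" "C > 0"
    "\<And>x y. \<lbrakk>norm (x - e) < r; norm (y - e) < r\<rbrakk> \<Longrightarrow> \<bar>F x - F y\<bar> \<le> C * norm (x - y)"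
    using F_lipschitz_near_unit by blast
  have near: "\<forall>\<^sub>F t in at 0. norm (\<delta> t - e) < r" if \<delta>: "((\<lambda>t. (\<delta> t - e) /\<^sub>R t) \<longlongrightarrow> h) (at 0)" for \<delta>
  proof -
    have "((\<lambda>t. norm (t *\<^sub>R ((\<delta> t - e) /\<^sub>R t))) \<longlongrightarrow> norm (0 *\<^sub>R h)) (at 0)"
      by (intro tendsto_intros \<delta>)
    then have "\<forall>\<^sub>F t in at 0. norm (t *\<^sub>R ((\<delta> t - e) /\<^sub>R t)) < r"
      using r(1) by (auto dest: order_tendstoD(2))
    moreover have "\<forall>\<^sub>F t in at (0::real). t \<noteq> 0" by (simp add: eventually_at_filter)
    ultimately show ?thesis by eventually_elim simp
  qed
  have "\<forall>\<^sub>F t in at (0::real). t \<noteq> 0" by (simp add: eventually_at_filter)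
  then have "\<forall>\<^sub>F t in at 0. norm (F (\<gamma> t) / t - G h) \<le> C * norm ((\<gamma> t - e) /\<^sub>R t - (?E t - e) /\<^sub>R t)"
    using near[OF assms] near[OF exp_line_derivative]
  proof eventually_elim
    case (elim t)
    have "\<bar>F (\<gamma> t) - F (?E t)\<bar> \<le> C * norm (\<gamma> t - ?E t)" using r(3) elim by blast
    then have "\<bar>F (\<gamma> t) - F (?E t)\<bar> / \<bar>t\<bar> \<le> C * norm (\<gamma> t - ?E t) / \<bar>t\<bar>" by (intro divide_right_mono) auto
    moreover have "(\<gamma> t - e) /\<^sub>R t - (?E t - e) /\<^sub>R t = (\<gamma> t - ?E t) /\<^sub>R t"
      by (simp flip: scaleR_diff_right)
    then have "C * norm ((\<gamma> t - e) /\<^sub>R t - (?E t - e) /\<^sub>R t) = C * norm (\<gamma> t - ?E t) / \<bar>t\<bar>"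
      by (simp add: divide_inverse mult.commute)
    moreover have "norm (F (\<gamma> t) / t - G h) = \<bar>F (\<gamma> t) - F (?E t)\<bar> / \<bar>t\<bar>"
    proof -
      have "F (\<gamma> t) / t - G h = (F (\<gamma> t) - F (?E t)) / t"
        using elim(1) F_exp_line[of h t] by (simp add: diff_divide_distrib)
      then show ?thesis by simp
    qed
    ultimately show ?case by simp
  qed
  moreover have "((\<lambda>t. C * norm ((\<gamma> t - e) /\<^sub>R t - (?E t - e) /\<^sub>R t)) \<longlongrightarrow> C * norm (h - h)) (at 0)"
    by (intro tendsto_intros assms exp_line_derivative)
  then have "((\<lambda>t. C * norm ((\<gamma> t - e) /\<^sub>R t - (?E t - e) /\<^sub>R t)) \<longlongrightarrow> 0) (at 0)" by simp
  ultimately have "((\<lambda>t. F (\<gamma> t) / t - G h) \<longlongrightarrow> 0) (at 0)" by (rule Lim_null_comparison)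
  then show ?thesis using LIM_zero_iff by blast
qed

lemma quadratic_curve:
  assumes "\<And>t. \<gamma> t = e + t *\<^sub>R h + t\<^sup>2 *\<^sub>R (u + t *\<^sub>R v)"
  shows "((\<lambda>t. (\<gamma> t - e) /\<^sub>R t) \<longlongrightarrow> h) (at (0::real))"
proof -
  have "((\<lambda>t. h + t *\<^sub>R (u + t *\<^sub>R v)) \<longlongrightarrow> h + 0 *\<^sub>R (u + 0 *\<^sub>R v)) (at 0)"
    by (intro tendsto_intros)
  moreover have "\<forall>\<^sub>F t in at (0::real). h + t *\<^sub>R (u + t *\<^sub>R v) = (\<gamma> t - e) /\<^sub>R t"
    unfolding eventually_at_filter
    by (intro always_eventually) (auto simp: assms algebra_simps power2_eq_square)
  ultimately show ?thesis by (simp add: tendsto_cong)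
qed

lemma eventually_pd: "\<forall>\<^sub>F t in at (0::real). e + t *\<^sub>R h \<in> pd"
proof -
  have "((\<lambda>t::real. e + t *\<^sub>R h) \<longlongrightarrow> e + 0 *\<^sub>R h) (at 0)" by (intro tendsto_intros)
  then have "((\<lambda>t::real. e + t *\<^sub>R h) \<longlongrightarrow> e) (at 0)" by simp
  then show ?thesis by (rule topological_tendstoD[OF _ open_pd unit_pd])
qed

lemma F_line: "((\<lambda>t. F (e + t *\<^sub>R h) / t) \<longlongrightarrow> G h) (at 0)"
  by (rule F_along_curve[OF quadratic_curve[of "\<lambda>t. e + t *\<^sub>R h" h 0 0]]) simp

text \<open>The curve P (e + t h) (e + t k) has tangent 2 h + k, while F splits along it; this gives
  G (2 h + k) = 2 G h + G k.\<close>

lemma linear_G: "linear G"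
proof -
  have lin: "G (2 *\<^sub>R h + k) = 2 * G h + G k" for h k
  proof -
    let ?\<gamma> = "\<lambda>t. P (e + t *\<^sub>R h) (e + t *\<^sub>R k)"
    have "?\<gamma> t = e + t *\<^sub>R (2 *\<^sub>R h + k) + t\<^sup>2 *\<^sub>R ((2 *\<^sub>R (h \<odot> k) + P h e) + t *\<^sub>R P h k)" for t
      unfolding P_unit_add P_scale
      by (simp add: P_linear bilin algebra_simps power2_eq_square)
    then have "((\<lambda>t. F (?\<gamma> t) / t) \<longlongrightarrow> G (2 *\<^sub>R h + k)) (at 0)"
      by (intro F_along_curve quadratic_curve)
    moreover have "\<forall>\<^sub>F t in at 0. F (?\<gamma> t) / t = 2 * (F (e + t *\<^sub>R h) / t) + F (e + t *\<^sub>R k) / t"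
      using eventually_pd[of h] eventually_pd[of k]
      by eventually_elim (simp add: F_P add_divide_distrib)
    ultimately have "((\<lambda>t. 2 * (F (e + t *\<^sub>R h) / t) + F (e + t *\<^sub>R k) / t) \<longlongrightarrow> G (2 *\<^sub>R h + k)) (at 0)"
      by (simp add: tendsto_cong)
    moreover have "((\<lambda>t. 2 * (F (e + t *\<^sub>R h) / t) + F (e + t *\<^sub>R k) / t) \<longlongrightarrow> 2 * G h + G k) (at 0)"
      by (intro tendsto_intros F_line)
    ultimately show ?thesis by (rule tendsto_unique[OF trivial_limit_at])
  qed
  have G0: "G 0 = 0" using lin[of 0 0] by simp
  have dbl: "G (2 *\<^sub>R h) = 2 * G h" for h using lin[of h 0] G0 by simp
  show ?thesis
  proof (rule linearI)
    show "G (h + k) = G h + G k" for h k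
      using lin[of "h /\<^sub>R 2" k] dbl[of "h /\<^sub>R 2"] by simp
    show "G (s *\<^sub>R h) = s *\<^sub>R G h" for s h
      using F_exp_line[of h s] by (simp add: G_def exp_line_scale)
  qed
qed

lemma F_eq_G_ln:
  assumes "x \<in> pd"
  shows "F x = G (fcalc ln x)"
proof -
  obtain S lam where S: "idem_system S (\<lambda>c. c)" "x = (\<Sum>c\<in>S. lam c *\<^sub>R c)"
    "\<And>c. c \<in> S \<Longrightarrow> 0 < lam c" using pd_spectral[OF assms] by metis
  have "fcalc exp (fcalc ln x) = (\<Sum>c\<in>S. exp (ln (lam c)) *\<^sub>R c)"
    using fcalc_eq[OF S(1), of ln lam] fcalc_eq[OF S(1), of exp "\<lambda>c. ln (lam c)"] S(2) by simp
  also have "\<dots> = x" unfolding S(2) using S(3) by (intro sum.cong) auto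
  finally show ?thesis by (simp add: G_def exp_line_def)
qed

lemma gradient_central:
  assumes G: "\<And>h. G h = m \<bullet> h"
  shows "m \<odot> (x \<odot> y) = x \<odot> (m \<odot> y)"
proof -
  text \<open>Compare the derivatives at \<open>t = 0\<close> of the two expressions
    \<open>F (P (e + t h) (x\<^sup>2)) = 2 F (e + t h) + F (x\<^sup>2)\<close>.\<close>
  have pd: "(x \<odot> x) \<odot> m = x \<odot> (x \<odot> m)" if x: "x \<in> pd" for x
  proof -
    let ?u = "jinv x" and ?q = "x \<odot> x"
    have deriv: "m \<bullet> (2 *\<^sub>R P ?u (h \<odot> ?q)) = 2 * (m \<bullet> h)" for h
    proof -
      \<comment> \<open>The outer P ?u makes the curve pass through e at t = 0; the contributions of
        ?u and ?q to F cancel.\<close>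
      let ?\<gamma> = "\<lambda>t. P ?u (P (e + t *\<^sub>R h) ?q)"
      have "P ?u ?q = e" using P_jinv(2)[OF x, of e] by simp
      then have "?\<gamma> t = e + t *\<^sub>R (2 *\<^sub>R P ?u (h \<odot> ?q)) + t\<^sup>2 *\<^sub>R (P ?u (P h ?q) + t *\<^sub>R 0)" for t
        unfolding P_unit_add P_scale by (simp add: P_linear bilin)
      then have "((\<lambda>t. F (?\<gamma> t) / t) \<longlongrightarrow> G (2 *\<^sub>R P ?u (h \<odot> ?q))) (at 0)"
        by (intro F_along_curve quadratic_curve)
      moreover have "\<forall>\<^sub>F t in at 0. F (?\<gamma> t) / t = 2 * (F (e + t *\<^sub>R h) / t)"
        using eventually_pd[of h]
        by eventually_elim (simp add: F_P P_pd x pd_square F_square F_jinv)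
      ultimately have "((\<lambda>t. 2 * (F (e + t *\<^sub>R h) / t)) \<longlongrightarrow> G (2 *\<^sub>R P ?u (h \<odot> ?q))) (at 0)"
        by (simp add: tendsto_cong)
      moreover have "((\<lambda>t. 2 * (F (e + t *\<^sub>R h) / t)) \<longlongrightarrow> 2 * G h) (at 0)"
        by (intro tendsto_intros F_line)
      ultimately have "G (2 *\<^sub>R P ?u (h \<odot> ?q)) = 2 * G h" by (rule tendsto_unique[OF trivial_limit_at])
      then show ?thesis by (simp add: G)
    qed
    \<comment> \<open>All operators involved are self-adjoint, so the identity in h becomes an
      equation for m, equivalent to ?q \<odot> m = P x m.\<close>
    have "h \<bullet> (?q \<odot> P ?u m) = h \<bullet> m" for h
    proof -
      have "h \<bullet> (?q \<odot> P ?u m) = P ?u (h \<odot> ?q) \<bullet> m"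
        unfolding L_sym[symmetric] P_sym[symmetric] by (simp only: comm)
      also have "\<dots> = h \<bullet> m" using deriv[of h] by (simp add: inner_commute)
      finally show ?thesis .
    qed
    then have "?q \<odot> P ?u m = m" using vector_eq_ldot[of "?q \<odot> P ?u m" m] by blast
    moreover have "?q \<odot> P ?u m = P ?u (?q \<odot> m)"
      unfolding P_def using gen_commute[of ?q x ?u] gen_commute[of ?q x "?u \<odot> ?u"] jinv_gen[OF x]
      by (simp add: bilin)
    ultimately have "P ?u (?q \<odot> m) = m" by simp
    then have "?q \<odot> m = P x m" using P_jinv(1)[OF x, of "?q \<odot> m"] by simp
    then have "?q \<odot> m + ?q \<odot> m = 2 *\<^sub>R (x \<odot> (x \<odot> m))" unfolding P_def eq_diff_eq .
    then have "2 *\<^sub>R (?q \<odot> m) = 2 *\<^sub>R (x \<odot> (x \<odot> m))" by (simp only: scaleR_2)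
    then show ?thesis by simp
  qed
  \<comment> \<open>In the identity for e + t x with small t \<noteq> 0 the terms of order 0 and 1
    in t agree, leaving t^2 times the claim.\<close>
  have all: "(x \<odot> x) \<odot> m = x \<odot> (x \<odot> m)" for x
  proof -
    have "\<forall>\<^sub>F t in at (0::real). t \<noteq> 0" by (simp add: eventually_at_filter)
    then have "\<forall>\<^sub>F t in at (0::real). t \<noteq> 0 \<and> e + t *\<^sub>R x \<in> pd"
      using eventually_pd[of x] by (rule eventually_conj)
    then obtain t where t: "t \<noteq> 0" "e + t *\<^sub>R x \<in> pd"
      using eventually_happens'[OF trivial_limit_at] by blast
    then show ?thesis using pd[OF t(2)] by (simp add: bilin)
  qed
  have pol: "2 *\<^sub>R (m \<odot> (x \<odot> y)) = x \<odot> (m \<odot> y) + (x \<odot> m) \<odot> y" for x y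
    using all[of "x + y"] all[of x] all[of y] comm[of y x] comm[of x m] comm[of y m] comm[of y "x \<odot> m"] comm[of "x \<odot> y" m]
    by (simp add: bilin scaleR_2 algebra_simps)
  \<comment> \<open>The adjoint of \<open>pol\<close>; subtracting the two identities leaves three
    times the commutator of the multiplications by m and x.\<close>
  have adj: "2 *\<^sub>R (x \<odot> (m \<odot> y)) = m \<odot> (x \<odot> y) + (x \<odot> m) \<odot> y" for x y
  proof -
    have "z \<bullet> (2 *\<^sub>R (x \<odot> (m \<odot> y))) = z \<bullet> (m \<odot> (x \<odot> y) + (x \<odot> m) \<odot> y)" for z
    proof -
      have "(2 *\<^sub>R (m \<odot> (x \<odot> z))) \<bullet> y = (x \<odot> (m \<odot> z) + (x \<odot> m) \<odot> z) \<bullet> y" using pol by simp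
      then show ?thesis by (simp add: inner_add_left inner_add_right L_sym)
    qed
    then show ?thesis using vector_eq_ldot by blast
  qed
  have "3 *\<^sub>R (m \<odot> (x \<odot> y)) = 3 *\<^sub>R (x \<odot> (m \<odot> y))"
    using pol[of x y] adj[of x y] scaleR_left_distrib[of 2 1 "m \<odot> (x \<odot> y)"] scaleR_left_distrib[of 2 1 "x \<odot> (m \<odot> y)"]
    by (simp add: algebra_simps)
  then show ?thesis by simp
qed

end

section \<open>Trace, determinant and simplicity\<close>

context eja begin

lemma complete_primitive_system_idem:
  assumes "complete_primitive_system (\<odot>) e r c"
  shows "idem_system {..<r} c"
  using assms unfolding complete_primitive_system_def idem_system_def by auto

lemma spectral_decomposition_exists: "\<exists>r lam c. spectral_decomposition (\<odot>) e x r lam c"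
proof -
  obtain S lam where S: "idem_system S (\<lambda>c. c)" "\<And>c. c \<in> S \<Longrightarrow> primitive_idempotent (\<odot>) c"
    "x = (\<Sum>c\<in>S. lam c *\<^sub>R c)" using primitive_spectral[of x] by blast
  obtain b where b: "bij_betw b {..<card S} S"
    using ex_bij_betw_nat_finite[OF idem_systemD(1)[OF S(1)]] by (auto simp: atLeast0LessThan)
  have bS: "b i \<in> S" if "i < card S" for i using b that by (auto simp: bij_betw_def)
  have inj: "b i = b j \<longleftrightarrow> i = j" if "i < card S" "j < card S" for i j
    using b that by (auto simp: bij_betw_def inj_on_def)
  have "complete_primitive_system (\<odot>) e (card S) b"
    unfolding complete_primitive_system_def
  proof (intro conjI allI impI)
    fix i j assume ij: "i < card S" "j < card S"
    then show "b i \<odot> b j = (if i = j then b i else 0)"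
      using idem_systemD(2,3)[OF S(1)] bS inj[OF ij] by (cases "i = j") auto
  next
    have "(\<Sum>i<card S. b i) = (\<Sum>c\<in>S. c)" using sum.reindex_bij_betw[OF b, of "\<lambda>c. c"] .
    then show "(\<Sum>i<card S. b i) = e" using idem_systemD(4)[OF S(1)] by simp
  qed (use S(2) bS in auto)
  moreover have "x = (\<Sum>i<card S. lam (b i) *\<^sub>R b i)"
    unfolding S(3) using sum.reindex_bij_betw[OF b, of "\<lambda>c. lam c *\<^sub>R c"] by simp
  ultimately show ?thesis unfolding spectral_decomposition_def
    by (intro exI[of _ "card S"] exI[of _ "\<lambda>i. lam (b i)"] exI[of _ b]) auto
qed

lemma jordan_inverse_eq: "jordan_inverse (\<odot>) e x = jinv x"
proof -
  have "(\<Sum>i<r. inverse (lam i) *\<^sub>R c i) = jinv x" if "spectral_decomposition (\<odot>) e x r lam c" for r lam c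
    using that fcalc_eq[OF complete_primitive_system_idem, of r c inverse lam]
    unfolding spectral_decomposition_def jinv_def by simp
  moreover obtain r lam c where "spectral_decomposition (\<odot>) e x r lam c"
    using spectral_decomposition_exists by blast
  ultimately show ?thesis unfolding jordan_inverse_def by (intro the_equality) metis+
qed

text \<open>Idempotency forces eigenvalues 0 or 1, and two eigenvalues 1 would split d. Hence
  \<open>jordan_tr\<close> of a primitive idempotent is 1, whichever decomposition is used.\<close>

lemma primitive_eigenvalue_sum:
  assumes "primitive_idempotent (\<odot>) d" "spectral_decomposition (\<odot>) e d r lam c"
  shows "(\<Sum>i<r. lam i) = 1"
proof -
  have sys: "complete_primitive_system (\<odot>) e r c" and d: "d = (\<Sum>i<r. lam i *\<^sub>R c i)"
    using assms(2) by (auto simp: spectral_decomposition_def)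
  note I = complete_primitive_system_idem[OF sys]
  have c0: "c i \<noteq> 0" if "i < r" for i
    using sys that by (auto simp: complete_primitive_system_def primitive_idempotent_def)
  have dd: "d \<odot> d = d" "d \<noteq> 0" using assms(1) by (auto simp: primitive_idempotent_def)
  have lam: "lam i = 0 \<or> lam i = 1" if i: "i < r" for i
  proof -
    have "(d \<odot> d) \<odot> c i = (lam i * lam i) *\<^sub>R c i"
      using system_mult_idem[OF I, of i "\<lambda>i. lam i * lam i"] system_mult[OF I, of lam lam] i d by simp
    moreover have "d \<odot> c i = lam i *\<^sub>R c i" using system_mult_idem[OF I, of i lam] i d by simp
    ultimately have "(lam i * lam i) *\<^sub>R c i = lam i *\<^sub>R c i" using dd by simp
    then show ?thesis using c0[OF i] by simp
  qed
  define J where "J = {i. i < r \<and> lam i = 1}"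
  have J: "finite J" "J \<subseteq> {..<r}" by (auto simp: J_def)
  have dJ: "d = (\<Sum>i\<in>J. c i)"
    unfolding d using lam by (intro sum.mono_neutral_cong_right) (auto simp: J_def)
  have proj: "(\<Sum>i\<in>K. c i) \<odot> (\<Sum>i\<in>K. c i) = (\<Sum>i\<in>K. c i)" if "K \<subseteq> {..<r}" for K
  proof -
    have fin: "finite K" using that finite_subset by blast
    have "c i \<odot> (\<Sum>j\<in>K. c j) = c i" if "i \<in> K" for i
    proof -
      have "c i \<odot> (\<Sum>j\<in>K. c j) = (\<Sum>j\<in>K. if i = j then c i else 0)"
        unfolding prod.sum_right
        using idem_systemD(2,3)[OF I] \<open>K \<subseteq> {..<r}\<close> that by (intro sum.cong) auto
      then show ?thesis using fin that by simp
    qed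
    then show ?thesis by (simp add: prod.sum_left)
  qed
  have "J \<noteq> {}" using dJ dd by auto
  then obtain i where i: "i \<in> J" by blast
  have "J = {i}"
  proof (rule ccontr)
    assume "J \<noteq> {i}"
    then obtain j where j: "j \<in> J" "j \<noteq> i" using i by blast
    let ?v = "\<Sum>k\<in>J - {i}. c k"
    have v: "?v \<odot> ?v = ?v" using J by (intro proj) auto
    have "c j \<odot> ?v = c j"
    proof -
      have "c j \<odot> ?v = (\<Sum>k\<in>J - {i}. if j = k then c j else 0)"
        unfolding prod.sum_right using idem_systemD(2,3)[OF I] J j by (intro sum.cong) auto
      then show ?thesis using J j by simp
    qed
    then have "?v \<noteq> 0" using c0[of j] j J by (auto simp: bilin)
    moreover have "d = c i + ?v" unfolding dJ using sum.remove[OF J(1) i] .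
    moreover have "c i \<odot> c i = c i" "c i \<noteq> 0" using idem_systemD(2)[OF I] c0 i J by auto
    ultimately show False using assms(1) v unfolding primitive_idempotent_def by blast
  qed
  have "(\<Sum>i<r. lam i) = (\<Sum>i\<in>J. 1)"
    using lam by (intro sum.mono_neutral_cong_right) (auto simp: J_def)
  then show ?thesis using \<open>J = {i}\<close> by simp
qed

text \<open>The trace form gives e \<bullet> c = 1 for primitive c, so e \<bullet> ln x is the sum
  of the logarithms of the eigenvalues. The right side does not mention a decomposition, so the
  description of the determinant is unique.\<close>

lemma jordan_det_eq:
  assumes canonical: "\<And>x y. x \<bullet> y = jordan_tr (\<odot>) e (x \<odot> y)" and x: "x \<in> pd"
  shows "jordan_det (\<odot>) e x = exp (e \<bullet> fcalc ln x)"
proof -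
  have trace: "e \<bullet> c = 1" if "primitive_idempotent (\<odot>) c" for c
  proof -
    have "jordan_tr (\<odot>) e c = 1"
    proof -
      obtain r lam d where "spectral_decomposition (\<odot>) e c r lam d"
        using spectral_decomposition_exists by blast
      then show ?thesis
        unfolding jordan_tr_def using primitive_eigenvalue_sum[OF that] by (intro the_equality) metis+
    qed
    then show ?thesis using canonical[of e c] by simp
  qed
  have "(\<Prod>i<r. lam i) = exp (e \<bullet> fcalc ln x)" if sd: "spectral_decomposition (\<odot>) e x r lam c" for r lam c
  proof -
    have sys: "complete_primitive_system (\<odot>) e r c" and xe: "x = (\<Sum>i<r. lam i *\<^sub>R c i)"
      using sd by (auto simp: spectral_decomposition_def)
    note I = complete_primitive_system_idem[OF sys]
    have prim: "primitive_idempotent (\<odot>) (c i)" if "i < r" for i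
      using sys that by (simp add: complete_primitive_system_def)
    have pos: "0 < lam i" if "i < r" for i
      by (rule pd_coeff_pos[OF _ I]) (use x xe that prim in \<open>auto simp: primitive_idempotent_def\<close>)
    have "fcalc ln x = (\<Sum>i<r. ln (lam i) *\<^sub>R c i)" unfolding xe by (rule fcalc_eq[OF I])
    then have "e \<bullet> fcalc ln x = (\<Sum>i<r. ln (lam i))"
      by (simp add: inner_sum_right trace prim)
    then have "exp (e \<bullet> fcalc ln x) = (\<Prod>i<r. exp (ln (lam i)))" by (simp add: exp_sum)
    also have "\<dots> = (\<Prod>i<r. lam i)" using pos by (intro prod.cong) auto
    finally show ?thesis by simp
  qed
  moreover obtain r lam c where "spectral_decomposition (\<odot>) e x r lam c"
    using spectral_decomposition_exists by blast
  ultimately show ?thesis unfolding jordan_det_def by (intro the_equality) metis+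
qed

section \<open>Ideals and central elements of a simple algebra\<close>

lemma ideal_is_factor:
  assumes "subspace U" "\<And>x v. v \<in> U \<Longrightarrow> x \<odot> v \<in> U" "u \<in> U" "\<And>x. x \<in> U \<Longrightarrow> x \<odot> u = x"
  shows "euclidean_jordan_algebra_on U (\<odot>) u"
proof
  show "x \<odot> y = y \<odot> x" for x y by (rule comm)
qed (use assms in \<open>simp_all add: bilin jordan inner_assoc\<close>)

text \<open>The eigenspaces of \<open>L m\<close> are ideals when \<open>m\<close> is central.\<close>

lemma central_scalar:
  assumes simple: "\<not> cartesian_product_decomposable (\<odot>)"
    and central: "\<And>x y. m \<odot> (x \<odot> y) = x \<odot> (m \<odot> y)"
  obtains q where "m = q *\<^sub>R e"
proof -
  obtain v0 q where v0: "v0 \<noteq> 0" "m \<odot> v0 = q *\<^sub>R v0"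
    using symmetric_eigenvector[OF linear_L[of m], of UNIV] L_sym unit_nonzero by (metis UNIV_I singletonD subspace_UNIV top_greatest)
  define V where "V = {v. m \<odot> v = q *\<^sub>R v}"
  \<comment> \<open>The orthogonal complement of the eigenspace is again an ideal, as
    multiplications are self-adjoint; products of V and W lie in both and so vanish.\<close>
  define W where "W = {w. \<forall>v\<in>V. v \<bullet> w = 0}"
  have sV: "subspace V" by (auto simp: V_def subspace_def bilin algebra_simps)
  have sW: "subspace W" by (auto simp: W_def subspace_def inner_add_right)
  have idV: "x \<odot> v \<in> V" if "v \<in> V" for x v
    using that central[of x v] by (simp add: V_def bilin)
  have idW: "x \<odot> w \<in> W" if "w \<in> W" for x w
    unfolding W_def
  proof safe
    fix v assume "v \<in> V"
    then have "(x \<odot> v) \<bullet> w = 0" using that idV W_def by blast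
    then show "v \<bullet> (x \<odot> w) = 0" by (simp add: L_sym)
  qed
  have disj: "u = 0" if "u \<in> V" "u \<in> W" for u
    using that by (auto simp: W_def)
  have VW: "v \<odot> w = 0" "w \<odot> v = 0" if "v \<in> V" "w \<in> W" for v w
    using that idV idW comm by (metis disj)+
  have decomp: "\<exists>v\<in>V. \<exists>w\<in>W. x = v + w" for x
  proof -
    have V: "span V = V" using sV by (simp add: span_eq_iff)
    obtain y z where yz: "y \<in> V" "\<And>w. w \<in> V \<Longrightarrow> orthogonal z w" "x = y + z"
      using orthogonal_subspace_decomp_exists[of V x] V by metis
    then have "z \<in> W" by (simp add: W_def orthogonal_def inner_commute)
    then show ?thesis using yz by blast
  qed
  \<comment> \<open>The components of e become the units of the two factors.\<close>
  obtain ev ew where e: "ev \<in> V" "ew \<in> W" "e = ev + ew" using decomp by blast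
  have "W = {0}"
  proof (rule ccontr)
    assume "W \<noteq> {0}"
    then have dims: "0 < dim V" "0 < dim W"
      using v0 subspace_0[OF sW] dim_eq_0[of V] dim_eq_0[of W] by (auto simp: V_def)
    have uV: "x \<odot> ev = x" if "x \<in> V" for x
      using unit_right[of x] VW(1)[OF that e(2)] e(3) by (simp add: bilin)
    have uW: "x \<odot> ew = x" if "x \<in> W" for x
      using unit_right[of x] VW(2)[OF e(1) that] e(3) by (simp add: bilin)
    have "euclidean_jordan_algebra_on V (\<odot>) ev"
      by (rule ideal_is_factor) (use sV idV e uV in auto)
    moreover have "euclidean_jordan_algebra_on W (\<odot>) ew"
      by (rule ideal_is_factor) (use sW idW e uW in auto)
    moreover define \<phi> :: "'a \<times> 'a \<Rightarrow> 'a" where "\<phi> p = fst p + snd p" for p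
    have "linear \<phi>" by (intro linearI) (auto simp: \<phi>_def algebra_simps)
    moreover have "bij_betw \<phi> (V \<times> W) UNIV"
      unfolding bij_betw_def
    proof
      show "inj_on \<phi> (V \<times> W)"
      proof (rule inj_onI)
        fix p p' assume p: "p \<in> V \<times> W" "p' \<in> V \<times> W" "\<phi> p = \<phi> p'"
        have eq: "fst p - fst p' = snd p' - snd p" using p(3) by (simp add: \<phi>_def algebra_simps)
        have "fst p - fst p' \<in> V" "snd p' - snd p \<in> W"
          using p sV sW by (auto intro: subspace_diff)
        then have "fst p - fst p' = 0" using disj eq by metis
        then show "p = p'" using eq by (simp add: prod_eq_iff)
      qed
      show "\<phi> ` (V \<times> W) = UNIV"
      proof -
        have "x \<in> \<phi> ` (V \<times> W)" for x
          using decomp[of x] by (auto simp: \<phi>_def image_iff)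
        then show ?thesis by blast
      qed
    qed
    moreover have "\<phi> (fst p \<odot> fst p', snd p \<odot> snd p') = \<phi> p \<odot> \<phi> p' \<and> \<phi> p \<bullet> \<phi> p' = p \<bullet> p'"
      if p: "p \<in> V \<times> W" "p' \<in> V \<times> W" for p p'
    proof -
      have m: "fst p \<in> V" "fst p' \<in> V" "snd p \<in> W" "snd p' \<in> W" using p by auto
      then have "fst p \<odot> snd p' = 0" "snd p \<odot> fst p' = 0" "fst p \<bullet> snd p' = 0" "snd p \<bullet> fst p' = 0"
        using VW by (auto simp: W_def inner_commute)
      then show ?thesis by (simp add: \<phi>_def bilin inner_add_left inner_add_right inner_prod_def)
    qed
    ultimately have "cartesian_product_decomposable (\<odot>)"
      unfolding cartesian_product_decomposable_def using dims by blast
    then show False using simple by blast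
  qed
  then have "e \<in> V" using e by simp
  then show thesis using that[of q] by (simp add: V_def)
qed

end

lemma (in multiplicative_on_cone) F_log_det:
  assumes "\<not> cartesian_product_decomposable (\<odot>)"
  obtains q where "\<And>x. x \<in> pd \<Longrightarrow> F x = q * (e \<bullet> fcalc ln x)"
proof -
  obtain m where m: "\<And>h. G h = m \<bullet> h" using linear_functional_inner[OF linear_G] by blast
  obtain q where "m = q *\<^sub>R e" using central_scalar[OF assms gradient_central[OF m]] by blast
  then show thesis using that[of q] F_eq_G_ln m by simp
qed

section \<open>The functional equation\<close>

context eja begin

lemma tendsto_jinv_shift:
  assumes d: "continuous_on pd d" and x: "x \<in> pd" and w: "w \<in> pd"
  shows "((\<lambda>t. d (jinv x - jinv (w + t *\<^sub>R e))) \<longlongrightarrow> (d (jinv x) :: real)) at_top"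
proof -
  have "isCont d (jinv x)" using d open_pd jinv_pd[OF x] by (simp add: continuous_on_eq_continuous_at)
  moreover have "((\<lambda>t. jinv x - jinv (w + t *\<^sub>R e)) \<longlongrightarrow> jinv x - 0) at_top"
    by (intro tendsto_intros jinv_tendsto_0 w)
  then have "((\<lambda>t. jinv x - jinv (w + t *\<^sub>R e)) \<longlongrightarrow> jinv x) at_top" by simp
  ultimately show ?thesis by (rule isCont_tendsto_compose)
qed

lemma shift_pd: "z \<in> psd \<Longrightarrow> t > 0 \<Longrightarrow> z + t *\<^sub>R e \<in> pd"
  using pd_add_psd[of "t *\<^sub>R e" z] by (simp add: add.commute)

text \<open>Letting \<open>y\<close> tend to infinity shows that the increments of \<open>a x - d (x\<^sup>-\<^sup>1)\<close> do not change
  when both arguments are translated.\<close>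

lemma equation_affine_part:
  fixes a b c d :: "'a \<Rightarrow> real"
  assumes cont: "continuous_on pd a" "continuous_on pd d"
    and eq: "\<And>x y. \<lbrakk>x \<in> pd; y \<in> pd\<rbrakk> \<Longrightarrow> a x + b y = c (jinv (x + y)) + d (jinv x - jinv (x + y))"
  obtains f \<kappa> where "\<And>x. x \<in> pd \<Longrightarrow> a x = d (jinv x) + f \<bullet> x + \<kappa>"
proof -
  define H where "H x = a x - d (jinv x)" for x
  have lim: "((\<lambda>t. c (jinv (x + (z + t *\<^sub>R e))) - c (jinv (x' + (z + t *\<^sub>R e)))) \<longlongrightarrow> H x - H x') at_top"
    if x: "x \<in> pd" "x' \<in> pd" "z \<in> psd" for x x' z
  proof -
    have "((\<lambda>t. (a x - d (jinv x - jinv ((x + z) + t *\<^sub>R e))) - (a x' - d (jinv x' - jinv ((x' + z) + t *\<^sub>R e))))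
        \<longlongrightarrow> (a x - d (jinv x)) - (a x' - d (jinv x'))) at_top"
      using x by (intro tendsto_intros tendsto_jinv_shift cont pd_add_psd)
    moreover have "\<forall>\<^sub>F t in at_top. (a x - d (jinv x - jinv ((x + z) + t *\<^sub>R e))) - (a x' - d (jinv x' - jinv ((x' + z) + t *\<^sub>R e)))
        = c (jinv (x + (z + t *\<^sub>R e))) - c (jinv (x' + (z + t *\<^sub>R e)))"
      using eventually_gt_at_top[of 0]
    proof eventually_elim
      case (elim t)
      then show ?case using eq[OF x(1) shift_pd[OF x(3) elim]] eq[OF x(2) shift_pd[OF x(3) elim]]
        by (simp add: add.assoc)
    qed
    ultimately show ?thesis unfolding H_def by (simp add: tendsto_cong)
  qed
  \<comment> \<open>One difference of values of c has two limits, according to whether z is counted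
    with the base points or with the ray.\<close>
  have shift: "H (x + z) - H (x' + z) = H x - H x'" if x: "x \<in> pd" "x' \<in> pd" "z \<in> pd" for x x' z
  proof -
    have "0 \<in> psd" by (simp add: psd_def bilin)
    then have "((\<lambda>t. c (jinv (x + (z + t *\<^sub>R e))) - c (jinv (x' + (z + t *\<^sub>R e)))) \<longlongrightarrow> H (x + z) - H (x' + z)) at_top"
      using lim[of "x + z" "x' + z" 0] x by (simp add: add.assoc)
    moreover have "((\<lambda>t. c (jinv (x + (z + t *\<^sub>R e))) - c (jinv (x' + (z + t *\<^sub>R e)))) \<longlongrightarrow> H x - H x') at_top"
      using x pd_subset_psd by (intro lim) auto
    ultimately show ?thesis by (rule tendsto_unique[OF trivial_limit_at_top_linorder])
  qed
  \<comment> \<open>By \<open>shift\<close> the increment of H along z is the same at every base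
    point, which makes A additive.\<close>
  define A where "A z = H (e + z) - H e" for z
  have H: "H (x + z) = H x + A z" if "x \<in> pd" "z \<in> pd" for x z
    using shift[of x e z] that by (simp add: A_def)
  have add: "A (x + y) = A x + A y" if "x \<in> pd" "y \<in> pd" for x y
    using H[of "e + x" y] that by (simp add: A_def add.assoc)
  have "continuous_on pd A"
  proof -
    have H: "continuous_on pd H" unfolding H_def
      by (intro continuous_intros cont continuous_on_compose2[OF cont(2) continuous_on_jinv]) auto
    then show ?thesis unfolding A_def
      by (intro continuous_intros continuous_on_compose2[OF H]) auto
  qed
  then obtain f where f: "\<And>x. x \<in> pd \<Longrightarrow> A x = f \<bullet> x"
    using additive_on_open_cone[OF open_pd unit_pd pd_add pd_scale add] by blast
  have "a x = d (jinv x) + f \<bullet> x + (H e - A e)" if "x \<in> pd" for x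
  proof -
    have "H x + A e = H e + A x" using H[OF that unit_pd] H[OF unit_pd that] by (simp add: add.commute)
    then show ?thesis using f[OF that] by (simp add: H_def)
  qed
  then show thesis using that by blast
qed

text \<open>The substituted arguments add up to \<open>jinv u\<close>, and the difference of their
  inverses is (u + v) - u = v: a and c trade places, as do b and d.\<close>

lemma equation_dual:
  assumes eq: "\<And>x y. \<lbrakk>x \<in> pd; y \<in> pd\<rbrakk> \<Longrightarrow> a x + b y = c (jinv (x + y)) + d (jinv x - jinv (x + y))"
    and uv: "u \<in> pd" "v \<in> pd"
  shows "c u + d v = a (jinv (u + v)) + b (jinv u - jinv (u + v))"
  using eq[of "jinv (u + v)" "jinv u - jinv (u + v)"] uv jinv_antimono[OF uv] by simp

text \<open>As y tends to infinity the left side tends to 0, so B (x + y) - B y tends to - k for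
  every x. An increment along e + e consists of two along e, hence - k = - 2 k.\<close>

lemma reduced_equation_constant:
  fixes D B :: "'a \<Rightarrow> real"
  assumes D: "continuous_on pd D"
    and eq: "\<And>x y. \<lbrakk>x \<in> pd; y \<in> pd\<rbrakk> \<Longrightarrow> D (jinv (jinv x - jinv (x + y))) - D x = B (x + y) - B y + k"
  shows "k = 0"
proof -
  have Dj: "continuous_on pd (\<lambda>u. D (jinv u))"
    by (intro continuous_on_compose2[OF D continuous_on_jinv]) auto
  have lim: "((\<lambda>t. B (x + (z + t *\<^sub>R e)) - B (z + t *\<^sub>R e)) \<longlongrightarrow> - k) at_top" if x: "x \<in> pd" "z \<in> psd" for x z
  proof -
    have "((\<lambda>t. D (jinv (jinv x - jinv ((x + z) + t *\<^sub>R e))) - D x - k) \<longlongrightarrow> D (jinv (jinv x)) - D x - k) at_top"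
      using x by (intro tendsto_intros tendsto_jinv_shift[OF Dj] pd_add_psd)
    moreover have "\<forall>\<^sub>F t in at_top. D (jinv (jinv x - jinv ((x + z) + t *\<^sub>R e))) - D x - k
        = B (x + (z + t *\<^sub>R e)) - B (z + t *\<^sub>R e)"
      using eventually_gt_at_top[of 0]
    proof eventually_elim
      case (elim t)
      then show ?case using eq[OF x(1) shift_pd[OF x(2) elim]] by (simp add: add.assoc)
    qed
    ultimately show ?thesis using x by (simp add: tendsto_cong)
  qed
  have 0: "0 \<in> psd" by (simp add: psd_def bilin)
  have "((\<lambda>t. (B (e + (e + t *\<^sub>R e)) - B (e + t *\<^sub>R e)) + (B (e + (0 + t *\<^sub>R e)) - B (0 + t *\<^sub>R e))) \<longlongrightarrow> - k + - k) at_top"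
    using pd_subset_psd 0 by (intro tendsto_add lim) auto
  moreover have "((\<lambda>t. B ((e + e) + (0 + t *\<^sub>R e)) - B (0 + t *\<^sub>R e)) \<longlongrightarrow> - k) at_top"
    using 0 by (intro lim) auto
  moreover have "(\<lambda>t. (B (e + (e + t *\<^sub>R e)) - B (e + t *\<^sub>R e)) + (B (e + (0 + t *\<^sub>R e)) - B (0 + t *\<^sub>R e)))
      = (\<lambda>t. B ((e + e) + (0 + t *\<^sub>R e)) - B (0 + t *\<^sub>R e))"
    by (simp add: add.assoc)
  ultimately have "- k + - k = - k"
    using tendsto_unique[OF trivial_limit_at_top_linorder] by metis
  then show ?thesis by simp
qed

text \<open>On a ray the inverse is a scalar reciprocal, and t + t^2 / y is the reciprocal of 1 / t
  - 1 / (t + y), so \<open>ray_equation\<close> applies.\<close>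

lemma reduced_equation_rays:
  fixes D B :: "'a \<Rightarrow> real"
  assumes cont: "continuous_on pd D" "continuous_on pd B"
    and eq: "\<And>x y. \<lbrakk>x \<in> pd; y \<in> pd\<rbrakk> \<Longrightarrow> D (jinv (jinv x - jinv (x + y))) - D x = B (x + y) - B y"
  obtains q where "continuous_on pd q"
    "\<And>x t. \<lbrakk>x \<in> pd; t > 0\<rbrakk> \<Longrightarrow> D (t *\<^sub>R x) = D x + q x * ln t"
    "\<And>x t. \<lbrakk>x \<in> pd; t > 0\<rbrakk> \<Longrightarrow> B (t *\<^sub>R x) = B x + q x * ln t"
proof -
  \<comment> \<open>Reading the coefficient off at t = exp 1 shows that it is continuous in
    x.\<close>
  define q where "q x = D (exp 1 *\<^sub>R x) - D x" for x
  have "D (t *\<^sub>R x) = D x + q x * ln t \<and> B (t *\<^sub>R x) = B x + q x * ln t" if x: "x \<in> pd" and t: "t > 0" for x t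
  proof -
    define \<phi> where "\<phi> t = D (t *\<^sub>R x)" for t
    define \<beta> where "\<beta> t = B (t *\<^sub>R x)" for t
    have "\<phi> (t + t\<^sup>2 / y) - \<phi> t = \<beta> (t + y) - \<beta> y" if ty: "t > 0" "y > 0" for t y
    proof -
      have "t *\<^sub>R x + y *\<^sub>R x = (t + y) *\<^sub>R x" by (simp add: scaleR_left_distrib)
      then have "jinv (t *\<^sub>R x) - jinv (t *\<^sub>R x + y *\<^sub>R x) = (1 / t - 1 / (t + y)) *\<^sub>R jinv x"
        using ty x by (simp add: jinv_scale scaleR_diff_left inverse_eq_divide)
      moreover have "1 / t - 1 / (t + y) = inverse (t + t\<^sup>2 / y)"
        using ty by (simp add: field_simps power2_eq_square)
      moreover have "t + t\<^sup>2 / y > 0" using ty by (intro add_pos_pos divide_pos_pos) auto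
      ultimately have "jinv (jinv (t *\<^sub>R x) - jinv (t *\<^sub>R x + y *\<^sub>R x)) = (t + t\<^sup>2 / y) *\<^sub>R x"
        using x by (simp add: jinv_scale)
      then show ?thesis using eq[of "t *\<^sub>R x" "y *\<^sub>R x"] x ty
        by (simp add: \<phi>_def \<beta>_def scaleR_left_distrib)
    qed
    moreover have "continuous_on {0<..} \<phi>" "continuous_on {0<..} \<beta>"
      unfolding \<phi>_def \<beta>_def using x
      by (auto intro!: continuous_on_compose2[OF cont(1)] continuous_on_compose2[OF cont(2)] continuous_intros)
    ultimately obtain p where p: "\<And>t. t > 0 \<Longrightarrow> \<phi> t = \<phi> 1 + p * ln t" "\<And>t. t > 0 \<Longrightarrow> \<beta> t = \<beta> 1 + p * ln t"
      using ray_equation[of \<phi> \<beta>] by metis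
    have "q x = p" using p(1)[of "exp 1"] by (simp add: q_def \<phi>_def)
    then show ?thesis using p t by (simp add: \<phi>_def \<beta>_def)
  qed
  moreover have "continuous_on pd q"
    unfolding q_def by (intro continuous_intros cont continuous_on_compose2[OF cont(1)]) auto
  ultimately show thesis using that by blast
qed

text \<open>Replacing \<open>y\<close> by \<open>t y\<close> and letting \<open>t\<close> tend to \<open>0\<close> turns the difference of inverses into the
  derivative of the inverse; the coefficient of \<open>ln t\<close> must vanish.\<close>

lemma reduced_equation_multiplicative:
  fixes D B :: "'a \<Rightarrow> real"
  assumes cont: "continuous_on pd D" "continuous_on pd B"
    and eq: "\<And>x y. \<lbrakk>x \<in> pd; y \<in> pd\<rbrakk> \<Longrightarrow> D (jinv (jinv x - jinv (x + y))) - D x = B (x + y) - B y"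
    and x: "x \<in> pd" and y: "y \<in> pd"
  shows "D (jinv (P (jinv x) y)) = D x + B x - B y"
proof -
  obtain q where q: "continuous_on pd q"
    "\<And>x t. \<lbrakk>x \<in> pd; t > 0\<rbrakk> \<Longrightarrow> D (t *\<^sub>R x) = D x + q x * ln t"
    "\<And>x t. \<lbrakk>x \<in> pd; t > 0\<rbrakk> \<Longrightarrow> B (t *\<^sub>R x) = B x + q x * ln t"
    using reduced_equation_rays[OF cont eq] by blast
  have at: "isCont D z" "isCont B z" "isCont q z" if "z \<in> pd" for z
    using cont q(1) open_pd that by (auto simp: continuous_on_eq_continuous_at)
  define w where "w x y t = (jinv x - jinv (x + t *\<^sub>R y)) /\<^sub>R t" for x y t
  define R where "R x y t = D (jinv (w x y t)) - D x - B (x + t *\<^sub>R y) + B y" for x y t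
  \<comment> \<open>Pulling the factor t out of the difference of inverses and out of t y produces a
    multiple of ln t on each side; R collects the other terms.\<close>
  have id: "(q (jinv (w x y t)) - q y) * ln t = R x y t" if "x \<in> pd" "y \<in> pd" "t > 0" for x y t
  proof -
    have ty: "t *\<^sub>R y \<in> pd" using that by simp
    have w: "w x y t \<in> pd" unfolding w_def using that jinv_antimono[OF that(1) ty] by simp
    have "jinv (jinv x - jinv (x + t *\<^sub>R y)) = jinv (t *\<^sub>R w x y t)" using that by (simp add: w_def)
    also have "\<dots> = (1 / t) *\<^sub>R jinv (w x y t)" using w that by (simp add: jinv_scale inverse_eq_divide)
    finally have "D (jinv (jinv x - jinv (x + t *\<^sub>R y))) = D (jinv (w x y t)) - q (jinv (w x y t)) * ln t"
      using q(2)[of "jinv (w x y t)" "1 / t"] w that by (simp add: ln_div)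
    then show ?thesis
      using eq[OF that(1) ty] q(3)[OF that(2,3)] by (simp add: R_def algebra_simps)
  qed
  have w_lim: "((\<lambda>t. jinv (w x y t)) \<longlongrightarrow> jinv (P (jinv x) y)) (at_right 0)" if "x \<in> pd" "y \<in> pd" for x y
  proof -
    have "((\<lambda>t. - ((jinv (x + t *\<^sub>R y) - jinv x) /\<^sub>R t)) \<longlongrightarrow> - (- P (jinv x) y)) (at_right 0)"
      by (intro tendsto_minus tendsto_within_subset[OF jinv_derivative]) (use that in auto)
    then have "(w x y \<longlongrightarrow> P (jinv x) y) (at_right 0)"
      by (simp add: w_def[abs_def] flip: scaleR_minus_right)
    then show ?thesis using that by (intro isCont_tendsto_compose[OF isCont_jinv] P_pd) auto
  qed
  have R_lim: "(R x y \<longlongrightarrow> D (jinv (P (jinv x) y)) - D x - B x + B y) (at_right 0)" if "x \<in> pd" "y \<in> pd" for x y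
  proof -
    have "((\<lambda>t. x + t *\<^sub>R y) \<longlongrightarrow> x + 0 *\<^sub>R y) (at_right 0)" by (intro tendsto_intros)
    then have "((\<lambda>t. B (x + t *\<^sub>R y)) \<longlongrightarrow> B x) (at_right 0)"
      using isCont_tendsto_compose[OF at(2)[OF that(1)]] by simp
    moreover have "((\<lambda>t. D (jinv (w x y t))) \<longlongrightarrow> D (jinv (P (jinv x) y))) (at_right 0)"
      using that by (intro isCont_tendsto_compose[OF at(1)] w_lim jinv_pd P_pd)
    ultimately show ?thesis unfolding R_def[abs_def] by (intro tendsto_intros)
  qed
  have small: "\<forall>\<^sub>F t in at_right (0::real). t > 0 \<and> t < 1"
    by (auto simp: eventually_at_right_field intro!: exI[of _ 1])
  have q_inv: "q (jinv (P (jinv x) y)) = q y" if "x \<in> pd" "y \<in> pd" for x y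
  proof -
    \<comment> \<open>R has a finite limit while ln t is unbounded, so the difference of the
      coefficients tends to 0.\<close>
    have "((\<lambda>t. R x y t / ln t) \<longlongrightarrow> 0) (at_right 0)"
      by (intro tendsto_divide_0[OF R_lim[OF that]] filterlim_mono[OF ln_at_0] at_bot_le_at_infinity) simp
    moreover have "\<forall>\<^sub>F t in at_right 0. R x y t / ln t = q (jinv (w x y t)) - q y"
      using small
    proof eventually_elim
      case (elim t)
      then have "ln t \<noteq> 0" by simp
      then show ?case using id[OF that, of t] elim by (simp add: field_simps)
    qed
    ultimately have "((\<lambda>t. q (jinv (w x y t)) - q y) \<longlongrightarrow> 0) (at_right 0)" by (simp add: tendsto_cong)
    moreover have "((\<lambda>t. q (jinv (w x y t)) - q y) \<longlongrightarrow> q (jinv (P (jinv x) y)) - q y) (at_right 0)"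
      using that by (intro tendsto_intros isCont_tendsto_compose[OF at(3)] w_lim jinv_pd P_pd)
    ultimately have "0 = q (jinv (P (jinv x) y)) - q y" by (rule tendsto_unique[rotated]) simp
    then show ?thesis by simp
  qed
  \<comment> \<open>Every z in \<open>pd\<close> has the form \<open>jinv (s \<odot> s)\<close>, the
    image of e under the transformations that leave q invariant.\<close>
  have q_const: "q z = q e" if z: "z \<in> pd" for z
  proof -
    obtain s where s: "s \<in> pd" "s \<odot> s = jinv z" using pd_sqrt[OF jinv_pd[OF z]] by blast
    then show ?thesis using q_inv[of "jinv s" e] z by simp
  qed
  have "\<forall>\<^sub>F t in at_right 0. R x y t = 0"
    using small
  proof eventually_elim
    case (elim t)
    have "w x y t \<in> pd" unfolding w_def using elim x y jinv_antimono[of x "t *\<^sub>R y"] by simp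
    then show ?case using id[OF x y, of t] elim q_const[of "jinv (w x y t)"] q_const[OF y] by simp
  qed
  then have "(R x y \<longlongrightarrow> 0) (at_right 0)" by (simp add: tendsto_eventually)
  then have "0 = D (jinv (P (jinv x) y)) - D x - B x + B y"
    using R_lim[OF x y] by (rule tendsto_unique[rotated]) simp
  then show ?thesis by simp
qed

text \<open>The case x = e of the multiplicative relation shows that inversion exchanges F and F' up
  to sign. It remains to prove F = F', which suffices on squares since every element of
  \<open>pd\<close> is one.\<close>

lemma reduced_equation_solution:
  fixes D B :: "'a \<Rightarrow> real"
  assumes simple: "\<not> cartesian_product_decomposable (\<odot>)"
    and cont: "continuous_on pd D" "continuous_on pd B"
    and eq: "\<And>x y. \<lbrakk>x \<in> pd; y \<in> pd\<rbrakk> \<Longrightarrow> D (jinv (jinv x - jinv (x + y))) - D x = B (x + y) - B y"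
  obtains q where "\<And>x. x \<in> pd \<Longrightarrow> D x = D e + q * (e \<bullet> fcalc ln x)"
    "\<And>x. x \<in> pd \<Longrightarrow> B x = B e + q * (e \<bullet> fcalc ln x)" "\<And>x. x \<in> pd \<Longrightarrow> D (jinv x) - D e = - (D x - D e)"
proof -
  note mult = reduced_equation_multiplicative[OF cont eq]
  define F where "F x = D x - D e" for x
  define F' where "F' x = B x - B e" for x
  have inv: "F (jinv y) = - F' y" if "y \<in> pd" for y
    using mult[of e y] that by (simp add: F_def F'_def)
  have inv': "F' (jinv y) = - F y" if "y \<in> pd" for y
    using inv[of "jinv y"] that by simp
  have mult': "F' (P x y) = F' y + F' x + F x" if "x \<in> pd" "y \<in> pd" for x y
  proof -
    have "F (jinv (P x y)) = F (jinv x) + F' (jinv x) - F' y"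
      using mult[of "jinv x" y] that by (simp add: F_def F'_def)
    then show ?thesis using inv[of "P x y"] inv[of x] inv'[of x] that P_pd by simp
  qed
  have sq: "F' (x \<odot> x) = F' x + F x" if "x \<in> pd" for x
    using mult'[of x e] that by (simp add: F'_def)
  \<comment> \<open>The fourth power of x is both P x (x \<odot> x) and a square of a square; the
    two evaluations of F' are compared.\<close>
  have "F' (x \<odot> x) = F (x \<odot> x)" if x: "x \<in> pd" for x
  proof -
    have "P x (x \<odot> x) = (x \<odot> x) \<odot> (x \<odot> x)"
      using P_pow[of x 2] pow_add[of x 2 2] by (simp add: eval_nat_numeral)
    then show ?thesis using mult'[of x "x \<odot> x"] sq[of "x \<odot> x"] sq[OF x] x pd_square[OF x] by simp
  qed
  then have FF': "F' x = F x" if "x \<in> pd" for x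
    using pd_sqrt[OF that] by metis
  interpret multiplicative_on_cone "(\<odot>)" e F
  proof
    show "F (P x y) = 2 * F x + F y" if "x \<in> pd" "y \<in> pd" for x y
      using mult'[OF that] FF' that P_pd by simp
    show "continuous_on pd F" unfolding F_def by (intro continuous_intros cont)
  qed
  obtain q where q: "\<And>x. x \<in> pd \<Longrightarrow> F x = q * (e \<bullet> fcalc ln x)"
    using F_log_det[OF simple] by blast
  show thesis
  proof (rule that[of q])
    show "D x = D e + q * (e \<bullet> fcalc ln x)" if "x \<in> pd" for x
      using q[OF that] by (simp add: F_def)
    show "B x = B e + q * (e \<bullet> fcalc ln x)" if "x \<in> pd" for x
      using q[OF that] FF'[OF that] by (simp add: F'_def)
    show "D (jinv x) - D e = - (D x - D e)" if "x \<in> pd" for x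
      using F_jinv[OF that] by (simp add: F_def)
  qed
qed

end

theorem theorem4p5:
  fixes mul :: "'a::euclidean_space \<Rightarrow> 'a \<Rightarrow> 'a" and e :: 'a
    and \<Omega> :: "'a set"
    and inv :: "'a \<Rightarrow> 'a" and det :: "'a \<Rightarrow> real"
    and a b c d :: "'a \<Rightarrow> real"
  defines "\<Omega> \<equiv> symmetric_cone mul"
    and "inv \<equiv> jordan_inverse mul e"
    and "det \<equiv> jordan_det mul e"
  assumes simple: "simple_euclidean_jordan_algebra mul e"
    and canonical: "\<And>x y. x \<bullet> y = jordan_tr mul e (mul x y)"
    and cont: "continuous_on \<Omega> a" "continuous_on \<Omega> b" "continuous_on \<Omega> c" "continuous_on \<Omega> d"
    and eq: "\<And>x y. \<lbrakk>x \<in> \<Omega>; y \<in> \<Omega>\<rbrakk> \<Longrightarrow>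
      a x + b y = c (inv (x + y)) + d (inv x - inv (x + y))"
  shows "\<exists>(q::real) (f::'a) (g::'a) (\<gamma>\<^sub>1::real) (\<gamma>\<^sub>2::real) (\<gamma>\<^sub>3::real). \<forall>x\<in>\<Omega>.
      a x = q * ln (det x) + f \<bullet> x + g \<bullet> inv x + \<gamma>\<^sub>1 + \<gamma>\<^sub>3 \<and>
      b x = - q * ln (det x) + f \<bullet> x + \<gamma>\<^sub>2 \<and>
      c x = q * ln (det x) + g \<bullet> x + f \<bullet> inv x + \<gamma>\<^sub>3 \<and>
      d x = - q * ln (det x) + g \<bullet> x + \<gamma>\<^sub>1 + \<gamma>\<^sub>2"
proof -
  interpret eja mul e
    using simple unfolding simple_euclidean_jordan_algebra_def eja_def by simp
  have indecomposable: "\<not> cartesian_product_decomposable mul"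
    using simple unfolding simple_euclidean_jordan_algebra_def by blast
  have \<Omega>: "\<Omega> = pd" unfolding \<Omega>_def by (rule symmetric_cone_eq)
  have inv: "inv x = jinv x" for x unfolding inv_def by (rule jordan_inverse_eq)
  have det: "ln (det x) = e \<bullet> fcalc ln x" if "x \<in> pd" for x
    unfolding det_def using jordan_det_eq[OF canonical that] by simp
  note cont = cont[unfolded \<Omega>] and eq = eq[unfolded \<Omega> inv]
  obtain f \<kappa> where f: "\<And>x. x \<in> pd \<Longrightarrow> a x = d (jinv x) + f \<bullet> x + \<kappa>"
    using equation_affine_part[OF cont(1,4) eq] by blast
  obtain g \<mu> where g: "\<And>x. x \<in> pd \<Longrightarrow> c x = b (jinv x) + g \<bullet> x + \<mu>"
    using equation_affine_part[OF cont(3,2) equation_dual[of a b c d, OF eq]] by blast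
  \<comment> \<open>Once both affine relations are inserted, the terms with f and g are absorbed by
    B and D; only \<kappa> - \<mu> is left over.\<close>
  define D where "D x = d (jinv x) - g \<bullet> jinv x" for x
  define B where "B x = f \<bullet> x - b x" for x
  have D: "continuous_on pd D" unfolding D_def
    by (intro continuous_intros continuous_on_compose2[OF cont(4) continuous_on_jinv] continuous_on_jinv) auto
  have B: "continuous_on pd B" unfolding B_def by (intro continuous_intros cont)
  have red: "D (jinv (jinv x - jinv (x + y))) - D x = B (x + y) - B y + (\<kappa> - \<mu>)"
    if "x \<in> pd" "y \<in> pd" for x y
    using eq[OF that] f[OF that(1)] g[of "jinv (x + y)"] that jinv_antimono[OF that]
    by (simp add: D_def B_def inner_diff_right inner_add_right)
  have k: "\<kappa> = \<mu>" using reduced_equation_constant[OF D red] by simp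
  have "D (jinv (jinv x - jinv (x + y))) - D x = B (x + y) - B y" if "x \<in> pd" "y \<in> pd" for x y
    using red[OF that] k by simp
  then obtain q where q: "\<And>x. x \<in> pd \<Longrightarrow> D x = D e + q * (e \<bullet> fcalc ln x)"
    "\<And>x. x \<in> pd \<Longrightarrow> B x = B e + q * (e \<bullet> fcalc ln x)"
    "\<And>x. x \<in> pd \<Longrightarrow> D (jinv x) - D e = - (D x - D e)"
    using reduced_equation_solution[OF indecomposable D B] by blast
  show ?thesis
  proof (intro exI ballI conjI)
    fix x assume "x \<in> \<Omega>"
    then have x: "x \<in> pd" "jinv x \<in> pd" by (auto simp: \<Omega>)
    let ?l = "e \<bullet> fcalc ln x"
    have l: "ln (det x) = ?l" by (rule det[OF x(1)])
    have dj: "d (jinv x) = D e + q * ?l + g \<bullet> jinv x" using q(1)[OF x(1)] by (simp add: D_def)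
    have dx: "d x = D e - q * ?l + g \<bullet> x" using q(1)[OF x(1)] q(3)[OF x(1)] x by (simp add: D_def)
    have bx: "b x = f \<bullet> x - B e - q * ?l" using q(2)[OF x(1)] by (simp add: B_def)
    have "q * (e \<bullet> fcalc ln (jinv x)) = - (q * ?l)"
      using q(1)[OF x(1)] q(1)[OF x(2)] q(3)[OF x(1)] by simp
    then have bj: "b (jinv x) = f \<bullet> jinv x - B e + q * ?l" using q(2)[OF x(2)] by (simp add: B_def)
    \<comment> \<open>The constants are \<open>\<gamma>\<^sub>1\<close> = D e + B e,
      \<open>\<gamma>\<^sub>2\<close> = - B e and \<open>\<gamma>\<^sub>3\<close> = \<kappa> - B e;
      \<open>\<gamma>\<^sub>1\<close> is forced by
      \<open>\<gamma>\<^sub>1 + \<gamma>\<^sub>2\<close> = D e in the formula for d.\<close>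
    show "a x = q * ln (det x) + f \<bullet> x + g \<bullet> inv x + (D e + B e) + (\<kappa> - B e)"
      unfolding f[OF x(1)] dj inv l by simp
    show "b x = - q * ln (det x) + f \<bullet> x + (- B e)"
      unfolding bx l by simp
    show "c x = q * ln (det x) + g \<bullet> x + f \<bullet> inv x + (\<kappa> - B e)"
      unfolding g[OF x(1)] bj inv l k by simp
    show "d x = - q * ln (det x) + g \<bullet> x + (D e + B e) + (- B e)"
      unfolding dx l by simp
  qed
qed

end
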